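(* Let $n>1$ and $1\le k\le n$, and consider a $k$-out-of-$n$:F system (it is failed iff $k$ or more of its $n$ components are failed) whose components' lifetimes follow a Lévy-frailty Marshall-Olkin (LFMO) distribution with Laplace exponent $\Psi$. All failed components can be instantaneously repaired, at cost $c_{cmp}(j)$ for repairing $j$ failed components, plus an additional cost $c_{sys}$ if the system has also failed. For a given $1\le r\le n$, consider the repair policy in which all failed components are instantly repaired when the system fails or when $r$ or more of its components have failed. Write $a\wedge b=\min\{a,b\}$. Then: 1. The probability $p^{(r)}$ that the first repair is due to a system failure is $p^{(r)}=F_{[0,r-1],[k,n]}$ if $k>r$, and $p^{(r)}=1$ if $k\le r$. 2. Letting $C[0,t]$ be the cumulative cost of operating the system up to time $t$, the long-term mean cost is $$\lim_{t\to\infty}\frac{C[0,t]}{t}=\frac{p^{(r)}c_{sys}+\sum_{j=k\wedge r}^n F_{[0,(k\wedge r)-1],j}\,c_{cmp}(j)}{\mathbb E[T_{k\wedge r:n}]}\quad\text{almost surely},$$ where $\mathbb E[T_{m:n}]=\sum_{i=n-m+1}^n\binom ni\binom{i-1}{n-m}(-1)^{i-n+m-1}\frac1{\Psi(i)}$ for $1\le m\le n$. 3. The mean times until the first repair and until the first system failure are, respectively, $\mathbb E[T_{k\wedge r:n}]$ and $\mathbb E[T_{k\wedge r:n}]/p^{(r)}$ (the latter being $+\infty$ if $p^{(r)}=0$). 4. The rates at which repairs, system failures, and components' failures occur are, respectively, $1/\mathbb E[T_{k\wedge r:n}]$, $p^{(r)}/\mathbb E[T_{k\wedge r:n}]$ and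 $\sum_{j=1}^n F_{[0,(k\wedge r)-1],j}\,j\,/\,\mathbb E[T_{k\wedge r:n}]$.
   Context: **LFMO lifetimes.** $\mathbf L=(L_t)_{t\ge0}$ is a (real-valued) Lévy subordinator, i.e. a nondecreasing Lévy process with $L_0=0$, not identically zero, with Laplace exponent $\Psi(x)=-\log\mathbb E[e^{-xL_1}]$ (so $\Psi(0)=0$). $\varepsilon_1,\dots,\varepsilon_n$ are iid standard exponential, independent of $\mathbf L$. Without repairs, component $i$ fails at $T_i:=\inf\{t\ge0:L_t>\varepsilon_i\}$; the law of $(T_1,\dots,T_n)$ is called LFMO. $T_{1:n}\le\dots\le T_{n:n}$ are the ordered values of $T_1,\dots,T_n$ (no-repair setting). **Probabilities $F$.** For $1\le m\le l$ let $\lambda_m^{(l)}:=\sum_{i=0}^{m-1}\binom{m-1}{i}(-1)^i(\Psi(l-m+i+1)-\Psi(l-m+i))$. For $0\le i<j\le n$ let $P_{i,j}:=\binom{n-i}{j-i}\lambda_{j-i}^{(n-i)}/\Psi(n-i)$. Define recursively $F_{[0,0],j}:=P_{0,j}$ for $j>0$; $F_{[0,i],j}:=F_{[0,i-1],j}+F_{[0,i-1],i}P_{i,j}$ for $i\ge1$, $j>i$; and $F_{[0,i],j}:=0$ for $j\le i$. Let $F_{[0,i],[j,m]}:=\sum_{l=j}^mF_{[0,i],l}$. **Repair dynamics.** At time $0$ all components work. Failures are detected instantly; repairs are instantaneous and perfect (a repaired component is as good as new); costs are deterministic real numbers. Formally, let $E_{i,m}$ ($1\le i\le n$, $m\ge0$)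 be iid standard exponential, independent of $\mathbf L$; put $T_{rep}[0]=0$, $\varepsilon_i[0]=E_{i,0}$, and inductively for $m\ge0$: after the $m$-th repair, component $i$ is failed at time $t$ iff $L_t\ge\varepsilon_i[m]$; the $(m+1)$-th repair occurs at the first time $T_{rep}[m+1]>T_{rep}[m]$ at which $r$ or more components are failed or the system is failed; and $\varepsilon_i[m+1]=L_{T_{rep}[m+1]}+E_{i,m+1}$ if component $i$ is failed at $T_{rep}[m+1]$, $\varepsilon_i[m+1]=\varepsilon_i[m]$ otherwise. A repair is "due to a system failure" if the system is failed at that time (just before the repair). $C[0,t]$ is the sum of the costs of all repairs made in $[0,t]$. The rate at which an event (repair, system failure, failure of a component) occurs is the almost sure limit, as $t\to\infty$, of the number of its occurrences in $[0,t]$ divided by $t$; components failing simultaneously are counted individually. *)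

theory Defs
  imports "HOL-Probability.Probability"
begin

section \<open>Subordinators and LFMO lifetimes\<close>

text \<open>The regularity of the paths is required for every outcome and not only almost surely, so
  that first passage times are measurable without a completeness assumption on \<open>M\<close>.
  Stochastic continuity follows from right-continuity and stationary increments.\<close>

definition levy_process :: "'a measure \<Rightarrow> (real \<Rightarrow> 'a \<Rightarrow> real) \<Rightarrow> bool" where
  "levy_process M L \<longleftrightarrow>
     prob_space M \<and>
     (\<forall>t\<ge>0. L t \<in> borel_measurable M) \<and>
     (\<forall>\<omega>\<in>space M. L 0 \<omega> = 0) \<and>
     (\<forall>\<omega>\<in>space M. \<forall>t\<ge>0. continuous (at_right t) (\<lambda>s. L s \<omega>)) \<and>
     (\<forall>\<omega>\<in>space M. \<forall>t>0. \<exists>l. ((\<lambda>s. L s \<omega>) \<longlongrightarrow> l) (at_left t)) \<and>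
     (\<forall>(u :: nat \<Rightarrow> real) m. 0 \<le> u 0 \<longrightarrow> (\<forall>j<m. u j \<le> u (Suc j)) \<longrightarrow>
        prob_space.indep_vars M (\<lambda>_. borel) (\<lambda>j \<omega>. L (u (Suc j)) \<omega> - L (u j) \<omega>) {..<m}) \<and>
     (\<forall>s\<ge>0. \<forall>h\<ge>0. distr M borel (\<lambda>\<omega>. L (s + h) \<omega> - L s \<omega>) = distr M borel (L h))"

definition levy_subordinator :: "'a measure \<Rightarrow> (real \<Rightarrow> 'a \<Rightarrow> real) \<Rightarrow> bool" where
  "levy_subordinator M L \<longleftrightarrow>
     levy_process M L \<and>
     (\<forall>\<omega>\<in>space M. \<forall>s t. 0 \<le> s \<longrightarrow> s \<le> t \<longrightarrow> L s \<omega> \<le> L t \<omega>) \<and>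
     (\<exists>t\<ge>0. \<not> (AE \<omega> in M. L t \<omega> = 0))"

definition laplace_exponent :: "'a measure \<Rightarrow> (real \<Rightarrow> 'a \<Rightarrow> real) \<Rightarrow> real \<Rightarrow> real" where
  "laplace_exponent M L x = - ln (prob_space.expectation M (\<lambda>\<omega>. exp (- x * L 1 \<omega>)))"

text \<open>The family \<open>X\<close> consists of iid standard exponentials and is, as a whole, independent of the
  whole process \<open>L\<close>: the generated \<open>\<sigma>\<close>-algebras are independent
  (\<open>indep_var\<close> is not applicable because it needs a common type of values).\<close>

definition iid_std_exp_indep_of ::
  "'a measure \<Rightarrow> (real \<Rightarrow> 'a \<Rightarrow> real) \<Rightarrow> 'i set \<Rightarrow> ('i \<Rightarrow> 'a \<Rightarrow> real) \<Rightarrow> bool" where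
  "iid_std_exp_indep_of M L I X \<longleftrightarrow>
     (\<forall>i\<in>I. distributed M lborel (X i) (exponential_density 1)) \<and>
     prob_space.indep_vars M (\<lambda>_. borel) X I \<and>
     prob_space.indep_set M
       (sets (vimage_algebra (space M) (\<lambda>\<omega>. \<lambda>t\<in>{0..}. L t \<omega>) (PiM {0..} (\<lambda>_. borel))))
       (sets (vimage_algebra (space M) (\<lambda>\<omega>. \<lambda>i\<in>I. X i \<omega>) (PiM I (\<lambda>_. borel))))"

text \<open>Random times take values in \<^typ>\<open>ennreal\<close>, so that the infimum of the empty set is
  \<open>\<infinity>\<close>.\<close>

definition lfmo_lifetime ::
  "(real \<Rightarrow> 'a \<Rightarrow> real) \<Rightarrow> (nat \<Rightarrow> 'a \<Rightarrow> real) \<Rightarrow> nat \<Rightarrow> 'a \<Rightarrow> ennreal" where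
  "lfmo_lifetime L eps i \<omega> = Inf {ennreal t | t. 0 \<le> t \<and> L t \<omega> > eps i \<omega>}"

text \<open>\<open>T\<^bsub>m:n\<^esub>\<close>, for \<open>1 \<le> m \<le> n\<close>.\<close>

definition lfmo_order_stat ::
  "(real \<Rightarrow> 'a \<Rightarrow> real) \<Rightarrow> (nat \<Rightarrow> 'a \<Rightarrow> real) \<Rightarrow> nat \<Rightarrow> nat \<Rightarrow> 'a \<Rightarrow> ennreal" where
  "lfmo_order_stat L eps n m \<omega> =
     sort (map (\<lambda>i. lfmo_lifetime L eps i \<omega>) [1..<Suc n]) ! (m - 1)"

definition mean_order_stat ::
  "'a measure \<Rightarrow> (real \<Rightarrow> 'a \<Rightarrow> real) \<Rightarrow> (nat \<Rightarrow> 'a \<Rightarrow> real) \<Rightarrow> nat \<Rightarrow> nat \<Rightarrow> ennreal" where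
  "mean_order_stat M L eps n m = (\<integral>\<^sup>+ \<omega>. lfmo_order_stat L eps n m \<omega> \<partial>M)"

section \<open>The probabilities \<open>F\<close>\<close>

text \<open>\<open>\<lambda>\<^sub>m\<close> with upper index \<open>l\<close>, for \<open>1 \<le> m \<le> l\<close>.\<close>

definition lfmo_rate :: "(real \<Rightarrow> real) \<Rightarrow> nat \<Rightarrow> nat \<Rightarrow> real" where
  "lfmo_rate \<Psi> l m = (\<Sum>i = 0..m - 1. real (m - 1 choose i) * (- 1) ^ i *
     (\<Psi> (real (l - m + i + 1)) - \<Psi> (real (l - m + i))))"

definition trans_prob :: "(real \<Rightarrow> real) \<Rightarrow> nat \<Rightarrow> nat \<Rightarrow> nat \<Rightarrow> real" where
  "trans_prob \<Psi> n i j = real (n - i choose (j - i)) * lfmo_rate \<Psi> (n - i) (j - i) / \<Psi> (real (n - i))"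

text \<open>\<open>F_prob \<Psi> n i j\<close> is \<open>F\<^bsub>[0,i],j\<^esub>\<close> and \<open>F_prob_range \<Psi> n i j m\<close> is \<open>F\<^bsub>[0,i],[j,m]\<^esub>\<close>.\<close>

fun F_prob :: "(real \<Rightarrow> real) \<Rightarrow> nat \<Rightarrow> nat \<Rightarrow> nat \<Rightarrow> real" where
  "F_prob \<Psi> n 0 j = (if j > 0 then trans_prob \<Psi> n 0 j else 0)"
| "F_prob \<Psi> n (Suc i) j =
     (if j > Suc i
      then F_prob \<Psi> n i j + F_prob \<Psi> n i (Suc i) * trans_prob \<Psi> n (Suc i) j
      else 0)"

definition F_prob_range :: "(real \<Rightarrow> real) \<Rightarrow> nat \<Rightarrow> nat \<Rightarrow> nat \<Rightarrow> nat \<Rightarrow> real" where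
  "F_prob_range \<Psi> n i j m = (\<Sum>l = j..m. F_prob \<Psi> n i l)"

section \<open>Repair dynamics\<close>

definition num_failed :: "(real \<Rightarrow> 'a \<Rightarrow> real) \<Rightarrow> nat \<Rightarrow> (nat \<Rightarrow> real) \<Rightarrow> real \<Rightarrow> 'a \<Rightarrow> nat" where
  "num_failed L n thr t \<omega> = card {i \<in> {1..n}. L t \<omega> \<ge> thr i}"

text \<open>\<open>repair_time L E n k r m \<omega>\<close> is \<open>T\<^sub>r\<^sub>e\<^sub>p[m]\<close> and \<open>threshold L E n k r m i \<omega>\<close> is
  \<open>\<epsilon>\<^sub>i[m]\<close>. A repair that never takes place has time \<open>\<infinity>\<close>; the thresholds computed after it (from
  the junk value \<open>enn2real \<infinity> = 0\<close>) are irrelevant, because then all later repair times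
  are \<open>\<infinity>\<close> as well.\<close>

function repair_time ::
    "(real \<Rightarrow> 'a \<Rightarrow> real) \<Rightarrow> (nat \<Rightarrow> nat \<Rightarrow> 'a \<Rightarrow> real) \<Rightarrow> nat \<Rightarrow> nat \<Rightarrow> nat \<Rightarrow> nat \<Rightarrow> 'a \<Rightarrow> ennreal"
  and threshold ::
    "(real \<Rightarrow> 'a \<Rightarrow> real) \<Rightarrow> (nat \<Rightarrow> nat \<Rightarrow> 'a \<Rightarrow> real) \<Rightarrow> nat \<Rightarrow> nat \<Rightarrow> nat \<Rightarrow> nat \<Rightarrow> nat \<Rightarrow> 'a \<Rightarrow> real"
where
  "repair_time L E n k r 0 \<omega> = 0"
| "repair_time L E n k r (Suc m) \<omega> =
     Inf {ennreal t | t. 0 \<le> t \<and> ennreal t > repair_time L E n k r m \<omega> \<and>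
       (r \<le> num_failed L n (\<lambda>i. threshold L E n k r m i \<omega>) t \<omega> \<or>
        k \<le> num_failed L n (\<lambda>i. threshold L E n k r m i \<omega>) t \<omega>)}"
| "threshold L E n k r 0 i \<omega> = E i 0 \<omega>"
| "threshold L E n k r (Suc m) i \<omega> =
     (let l = L (enn2real (repair_time L E n k r (Suc m) \<omega>)) \<omega>
      in if l \<ge> threshold L E n k r m i \<omega> then l + E i (Suc m) \<omega>
         else threshold L E n k r m i \<omega>)"
  by pat_completeness auto
termination
  by (relation "Wellfounded.measure (\<lambda>x. case x of
        Inl (_, _, _, _, _, m, _) \<Rightarrow> 2 * m
      | Inr (_, _, _, _, _, m, _, _) \<Rightarrow> 2 * m + 1)") auto

text \<open>In the following, \<open>m \<ge> 1\<close> is the number of a repair; just before it, the thresholds are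
  those with index \<open>m - 1\<close>.\<close>

definition num_repaired ::
  "(real \<Rightarrow> 'a \<Rightarrow> real) \<Rightarrow> (nat \<Rightarrow> nat \<Rightarrow> 'a \<Rightarrow> real) \<Rightarrow> nat \<Rightarrow> nat \<Rightarrow> nat \<Rightarrow> nat \<Rightarrow> 'a \<Rightarrow> nat" where
  "num_repaired L E n k r m \<omega> =
     num_failed L n (\<lambda>i. threshold L E n k r (m - 1) i \<omega>)
       (enn2real (repair_time L E n k r m \<omega>)) \<omega>"

definition due_to_system_failure ::
  "(real \<Rightarrow> 'a \<Rightarrow> real) \<Rightarrow> (nat \<Rightarrow> nat \<Rightarrow> 'a \<Rightarrow> real) \<Rightarrow> nat \<Rightarrow> nat \<Rightarrow> nat \<Rightarrow> nat \<Rightarrow> 'a \<Rightarrow> bool" where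
  "due_to_system_failure L E n k r m \<omega> \<longleftrightarrow>
     repair_time L E n k r m \<omega> < \<infinity> \<and> k \<le> num_repaired L E n k r m \<omega>"

definition prob_first_repair_system_failure ::
  "'a measure \<Rightarrow> (real \<Rightarrow> 'a \<Rightarrow> real) \<Rightarrow> (nat \<Rightarrow> nat \<Rightarrow> 'a \<Rightarrow> real) \<Rightarrow> nat \<Rightarrow> nat \<Rightarrow> nat \<Rightarrow> real" where
  "prob_first_repair_system_failure M L E n k r =
     measure M {\<omega> \<in> space M. due_to_system_failure L E n k r 1 \<omega>}"

text \<open>A system failure is repaired at once, so the system failures take place exactly at
  the repairs that are due to one.\<close>

definition first_system_failure_time ::
  "(real \<Rightarrow> 'a \<Rightarrow> real) \<Rightarrow> (nat \<Rightarrow> nat \<Rightarrow> 'a \<Rightarrow> real) \<Rightarrow> nat \<Rightarrow> nat \<Rightarrow> nat \<Rightarrow> 'a \<Rightarrow> ennreal" where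
  "first_system_failure_time L E n k r \<omega> =
     Inf {repair_time L E n k r m \<omega> | m. 1 \<le> m \<and> due_to_system_failure L E n k r m \<omega>}"

definition repairs_until ::
  "(real \<Rightarrow> 'a \<Rightarrow> real) \<Rightarrow> (nat \<Rightarrow> nat \<Rightarrow> 'a \<Rightarrow> real) \<Rightarrow> nat \<Rightarrow> nat \<Rightarrow> nat \<Rightarrow> real \<Rightarrow> 'a \<Rightarrow> nat set" where
  "repairs_until L E n k r t \<omega> = {m. 1 \<le> m \<and> repair_time L E n k r m \<omega> \<le> ennreal t}"

definition system_failures_until ::
  "(real \<Rightarrow> 'a \<Rightarrow> real) \<Rightarrow> (nat \<Rightarrow> nat \<Rightarrow> 'a \<Rightarrow> real) \<Rightarrow> nat \<Rightarrow> nat \<Rightarrow> nat \<Rightarrow> real \<Rightarrow> 'a \<Rightarrow> nat set" where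
  "system_failures_until L E n k r t \<omega> =
     {m \<in> repairs_until L E n k r t \<omega>. due_to_system_failure L E n k r m \<omega>}"

text \<open>A component fails at most once between two consecutive repairs. It does so between repair
  \<open>m\<close> (excluded) and repair \<open>m + 1\<close> (included) iff its failure time computed with the
  thresholds after repair \<open>m\<close> does not exceed the time of repair \<open>m + 1\<close>; this also counts the
  failures of components that are still waiting for a repair at time \<open>t\<close>.\<close>

definition component_failure_time ::
  "(real \<Rightarrow> 'a \<Rightarrow> real) \<Rightarrow> (nat \<Rightarrow> nat \<Rightarrow> 'a \<Rightarrow> real) \<Rightarrow> nat \<Rightarrow> nat \<Rightarrow> nat \<Rightarrow> nat \<Rightarrow> nat \<Rightarrow> 'a \<Rightarrow> ennreal" where
  "component_failure_time L E n k r m i \<omega> =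
     Inf {ennreal t | t. 0 \<le> t \<and> ennreal t > repair_time L E n k r m \<omega> \<and>
       L t \<omega> \<ge> threshold L E n k r m i \<omega>}"

definition component_failures_until ::
  "(real \<Rightarrow> 'a \<Rightarrow> real) \<Rightarrow> (nat \<Rightarrow> nat \<Rightarrow> 'a \<Rightarrow> real) \<Rightarrow> nat \<Rightarrow> nat \<Rightarrow> nat \<Rightarrow> real \<Rightarrow> 'a \<Rightarrow> (nat \<times> nat) set" where
  "component_failures_until L E n k r t \<omega> =
     {(i, m). i \<in> {1..n} \<and>
       component_failure_time L E n k r m i \<omega> \<le> repair_time L E n k r (Suc m) \<omega> \<and>
       component_failure_time L E n k r m i \<omega> \<le> ennreal t}"

definition cumulative_cost ::
  "(nat \<Rightarrow> real) \<Rightarrow> real \<Rightarrow>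
   (real \<Rightarrow> 'a \<Rightarrow> real) \<Rightarrow> (nat \<Rightarrow> nat \<Rightarrow> 'a \<Rightarrow> real) \<Rightarrow> nat \<Rightarrow> nat \<Rightarrow> nat \<Rightarrow> real \<Rightarrow> 'a \<Rightarrow> real" where
  "cumulative_cost c_cmp c_sys L E n k r t \<omega> =
     (\<Sum>m \<in> repairs_until L E n k r t \<omega>.
        c_cmp (num_repaired L E n k r m \<omega>) +
        (if due_to_system_failure L E n k r m \<omega> then c_sys else 0))"

end

theory Submission
  imports Defs
begin

text \<open>
  All thresholds exceed the current value of \<open>L\<close> right after a repair, so by lack of memory the
  residual thresholds are again iid standard exponentials, independent of the restarted subordinator
  and of the past. This is expressed by probabilities of joint survival only:
  \<open>P(\<forall>x\<in>J. Y\<^sub>x < X\<^sub>x) = exp (- \<Sum>\<^sub>j (u\<^sub>j\<^sub>+\<^sub>1 - u\<^sub>j) \<Psi>(\<Sum>\<^sub>x b\<^sub>x\<^sub>j))\<close> for the nonnegative combinations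
  \<open>Y\<^sub>x = \<Sum>\<^sub>j b\<^sub>x\<^sub>j (L(u\<^sub>j\<^sub>+\<^sub>1) - L(u\<^sub>j))\<close> of increments. The right-hand side factorizes over time, which
  is a Markov property at fixed times; approximating the first repair time from the right by grid
  times transfers it to the first repair. Inclusion--exclusion gives the mean of \<open>T\<^sub>m\<^sub>:\<^sub>n\<close>, and the
  number of failed components, observed on finer and finer grids, is a Markov chain whose embedded
  jump chain has the transition probabilities \<open>P\<^sub>i\<^sub>j\<close>, which gives \<open>F\<close>. The restart identity holds
  under any density \<open>exp(\<theta> T) \<psi>(N)\<close> depending on length and repair size of the first cycle, so
  exponential moments of sums over cycles factorize; Chernoff bounds and Borel--Cantelli then give
  the almost sure limits, and \<open>\<psi> = 1\<^bsub>N < k\<^esub>\<close> gives the mean time until the first system failure.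
\<close>

section \<open>Counting events\<close>

text \<open>Restarting replaces both the strong Markov property and the independence of cycles. To
  be iterated, its conclusion must have the form of its hypothesis. The survival formula has this
  form: after a restart it is again a statement about finitely many increments and thresholds. The
  law of the next cycle is then only proportional to the mass, and this is all that a product
  formula over cycles needs. The obstacle in passing from grid times to the repair time is that
  survival is a strict inequality, which limits do not preserve. Ties must be shown to be null
  before the law at the repair time is known, so they are squeezed between events at grid times,
  with coefficients scaled by \<open>c < 1\<close> and \<open>d > 1\<close>. All tails are governed
  by \<open>\<Psi> 1\<close>, the rate of a single component: some component is still alive at time
  \<open>t\<close> with probability at most \<open>n * exp (- t * \<Psi> 1)\<close>. Hence
  exponential moments exist for \<open>\<theta> < \<Psi> 1\<close>, and the weighted measures stay
  finite.\<close>

lemma alternating_sum_choose_choose: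
  fixes a b n :: nat
  assumes "a \<le> n"
  shows "(\<Sum>i = b..n. (- 1) ^ (i - b) * real (a choose i) * real (i choose b)) =
    (if a = b then 1 else 0)"
proof -
  \<comment> \<open>Terms beyond \<open>a\<close> vanish. The upper limit is \<open>n\<close> and
    not \<open>a\<close> because the coefficients have to be the same for all values
    \<open>a\<close> that a random count can take.\<close>
  have "(\<Sum>i = b..n. (- 1) ^ (i - b) * real (a choose i) * real (i choose b)) =
      (\<Sum>i = b..a. (- 1) ^ (i - b) * real (a choose i) * real (i choose b))"
    using assms by (intro sum.mono_neutral_right) (auto simp: binomial_eq_0)
  also have "\<dots> = (if a = b then 1 else 0)"
  proof (cases "b \<le> a")
    case True
    have "(\<Sum>i = b..a. (- 1) ^ (i - b) * real (a choose i) * real (i choose b)) =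
        (\<Sum>i = 0 + b..(a - b) + b. (- 1) ^ (i - b) * real (a choose i) * real (i choose b))"
      using True by simp
    also have "\<dots> = (\<Sum>i = 0..a - b. (- 1) ^ i * real (a choose (i + b)) * real ((i + b) choose b))"
      by (subst sum.shift_bounds_cl_nat_ivl) simp
    \<comment> \<open>Trinomial revision extracts \<open>a choose b\<close>. A full alternating row
      of Pascal's triangle remains, whose sum is zero unless \<open>a = b\<close>.\<close>
    also have "\<dots> = (\<Sum>i = 0..a - b. real (a choose b) * ((- 1) ^ i * real ((a - b) choose i)))"
    proof (rule sum.cong)
      fix i assume "i \<in> {0..a - b}"
      then have "real ((a choose (i + b)) * ((i + b) choose b)) =
          real ((a choose b) * ((a - b) choose i))"
        using choose_mult[of b "i + b" a] True by simp
      then show "(- 1) ^ i * real (a choose (i + b)) * real ((i + b) choose b) =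
          real (a choose b) * ((- 1) ^ i * real ((a - b) choose i))"
        by (simp only: of_nat_mult) (simp add: algebra_simps)
    qed simp
    also have "\<dots> = real (a choose b) * (\<Sum>i \<le> a - b. (- 1) ^ i * real ((a - b) choose i))"
      by (simp add: sum_distrib_left atLeast0AtMost)
    also have "\<dots> = (if a = b then 1 else 0)"
      using True by (cases "a = b") (auto simp: choose_alternating_sum)
    finally show ?thesis .
  qed auto
  finally show ?thesis .
qed

text \<open>Pascal's rule turns the increment from \<open>a\<close> to \<open>Suc a\<close> into the
  preceding identity with \<open>b = r - 1\<close>, a unit jump exactly at \<open>a = r - 1\<close>.
  Summing the jumps gives the step function.\<close>

lemma alternating_sum_choose_choose_pred:
  fixes a r n :: nat
  assumes "a \<le> n" "1 \<le> r"
  shows "(\<Sum>i = r..n. (- 1) ^ (i - r) * real (a choose i) * real (i - 1 choose (r - 1))) =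
    (if r \<le> a then 1 else 0)"
  using assms(1)
proof (induction a)
  case 0
  then show ?case using assms(2) by (auto simp: binomial_eq_0 intro!: sum.neutral)
next
  case (Suc a)
  let ?f = "\<lambda>a i. (- 1) ^ (i - r) * real (a choose i) * real (i - 1 choose (r - 1))"
  have "(\<Sum>i = r..n. ?f (Suc a) i) =
      (\<Sum>i = r..n. ?f a i) + (\<Sum>i = r..n. (- 1) ^ (i - r) * real (a choose (i - 1)) * real (i - 1 choose (r - 1)))"
    unfolding sum.distrib[symmetric]
  proof (rule sum.cong)
    fix i assume "i \<in> {r..n}"
    then obtain j where "i = Suc j" using assms(2) by (cases i) auto
    then show "?f (Suc a) i = ?f a i + (- 1) ^ (i - r) * real (a choose (i - 1)) * real (i - 1 choose (r - 1))"
      by (simp add: algebra_simps)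
  qed simp
  also have "(\<Sum>i = r..n. (- 1) ^ (i - r) * real (a choose (i - 1)) * real (i - 1 choose (r - 1))) =
      (\<Sum>i = Suc (r - 1)..Suc (n - 1). (- 1) ^ (i - r) * real (a choose (i - 1)) * real (i - 1 choose (r - 1)))"
    using assms(2) Suc.prems by (intro sum.cong) auto
  also have "\<dots> = (\<Sum>i = r - 1..n - 1. (- 1) ^ (i - (r - 1)) * real (a choose i) * real (i choose (r - 1)))"
    unfolding sum.shift_bounds_cl_Suc_ivl using assms(2) by (intro sum.cong) auto
  also have "\<dots> = (if a = r - 1 then 1 else 0)"
    using Suc.prems by (intro alternating_sum_choose_choose) auto
  finally show ?case using Suc assms(2) by auto
qed

lemma card_subsets_of_card:
  assumes "finite V"
  shows "(\<Sum>A | A \<subseteq> V \<and> card A = i. if \<forall>x\<in>A. P x then 1 else 0) = real (card {x \<in> V. P x} choose i)"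
proof -
  have "(\<Sum>A | A \<subseteq> V \<and> card A = i. if \<forall>x\<in>A. P x then 1 else 0) =
      real (card {A \<in> {A. A \<subseteq> V \<and> card A = i}. \<forall>x\<in>A. P x})"
    using assms by (subst sum.inter_filter[symmetric]) auto
  also have "{A \<in> {A. A \<subseteq> V \<and> card A = i}. \<forall>x\<in>A. P x} = {A. A \<subseteq> {x \<in> V. P x} \<and> card A = i}"
    by auto
  also have "card \<dots> = card {x \<in> V. P x} choose i"
    using assms by (intro n_subsets) auto
  finally show ?thesis .
qed

context finite_measure
begin

text \<open>Binomial moments of a random count: \<open>count choose i\<close> is the number of
  \<open>i\<close>-subsets on which \<open>P\<close> holds throughout, and all subsets of one size
  contribute equally. The event \<open>Q\<close> allows conditioning.\<close>

lemma integral_count_choose: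
  assumes V: "finite V" and Q: "Q \<in> sets M"
    and P: "\<And>x. x \<in> V \<Longrightarrow> {w \<in> space M. P x w} \<in> sets M"
    and v: "\<And>A. A \<subseteq> V \<Longrightarrow> measure M {w \<in> Q. \<forall>x\<in>A. P x w} = v (card A)"
  shows "has_bochner_integral M (\<lambda>w. indicator Q w * real (card {x \<in> V. P x w} choose i))
    (real (card V choose i) * v i)"
proof -
  let ?K = "{A. A \<subseteq> V \<and> card A = i}"
  have fin: "finite ?K" using V by auto
  have "has_bochner_integral M (\<lambda>w. \<Sum>A\<in>?K. indicator {w \<in> Q. \<forall>x\<in>A. P x w} w)
      (\<Sum>A\<in>?K. measure M {w \<in> Q. \<forall>x\<in>A. P x w})"
  proof (rule has_bochner_integral_sum)
    fix A assume A: "A \<in> ?K"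
    have "finite A" using A V finite_subset by auto
    have "{w \<in> Q. \<forall>x\<in>A. P x w} = Q \<inter> {w \<in> space M. \<forall>x\<in>A. P x w}"
      using sets.sets_into_space[OF Q] by auto
    also have "\<dots> \<in> sets M"
      using A P \<open>finite A\<close> Q by (intro sets.Int sets.sets_Collect_finite_All) auto
    finally show "has_bochner_integral M (indicator {w \<in> Q. \<forall>x\<in>A. P x w})
        (measure M {w \<in> Q. \<forall>x\<in>A. P x w})"
      by (rule has_bochner_integral_real_indicator) (simp add: emeasure_eq_measure)
  qed
  moreover have "(\<Sum>A\<in>?K. indicator {w \<in> Q. \<forall>x\<in>A. P x w} w) =
      indicator Q w * real (card {x \<in> V. P x w} choose i)" for w
    unfolding card_subsets_of_card[OF V, symmetric] sum_distrib_left
    by (intro sum.cong) (auto simp: indicator_def)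
  moreover have "(\<Sum>A\<in>?K. measure M {w \<in> Q. \<forall>x\<in>A. P x w}) = real (card V choose i) * v i"
    using v by (simp add: n_subsets[OF V])
  ultimately show ?thesis by simp
qed

text \<open>Inclusion-exclusion in dual form: expanding the indicator of \<open>R\<close> in the
  basis \<open>a choose i\<close>, on the finitely many possible counts, reduces its measure to
  binomial moments.\<close>

lemma measure_count_of_coeffs:
  assumes V: "finite V" and Q: "Q \<in> sets M"
    and P: "\<And>x. x \<in> V \<Longrightarrow> {w \<in> space M. P x w} \<in> sets M"
    and v: "\<And>A. A \<subseteq> V \<Longrightarrow> measure M {w \<in> Q. \<forall>x\<in>A. P x w} = v (card A)"
    and c: "\<And>a. a \<le> card V \<Longrightarrow> (\<Sum>i\<in>I. c i * real (a choose i)) = (if R a then 1 else 0)"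
  shows "measure M {w \<in> Q. R (card {x \<in> V. P x w})} = (\<Sum>i\<in>I. c i * (real (card V choose i) * v i))"
proof -
  have "has_bochner_integral M (\<lambda>w. \<Sum>i\<in>I. c i * (indicator Q w * real (card {x \<in> V. P x w} choose i)))
      (\<Sum>i\<in>I. c i * (real (card V choose i) * v i))"
    using integral_count_choose[OF V Q P v]
    by (intro has_bochner_integral_sum has_bochner_integral_mult_right) auto
  moreover have "(\<Sum>i\<in>I. c i * (indicator Q w * real (card {x \<in> V. P x w} choose i))) =
      indicator {w \<in> Q. R (card {x \<in> V. P x w})} w" for w
  proof -
    have "card {x \<in> V. P x w} \<le> card V" using V by (intro card_mono) auto
    then have "indicator Q w * (\<Sum>i\<in>I. c i * real (card {x \<in> V. P x w} choose i)) =
      indicator {w \<in> Q. R (card {x \<in> V. P x w})} w"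
      using c by (auto simp: indicator_def)
    then show ?thesis by (simp add: sum_distrib_left mult_ac)
  qed
  ultimately have *: "has_bochner_integral M (indicator {w \<in> Q. R (card {x \<in> V. P x w})} :: _ \<Rightarrow> real)
      (\<Sum>i\<in>I. c i * (real (card V choose i) * v i))"
    by simp
  have "{w \<in> Q. R (card {x \<in> V. P x w})} \<subseteq> space M"
    using sets.sets_into_space[OF Q] by auto
  then show ?thesis
    using has_bochner_integral_integral_eq[OF *] by (simp add: Int_absorb2 Int_absorb1)
qed

lemma measure_count_eq:
  assumes V: "finite V" and Q: "Q \<in> sets M"
    and P: "\<And>x. x \<in> V \<Longrightarrow> {w \<in> space M. P x w} \<in> sets M"
    and v: "\<And>A. A \<subseteq> V \<Longrightarrow> measure M {w \<in> Q. \<forall>x\<in>A. P x w} = v (card A)"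
  shows "measure M {w \<in> Q. card {x \<in> V. P x w} = b} =
    (\<Sum>i = b..card V. (- 1) ^ (i - b) * real (i choose b) * (real (card V choose i) * v i))"
proof (rule measure_count_of_coeffs[OF V Q P v])
  fix a assume "a \<le> card V"
  from alternating_sum_choose_choose[OF this, of b]
  show "(\<Sum>i = b..card V. (- 1) ^ (i - b) * real (i choose b) * real (a choose i)) = (if a = b then 1 else 0)"
    by (simp add: mult_ac)
qed auto

lemma measure_count_ge:
  assumes V: "finite V" and Q: "Q \<in> sets M"
    and P: "\<And>x. x \<in> V \<Longrightarrow> {w \<in> space M. P x w} \<in> sets M"
    and v: "\<And>A. A \<subseteq> V \<Longrightarrow> measure M {w \<in> Q. \<forall>x\<in>A. P x w} = v (card A)"
    and r: "1 \<le> r"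
  shows "measure M {w \<in> Q. r \<le> card {x \<in> V. P x w}} =
    (\<Sum>i = r..card V. (- 1) ^ (i - r) * real (i - 1 choose (r - 1)) * (real (card V choose i) * v i))"
proof (rule measure_count_of_coeffs[OF V Q P v])
  fix a assume "a \<le> card V"
  from alternating_sum_choose_choose_pred[OF this r]
  show "(\<Sum>i = r..card V. (- 1) ^ (i - r) * real (i - 1 choose (r - 1)) * real (a choose i)) = (if r \<le> a then 1 else 0)"
    by (simp add: mult_ac)
qed auto

end

section \<open>A law of large numbers via exponential moments\<close>

lemma exp_le_quadratic:
  fixes x :: real
  shows "exp x \<le> 1 + x + x\<^sup>2 * exp \<bar>x\<bar>"
proof -
  obtain t where t: "\<bar>t\<bar> \<le> \<bar>x\<bar>" "exp x = (\<Sum>m<2. x ^ m / fact m) + exp t / fact 2 * x ^ 2"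
    using Maclaurin_exp_le[of x 2] by blast
  have "exp t / fact 2 * x\<^sup>2 \<le> exp \<bar>x\<bar> * x\<^sup>2"
  proof (rule mult_right_mono)
    have "exp t \<le> exp \<bar>x\<bar>" using t(1) by simp
    then show "exp t / fact 2 \<le> exp \<bar>x\<bar>" using exp_gt_zero[of t] unfolding fact_2 by linarith
  qed simp
  then show ?thesis using t(2) by (simp add: numeral_2_eq_2 mult.commute)
qed

lemma square_le_exp: "x\<^sup>2 \<le> 2 * exp \<bar>x\<bar>" for x :: real
  using exp_lower_Taylor_quadratic[of "\<bar>x\<bar>"] by simp

context prob_space
begin

text \<open>Chernoff bound and Borel-Cantelli. The hypothesis that the exponential moment of a sum
  of \<open>m\<close> terms is the \<open>m\<close>-th power of that of \<open>Y\<close> stands in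
  for independence.\<close>

lemma AE_eventually_sum_le_of_exp_moments:
  fixes X :: "nat \<Rightarrow> 'a \<Rightarrow> real" and Y :: "'a \<Rightarrow> real"
  assumes X[measurable]: "\<And>m. X m \<in> borel_measurable M" and Y[measurable]: "Y \<in> borel_measurable M"
    and th0: "0 < th0"
    and int: "\<And>th. \<bar>th\<bar> \<le> th0 \<Longrightarrow> integrable M (\<lambda>w. exp (th * Y w))"
    and mom: "\<And>th m. \<bar>th\<bar> \<le> th0 \<Longrightarrow>
      (\<integral>\<^sup>+ w. ennreal (exp (th * (\<Sum>l<m. X l w))) \<partial>M) = ennreal (expectation (\<lambda>w. exp (th * Y w)) ^ m)"
    and d: "0 < d"
  shows "AE w in M. eventually (\<lambda>m. (\<Sum>l<m. X l w) \<le> real m * (expectation Y + d)) sequentially"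
proof -
  define mu where "mu = expectation Y"
  \<comment> \<open>Half of the radius leaves room: the quadratic factor in \<open>Y\<close> is
    absorbed by passing from \<open>h\<close> to \<open>th0\<close> in the exponent.\<close>
  define h where "h = th0 / 2"
  have h: "0 < h" using th0 by (simp add: h_def)
  define C where "C = expectation (\<lambda>w. (Y w)\<^sup>2 * exp (h * \<bar>Y w\<bar>))"
  have bnd: "(Y w)\<^sup>2 * exp (h * \<bar>Y w\<bar>) \<le> 2 / h\<^sup>2 * (exp (th0 * Y w) + exp (- th0 * Y w))" for w
  proof -
    have "(h * Y w)\<^sup>2 \<le> 2 * exp (h * \<bar>Y w\<bar>)"
      using square_le_exp[of "h * Y w"] h by (simp add: abs_mult)
    then have "(h * Y w)\<^sup>2 * exp (h * \<bar>Y w\<bar>) \<le> 2 * exp (h * \<bar>Y w\<bar>) * exp (h * \<bar>Y w\<bar>)"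
      by (intro mult_right_mono) auto
    also have "\<dots> = 2 * exp (th0 * \<bar>Y w\<bar>)"
      unfolding mult.assoc exp_add[symmetric] by (simp add: h_def)
    also have "\<dots> \<le> 2 * (exp (th0 * Y w) + exp (- th0 * Y w))"
      by (cases "Y w \<ge> 0") (auto simp: abs_if)
    finally show ?thesis using h by (simp add: power_mult_distrib field_simps)
  qed
  have intC: "integrable M (\<lambda>w. (Y w)\<^sup>2 * exp (h * \<bar>Y w\<bar>))"
  proof (rule Bochner_Integration.integrable_bound)
    show "integrable M (\<lambda>w. 2 / h\<^sup>2 * (exp (th0 * Y w) + exp (- th0 * Y w)))"
      using int[of th0] int[of "- th0"] th0 by (intro integrable_mult_right Bochner_Integration.integrable_add) auto
    show "AE w in M. norm ((Y w)\<^sup>2 * exp (h * \<bar>Y w\<bar>)) \<le> norm (2 / h\<^sup>2 * (exp (th0 * Y w) + exp (- th0 * Y w)))"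
      using bnd by (intro AE_I2) (simp add: abs_mult)
  qed simp
  have intY: "integrable M Y"
  proof (rule Bochner_Integration.integrable_bound)
    show "integrable M (\<lambda>w. 1 + (Y w)\<^sup>2 * exp (h * \<bar>Y w\<bar>))"
      using intC by (intro Bochner_Integration.integrable_add) auto
    show "AE w in M. norm (Y w) \<le> norm (1 + (Y w)\<^sup>2 * exp (h * \<bar>Y w\<bar>))"
    proof (rule AE_I2)
      fix w
      have "\<bar>Y w\<bar> \<le> 1 + (Y w)\<^sup>2"
        using zero_le_power2[of "\<bar>Y w\<bar> - 1"] zero_le_power2[of "Y w"] by (simp add: power2_diff)
      also have "\<dots> \<le> 1 + (Y w)\<^sup>2 * exp (h * \<bar>Y w\<bar>)"
        using h by (simp add: mult_le_cancel_left1)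
      finally show "norm (Y w) \<le> norm (1 + (Y w)\<^sup>2 * exp (h * \<bar>Y w\<bar>))" by simp
    qed
  qed simp
  have C0: "0 \<le> C" unfolding C_def by (intro integral_nonneg_AE AE_I2) auto
  \<comment> \<open>Small enough for the quadratic term to cost at most half of the slack
    \<open>th * d\<close>; the other half is the rate in the Chernoff bound. The summand
    \<open>1\<close> guards against \<open>C = 0\<close>.\<close>
  define th where "th = min h (d / (2 * (C + 1)))"
  have th: "0 < th" "th \<le> h" "th * C \<le> d / 2"
  proof -
    show "0 < th" "th \<le> h" using h d C0 by (auto simp: th_def)
    have "th * C \<le> d / (2 * (C + 1)) * C" using C0 by (intro mult_right_mono) (auto simp: th_def)
    also have "\<dots> \<le> d / 2" using C0 d by (simp add: field_simps)
    finally show "th * C \<le> d / 2" .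
  qed
  define kap where "kap = expectation (\<lambda>w. exp (th * Y w))"
  have "kap \<le> expectation (\<lambda>w. 1 + th * Y w + th\<^sup>2 * ((Y w)\<^sup>2 * exp (h * \<bar>Y w\<bar>)))"
    unfolding kap_def
  proof (rule integral_mono)
    show "integrable M (\<lambda>w. exp (th * Y w))" using th h by (intro int) (auto simp: h_def)
    show "integrable M (\<lambda>w. 1 + th * Y w + th\<^sup>2 * ((Y w)\<^sup>2 * exp (h * \<bar>Y w\<bar>)))"
      using intY intC by (intro Bochner_Integration.integrable_add integrable_mult_right) auto
    fix w
    have "exp (th * Y w) \<le> 1 + th * Y w + (th * Y w)\<^sup>2 * exp \<bar>th * Y w\<bar>" by (rule exp_le_quadratic)
    also have "(th * Y w)\<^sup>2 * exp \<bar>th * Y w\<bar> \<le> (th * Y w)\<^sup>2 * exp (h * \<bar>Y w\<bar>)"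
      using th by (intro mult_left_mono) (auto simp: abs_mult intro: mult_right_mono)
    finally show "exp (th * Y w) \<le> 1 + th * Y w + th\<^sup>2 * ((Y w)\<^sup>2 * exp (h * \<bar>Y w\<bar>))"
      by (simp add: power_mult_distrib mult_ac)
  qed
  also have "\<dots> = 1 + th * mu + th\<^sup>2 * C"
    using intY intC by (simp add: mu_def C_def prob_space)
  also have "\<dots> \<le> 1 + (th * mu + th * (d / 2))"
    using mult_left_mono[OF th(3), of th] th(1) by (simp add: power2_eq_square)
  also have "\<dots> \<le> exp (th * mu + th * (d / 2))" by (rule exp_ge_add_one_self)
  finally have kap: "kap \<le> exp (th * mu + th * (d / 2))" .
  have kap0: "0 \<le> kap" unfolding kap_def by (intro integral_nonneg_AE AE_I2) auto
  define \<rho> where "\<rho> = exp (- th * d / 2)"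
  have \<rho>: "0 < \<rho>" "\<rho> < 1" using th d by (auto simp: \<rho>_def)
  let ?A = "\<lambda>m. {w \<in> space M. real m * (mu + d) < (\<Sum>l<m. X l w)}"
  have A: "emeasure M (?A m) \<le> ennreal (\<rho> ^ m)" for m
  proof -
    have "emeasure M (?A m) = (\<integral>\<^sup>+ w. indicator (?A m) w \<partial>M)" by simp
    also have "\<dots> \<le> (\<integral>\<^sup>+ w. ennreal (exp (- th * (real m * (mu + d)))) * ennreal (exp (th * (\<Sum>l<m. X l w))) \<partial>M)"
    proof (rule nn_integral_mono)
      fix w
      show "indicator (?A m) w \<le> ennreal (exp (- th * (real m * (mu + d)))) * ennreal (exp (th * (\<Sum>l<m. X l w)))"
      proof (cases "w \<in> ?A m")
        case True
        then have "0 \<le> - th * (real m * (mu + d)) + th * (\<Sum>l<m. X l w)"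
          using th by (auto simp: mult_le_cancel_left)
        then have "1 \<le> exp (- th * (real m * (mu + d)) + th * (\<Sum>l<m. X l w))" by simp
        then have "ennreal 1 \<le> ennreal (exp (- th * (real m * (mu + d))) * exp (th * (\<Sum>l<m. X l w)))"
          unfolding exp_add by (intro ennreal_leI)
        then show ?thesis using True by (simp add: ennreal_mult)
      qed auto
    qed
    also have "\<dots> = ennreal (exp (- th * (real m * (mu + d)))) * ennreal (kap ^ m)"
      using mom[of th m] th h by (subst nn_integral_cmult) (auto simp: kap_def h_def)
    also have "\<dots> = ennreal (exp (- th * (real m * (mu + d))) * kap ^ m)"
      using kap0 by (simp add: ennreal_mult)
    also have "\<dots> \<le> ennreal (\<rho> ^ m)"
    proof (rule ennreal_leI)
      have "exp (- th * (real m * (mu + d))) * kap ^ m \<le>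
          exp (- th * (real m * (mu + d))) * exp (th * mu + th * (d / 2)) ^ m"
        using kap kap0 by (intro mult_left_mono power_mono) auto
      also have "\<dots> = \<rho> ^ m"
        by (simp add: \<rho>_def exp_of_nat_mult[symmetric] exp_add[symmetric] algebra_simps)
      finally show "exp (- th * (real m * (mu + d))) * kap ^ m \<le> \<rho> ^ m" .
    qed
    finally show ?thesis .
  qed
  have "AE w in M. eventually (\<lambda>m. w \<in> space M - ?A m) sequentially"
  proof (rule borel_cantelli_AE1)
    show "?A m \<in> sets M" for m by measurable
    show "emeasure M (?A m) < \<infinity>" for m by (simp add: emeasure_eq_measure)
    have "measure M (?A m) \<le> \<rho> ^ m" for m
      using A[of m] \<rho> by (simp add: emeasure_eq_measure)
    then show "summable (\<lambda>m. measure M (?A m))"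
      using \<rho> by (intro summable_comparison_test[OF _ summable_geometric[of \<rho>]]) auto
  qed
  then show ?thesis
    by eventually_elim (auto simp: mu_def not_less elim!: eventually_mono)
qed

text \<open>The one-sided bound is applied to \<open>X\<close> and to \<open>- X\<close>, with the
  countably many slacks \<open>1 / Suc j\<close>.\<close>

theorem AE_mean_tendsto_of_exp_moments:
  fixes X :: "nat \<Rightarrow> 'a \<Rightarrow> real" and Y :: "'a \<Rightarrow> real"
  assumes X[measurable]: "\<And>m. X m \<in> borel_measurable M" and Y[measurable]: "Y \<in> borel_measurable M"
    and th0: "0 < th0"
    and int: "\<And>th. \<bar>th\<bar> \<le> th0 \<Longrightarrow> integrable M (\<lambda>w. exp (th * Y w))"
    and mom: "\<And>th m. \<bar>th\<bar> \<le> th0 \<Longrightarrow>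
      (\<integral>\<^sup>+ w. ennreal (exp (th * (\<Sum>l<m. X l w))) \<partial>M) = ennreal (expectation (\<lambda>w. exp (th * Y w)) ^ m)"
  shows "AE w in M. (\<lambda>m. (\<Sum>l<m. X l w) / real m) \<longlonglongrightarrow> expectation Y"
proof -
  have 1: "AE w in M. \<forall>j::nat. eventually (\<lambda>m. (\<Sum>l<m. X l w) \<le> real m * (expectation Y + 1 / Suc j)) sequentially"
    unfolding AE_all_countable using AE_eventually_sum_le_of_exp_moments[OF X Y th0 int mom] by simp
  have 2: "AE w in M. \<forall>j::nat. eventually (\<lambda>m. (\<Sum>l<m. - X l w) \<le> real m * (expectation (\<lambda>w. - Y w) + 1 / Suc j)) sequentially"
    unfolding AE_all_countable
  proof (intro allI AE_eventually_sum_le_of_exp_moments[OF _ _ th0])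
    fix th :: real and m :: nat assume "\<bar>th\<bar> \<le> th0"
    then show "integrable M (\<lambda>w. exp (th * - Y w))" using int[of "- th"] by simp
    show "(\<integral>\<^sup>+ w. ennreal (exp (th * (\<Sum>l<m. - X l w))) \<partial>M) = ennreal (expectation (\<lambda>w. exp (th * - Y w)) ^ m)"
      using mom[of "- th" m] \<open>\<bar>th\<bar> \<le> th0\<close> by (simp add: sum_negf)
  qed auto
  from 1 2 show ?thesis
  proof eventually_elim
    case (elim w)
    show ?case
    proof (rule LIMSEQ_I)
      fix r :: real assume "0 < r"
      then obtain j :: nat where j: "1 / Suc j < r" using nat_approx_posE by (metis of_nat_Suc)
      define e where "e = 1 / real (Suc j)"
      from elim(1)[rule_format, of j, folded e_def] elim(2)[rule_format, of j, folded e_def] eventually_gt_at_top[of 0]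
      have "eventually (\<lambda>m. norm ((\<Sum>l<m. X l w) / real m - expectation Y) < r) sequentially"
      proof eventually_elim
        case (elim m)
        then have m: "0 < real m" by simp
        have "(\<Sum>l<m. X l w) / real m \<le> expectation Y + e"
          using elim(1) m by (subst pos_divide_le_eq) (simp_all add: mult.commute)
        moreover have "(\<Sum>l<m. X l w) / real m \<ge> expectation Y - e"
        proof (subst pos_le_divide_eq[OF m])
          have "- (\<Sum>l<m. X l w) \<le> real m * (- expectation Y + e)"
            using elim(2) by (simp add: sum_negf)
          also have "\<dots> = - ((expectation Y - e) * real m)" by (simp add: algebra_simps)
          finally show "(expectation Y - e) * real m \<le> (\<Sum>l<m. X l w)" by simp
        qed
        ultimately show ?case using j unfolding e_def[symmetric] by (simp add: abs_less_iff)
      qed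
      then show "\<exists>no. \<forall>m\<ge>no. norm ((\<Sum>l<m. X l w) / real m - expectation Y) < r"
        by (simp add: eventually_sequentially)
    qed
  qed
qed

end

section \<open>Renewal counting\<close>

text \<open>The count inverts the partial sums, \<open>S (K t) \<le> t < S (Suc (K t))\<close>, and
  dividing by \<open>K t\<close> squeezes \<open>t / K t\<close>.\<close>

lemma renewal_rate:
  fixes S :: "nat \<Rightarrow> real"
  assumes S0: "S 0 = 0" and mono: "mono S" and mu: "0 < mu"
    and lim: "(\<lambda>m. S m / real m) \<longlonglongrightarrow> mu"
  defines "K \<equiv> \<lambda>t. card {m. 1 \<le> m \<and> S m \<le> t}"
  shows "\<And>t. 0 \<le> t \<Longrightarrow> {m. 1 \<le> m \<and> S m \<le> t} = {1..K t}"
    and "filterlim K at_top at_top"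
    and "((\<lambda>t. real (K t) / t) \<longlongrightarrow> 1 / mu) at_top"
proof -
  have Sinf: "filterlim S at_top sequentially"
  proof -
    have "filterlim (\<lambda>m. S m / real m * real m) at_top sequentially"
      by (rule filterlim_tendsto_pos_mult_at_top[OF lim mu filterlim_real_sequentially])
    then show ?thesis
    proof (rule filterlim_at_top_mono)
      show "eventually (\<lambda>m. S m / real m * real m \<le> S m) sequentially"
        using eventually_gt_at_top[of 0] by eventually_elim simp
    qed
  qed
  have ex: "\<exists>k. {m. 1 \<le> m \<and> S m \<le> t} = {1..k}" if "0 \<le> t" for t
  proof -
    from Sinf have "eventually (\<lambda>m. t < S m) sequentially" by (simp add: filterlim_at_top_dense)
    then obtain k0 where k0: "t < S k0" by (auto simp: eventually_sequentially)
    define k where "k = (LEAST m. t < S m)"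
    have k: "t < S k" unfolding k_def using k0 by (rule LeastI)
    have "k \<noteq> 0" using k S0 that by (cases k) auto
    have "m < k \<longleftrightarrow> S m \<le> t" for m
    proof
      show "m < k \<Longrightarrow> S m \<le> t" unfolding k_def using not_less_Least by (metis not_le)
      show "S m \<le> t \<Longrightarrow> m < k" using k monoD[OF mono, of k m] by (meson not_le order.strict_trans1 order.strict_trans2 leD)
    qed
    then have "{m. 1 \<le> m \<and> S m \<le> t} = {m. 1 \<le> m \<and> m < k}" by simp
    also have "\<dots> = {1..k - 1}" using \<open>k \<noteq> 0\<close> by auto
    finally have "{m. 1 \<le> m \<and> S m \<le> t} = {1..k - 1}" .
    then show ?thesis ..
  qed
  show *: "{m. 1 \<le> m \<and> S m \<le> t} = {1..K t}" if "0 \<le> t" for t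
  proof -
    from ex[OF that] obtain k where k: "{m. 1 \<le> m \<and> S m \<le> t} = {1..k}" ..
    have "K t = k" unfolding K_def k by simp
    then show ?thesis using k by simp
  qed
  have le: "S (K t) \<le> t" if "0 \<le> t" for t
  proof (cases "K t = 0")
    case False
    then have "K t \<in> {m. 1 \<le> m \<and> S m \<le> t}" unfolding *[OF that] by simp
    then show ?thesis by simp
  qed (use S0 that in simp)
  have gt: "t < S (Suc (K t))" if "0 \<le> t" for t
  proof -
    have "Suc (K t) \<notin> {m. 1 \<le> m \<and> S m \<le> t}" unfolding *[OF that] by simp
    then show ?thesis by simp
  qed
  show Kinf: "filterlim K at_top at_top"
    unfolding filterlim_at_top
  proof
    fix k
    show "eventually (\<lambda>t. k \<le> K t) at_top"
      using eventually_ge_at_top[of "max 0 (S k)"]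
    proof eventually_elim
      case (elim t)
      then have "k \<in> {m. 1 \<le> m \<and> S m \<le> t} \<or> k = 0" by auto
      then show ?case unfolding *[OF order_trans[OF max.cobounded1 elim]] by auto
    qed
  qed
  have lim1: "((\<lambda>t. S (K t) / real (K t)) \<longlongrightarrow> mu) at_top"
    using filterlim_compose[OF lim Kinf] .
  \<comment> \<open>The factor \<open>Suc m / m\<close> tends to 1 and replaces the denominator
    \<open>Suc m\<close> by \<open>m\<close>.\<close>
  have "(\<lambda>m. S (Suc m) / real (Suc m) * (real (Suc m) / real m)) \<longlonglongrightarrow> mu * 1"
    by (intro tendsto_mult LIMSEQ_Suc[OF lim] LIMSEQ_Suc_n_over_n)
  then have lim2: "((\<lambda>t. S (Suc (K t)) / real (Suc (K t)) * (real (Suc (K t)) / real (K t))) \<longlongrightarrow> mu) at_top"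
    using filterlim_compose[OF _ Kinf] by simp
  have "((\<lambda>t. t / real (K t)) \<longlongrightarrow> mu) at_top"
  proof (rule tendsto_sandwich[OF _ _ lim1 lim2])
    have K0: "eventually (\<lambda>t. 0 < K t) at_top"
      using eventually_compose_filterlim[OF eventually_gt_at_top[of 0] Kinf] .
    show "eventually (\<lambda>t. S (K t) / real (K t) \<le> t / real (K t)) at_top"
      using eventually_ge_at_top[of 0] K0 by eventually_elim (auto intro!: divide_right_mono le)
    show "eventually (\<lambda>t. t / real (K t) \<le> S (Suc (K t)) / real (Suc (K t)) * (real (Suc (K t)) / real (K t))) at_top"
      using eventually_ge_at_top[of 0] K0
      by eventually_elim (auto intro!: divide_right_mono less_imp_le[OF gt] simp del: of_nat_Suc)
  qed
  from tendsto_divide[OF tendsto_const[of 1] this] mu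
  show "((\<lambda>t. real (K t) / t) \<longlongrightarrow> 1 / mu) at_top" by simp
qed

text \<open>\<open>R l\<close> is the reward of the cycle from \<open>S l\<close> to
  \<open>S (Suc l)\<close>, counted at its end: at time \<open>t\<close> exactly the cycles with
  index below the renewal count are complete.\<close>

lemma renewal_reward_rate:
  fixes S R :: "nat \<Rightarrow> real"
  assumes S: "S 0 = 0" "mono S" "0 < mu" "(\<lambda>m. S m / real m) \<longlonglongrightarrow> mu"
    and R: "(\<lambda>m. (\<Sum>l<m. R l) / real m) \<longlonglongrightarrow> rho"
  shows "((\<lambda>t. (\<Sum>l<card {m. 1 \<le> m \<and> S m \<le> t}. R l) / t) \<longlongrightarrow> rho / mu) at_top"
proof -
  let ?K = "\<lambda>t. card {m. 1 \<le> m \<and> S m \<le> t}"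
  note K = renewal_rate[OF S]
  have "((\<lambda>t. (\<Sum>l<?K t. R l) / real (?K t) * (real (?K t) / t)) \<longlongrightarrow> rho * (1 / mu)) at_top"
    by (intro tendsto_mult K(3) filterlim_compose[OF R K(2)])
  moreover have "eventually (\<lambda>t. (\<Sum>l<?K t. R l) / real (?K t) * (real (?K t) / t) = (\<Sum>l<?K t. R l) / t) at_top"
  proof -
    have "eventually (\<lambda>t. 0 < ?K t) at_top" using eventually_compose_filterlim[OF eventually_gt_at_top[of 0] K(2)] .
    then show ?thesis by eventually_elim simp
  qed
  ultimately have "((\<lambda>t. (\<Sum>l<?K t. R l) / t) \<longlongrightarrow> rho * (1 / mu)) at_top"
    by (rule Lim_transform_eventually)
  then show ?thesis by simp
qed

section \<open>Laplace exponents\<close>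

text \<open>Cauchy's functional equation. Nonnegativity makes \<open>g\<close> monotone, and
  squeezing \<open>Suc N * g t\<close> between neighbouring multiples of \<open>g 1\<close> takes
  the place of a continuity argument.\<close>

lemma additive_nonneg_linear:
  fixes g :: "real \<Rightarrow> real"
  assumes add: "\<And>s t. 0 \<le> s \<Longrightarrow> 0 \<le> t \<Longrightarrow> g (s + t) = g s + g t"
    and pos: "\<And>t. 0 \<le> t \<Longrightarrow> 0 \<le> g t" and t: "0 \<le> t"
  shows "g t = t * g 1"
proof -
  have mult: "g (real N * s) = real N * g s" if "0 \<le> s" for N s
  proof (induction N)
    case 0
    then show ?case using add[of 0 0] by simp
  next
    case (Suc N)
    then show ?case using add[of "real N * s" s] that by (simp add: algebra_simps)
  qed
  have mono: "g s \<le> g t" if "0 \<le> s" "s \<le> t" for s t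
    using add[of s "t - s"] pos[of "t - s"] that by simp
  have bound: "\<bar>g t - t * g 1\<bar> \<le> g 1 / real (Suc N)" for N
  proof -
    define k where "k = nat \<lfloor>real (Suc N) * t\<rfloor>"
    have k: "real k \<le> real (Suc N) * t" "real (Suc N) * t \<le> real (Suc k)"
      using t by (simp_all add: k_def) linarith+
    have "real k * g 1 \<le> real (Suc N) * g t" "real (Suc N) * g t \<le> real (Suc k) * g 1"
      using mono[OF _ k(1)] mono[OF _ k(2)] mult[OF t, of "Suc N"] mult[of 1 k] mult[of 1 "Suc k"] t
      by simp_all
    moreover have "real k * g 1 \<le> real (Suc N) * t * g 1" "real (Suc N) * t * g 1 \<le> real (Suc k) * g 1"
      using k pos[of 1] by (intro mult_right_mono; simp)+
    ultimately have "\<bar>real (Suc N) * g t - real (Suc N) * t * g 1\<bar> \<le> g 1"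
      by (simp add: algebra_simps abs_le_iff)
    then have "\<bar>real (Suc N) * (g t - t * g 1)\<bar> \<le> g 1"
      by (simp only: right_diff_distrib mult.assoc)
    then have "real (Suc N) * \<bar>g t - t * g 1\<bar> \<le> g 1" by (simp only: abs_mult abs_of_nat)
    then show ?thesis by (subst pos_le_divide_eq) (simp_all add: mult.commute)
  qed
  have "(\<lambda>N. g 1 / real (Suc N)) \<longlonglongrightarrow> 0"
    by (intro tendsto_divide_0[OF tendsto_const] filterlim_at_top_imp_at_infinity
        filterlim_compose[OF filterlim_real_sequentially filterlim_Suc])
  then have "\<bar>g t - t * g 1\<bar> \<le> 0"
    using bound by (intro LIMSEQ_le_const) auto
  then show ?thesis by simp
qed

section \<open>Weighted increments over a time grid and their Laplace transforms\<close>

definition time_grid :: "(nat \<Rightarrow> real) \<Rightarrow> nat \<Rightarrow> bool" where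
  "time_grid u p \<longleftrightarrow> 0 \<le> u 0 \<and> (\<forall>j<p. u j \<le> u (Suc j))"

text \<open>The integral against \<open>L\<close> of the step function with value \<open>c j\<close>
  on the \<open>j\<close>-th grid interval. In the same way \<open>psi_comb\<close> is the time
  integral of \<open>\<Psi>\<close> along this step function, the exponent of the Laplace
  transform.\<close>

definition path_comb :: "(real \<Rightarrow> 'a \<Rightarrow> real) \<Rightarrow> (nat \<Rightarrow> real) \<Rightarrow> nat \<Rightarrow> (nat \<Rightarrow> real) \<Rightarrow> 'a \<Rightarrow> real" where
  "path_comb L u p c w = (\<Sum>j<p. c j * (L (u (Suc j)) w - L (u j) w))"

definition psi_comb :: "(real \<Rightarrow> real) \<Rightarrow> (nat \<Rightarrow> real) \<Rightarrow> nat \<Rightarrow> (nat \<Rightarrow> real) \<Rightarrow> real" where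
  "psi_comb \<Psi> u p c = (\<Sum>j<p. (u (Suc j) - u j) * \<Psi> (c j))"

lemma time_grid_nonneg: "time_grid u p \<Longrightarrow> j \<le> p \<Longrightarrow> 0 \<le> u j"
  by (induction j) (auto simp: time_grid_def intro: order_trans)

lemma path_comb_measurable:
  assumes "\<And>t. 0 \<le> t \<Longrightarrow> L t \<in> borel_measurable M" and "time_grid u p"
  shows "path_comb L u p c \<in> borel_measurable M"
  unfolding path_comb_def[abs_def] using assms time_grid_nonneg[OF assms(2)]
  by (intro borel_measurable_sum borel_measurable_times borel_measurable_const borel_measurable_diff) auto

locale subordinator =
  fixes M :: "'a measure" and L :: "real \<Rightarrow> 'a \<Rightarrow> real"
  assumes sub: "levy_subordinator M L"
begin

lemma levy: "levy_process M L"
  using sub by (simp add: levy_subordinator_def)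

sublocale prob_space M
  using levy by (simp add: levy_process_def)

abbreviation "\<Psi> \<equiv> laplace_exponent M L"

lemma L_measurable[measurable]: "0 \<le> t \<Longrightarrow> L t \<in> borel_measurable M"
  using levy by (simp add: levy_process_def)

lemma L_zero: "w \<in> space M \<Longrightarrow> L 0 w = 0"
  using levy by (simp add: levy_process_def)

lemma L_right_continuous: "w \<in> space M \<Longrightarrow> 0 \<le> t \<Longrightarrow> continuous (at_right t) (\<lambda>s. L s w)"
  using levy by (simp add: levy_process_def)

lemma L_mono: "w \<in> space M \<Longrightarrow> 0 \<le> s \<Longrightarrow> s \<le> t \<Longrightarrow> L s w \<le> L t w"
  using sub by (simp add: levy_subordinator_def)

lemma L_nonneg: "w \<in> space M \<Longrightarrow> 0 \<le> t \<Longrightarrow> 0 \<le> L t w"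
  using L_mono[of w 0 t] L_zero[of w] by simp

lemma integrable_exp_L: "0 \<le> x \<Longrightarrow> 0 \<le> t \<Longrightarrow> integrable M (\<lambda>w. exp (- x * L t w))"
  by (rule integrable_const_bound[where B = 1]) (auto intro!: AE_I2 L_nonneg mult_nonneg_nonneg)

lemma expectation_exp_increment:
  assumes "0 \<le> s" "0 \<le> h"
  shows "expectation (\<lambda>w. exp (- x * (L (s + h) w - L s w))) = expectation (\<lambda>w. exp (- x * L h w))"
proof -
  have eq: "distr M borel (\<lambda>w. L (s + h) w - L s w) = distr M borel (L h)"
    using levy assms by (simp add: levy_process_def)
  have m: "(\<lambda>w. L (s + h) w - L s w) \<in> measurable M borel"
    using assms by (intro borel_measurable_diff L_measurable) auto
  have m': "L h \<in> measurable M borel" using assms by measurable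
  have "expectation (\<lambda>w. exp (- x * (L (s + h) w - L s w))) =
      (\<integral>y. exp (- x * y) \<partial>distr M borel (\<lambda>w. L (s + h) w - L s w))"
    by (subst integral_distr[OF m]) auto
  also have "\<dots> = expectation (\<lambda>w. exp (- x * L h w))"
    unfolding eq by (subst integral_distr[OF m']) auto
  finally show ?thesis .
qed

lemma expectation_exp_path_comb:
  assumes u: "time_grid u p" and c: "\<And>j. j < p \<Longrightarrow> 0 \<le> c j"
  shows "expectation (\<lambda>w. exp (- path_comb L u p c w)) =
    (\<Prod>j<p. expectation (\<lambda>w. exp (- c j * L (u (Suc j) - u j) w)))"
proof -
  have u0: "0 \<le> u j" if "j \<le> p" for j using time_grid_nonneg[OF u that] .
  have u1: "u j \<le> u (Suc j)" if "j < p" for j using u that by (simp add: time_grid_def)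
  have ind: "indep_vars (\<lambda>_. borel) (\<lambda>j w. L (u (Suc j)) w - L (u j) w) {..<p}"
    using levy u by (simp add: levy_process_def time_grid_def)
  have ind2: "indep_vars (\<lambda>_. borel) (\<lambda>j w. exp (- c j * (L (u (Suc j)) w - L (u j) w))) {..<p}"
    by (rule indep_vars_compose2[OF ind]) auto
  have "expectation (\<lambda>w. exp (- path_comb L u p c w)) =
      expectation (\<lambda>w. \<Prod>j<p. exp (- c j * (L (u (Suc j)) w - L (u j) w)))"
    by (simp add: path_comb_def exp_sum[symmetric] sum_negf)
  also have "\<dots> = (\<Prod>j<p. expectation (\<lambda>w. exp (- c j * (L (u (Suc j)) w - L (u j) w))))"
  proof (rule indep_vars_lebesgue_integral[OF _ ind2])
    fix j assume j: "j \<in> {..<p}"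
    show "integrable M (\<lambda>w. exp (- c j * (L (u (Suc j)) w - L (u j) w)))"
    proof (rule integrable_const_bound[where B = 1])
      show "AE w in M. norm (exp (- c j * (L (u (Suc j)) w - L (u j) w))) \<le> 1"
        using L_mono[OF _ u0 u1, of _ j] c j by (intro AE_I2) (auto intro!: mult_nonneg_nonneg)
      show "(\<lambda>w. exp (- c j * (L (u (Suc j)) w - L (u j) w))) \<in> borel_measurable M"
        using u0[of j] u0[of "Suc j"] j by simp
    qed
  qed simp
  also have "\<dots> = (\<Prod>j<p. expectation (\<lambda>w. exp (- c j * L (u (Suc j) - u j) w)))"
  proof (rule prod.cong)
    fix j assume "j \<in> {..<p}"
    then show "expectation (\<lambda>w. exp (- c j * (L (u (Suc j)) w - L (u j) w))) =
        expectation (\<lambda>w. exp (- c j * L (u (Suc j) - u j) w))"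
      using expectation_exp_increment[of "u j" "u (Suc j) - u j" "c j"] u0[of j] u1[of j] by simp
  qed simp
  finally show ?thesis .
qed

lemma expectation_exp_pos:
  assumes "0 \<le> x" "0 \<le> t"
  shows "0 < expectation (\<lambda>w. exp (- x * L t w))"
proof -
  have "expectation (\<lambda>w. exp (- x * L t w)) \<noteq> 0"
  proof
    assume "expectation (\<lambda>w. exp (- x * L t w)) = 0"
    then have "AE w in M. exp (- x * L t w) = 0"
      using integral_nonneg_eq_0_iff_AE[OF integrable_exp_L[OF assms]] by auto
    then show False by simp
  qed
  moreover have "0 \<le> expectation (\<lambda>w. exp (- x * L t w))" by simp
  ultimately show ?thesis by linarith
qed

lemma expectation_exp_le_1:
  assumes "0 \<le> x" "0 \<le> t"
  shows "expectation (\<lambda>w. exp (- x * L t w)) \<le> 1"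
proof -
  have "expectation (\<lambda>w. exp (- x * L t w)) \<le> expectation (\<lambda>w. 1)"
    using assms by (intro integral_mono integrable_exp_L) (auto intro!: mult_nonneg_nonneg L_nonneg)
  then show ?thesis by (simp add: prob_space)
qed

text \<open>A grid with two intervals shows that the transform is multiplicative in
  \<open>t\<close>. It lies between 0 (excluded) and 1, so minus its logarithm is additive and
  nonnegative, hence linear in \<open>t\<close>.\<close>

theorem expectation_exp_L:
  assumes x: "0 \<le> x" and t: "0 \<le> t"
  shows "expectation (\<lambda>w. exp (- x * L t w)) = exp (- t * \<Psi> x)"
proof -
  define f where "f t = expectation (\<lambda>w. exp (- x * L t w))" for t
  have f: "0 < f t" "f t \<le> 1" if "0 \<le> t" for t
    using that x expectation_exp_pos expectation_exp_le_1 by (auto simp: f_def)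
  have fmult: "f (s + t) = f s * f t" if "0 \<le> s" "0 \<le> t" for s t
  proof -
    define u where "u j = (if j = 0 then 0 else if j = 1 then s else s + t)" for j :: nat
    have u: "time_grid u 2" using that by (auto simp: time_grid_def u_def)
    have "f (s + t) = expectation (\<lambda>w. exp (- path_comb L u 2 (\<lambda>_. x) w))"
      unfolding f_def by (intro Bochner_Integration.integral_cong)
        (auto simp: path_comb_def u_def numeral_2_eq_2 L_zero algebra_simps)
    also have "\<dots> = f s * f t"
      by (subst expectation_exp_path_comb[OF u]) (use x in \<open>auto simp: numeral_2_eq_2 u_def f_def\<close>)
    finally show ?thesis .
  qed
  have "f t \<noteq> 0" if "0 \<le> t" for t using f(1)[OF that] by simp
  then have "- ln (f t) = t * - ln (f 1)"
    using f fmult t by (intro additive_nonneg_linear[where g = "\<lambda>t. - ln (f t)"]) (auto simp: ln_mult)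
  also have "- ln (f 1) = \<Psi> x" by (simp add: laplace_exponent_def f_def)
  finally have "ln (f t) = - t * \<Psi> x" by simp
  then have "f t = exp (- t * \<Psi> x)" using f(1)[OF t] by (metis exp_ln)
  then show ?thesis by (simp add: f_def)
qed

lemma \<Psi>_zero: "\<Psi> 0 = 0"
  by (simp add: laplace_exponent_def prob_space)

lemma \<Psi>_nonneg: "0 \<le> x \<Longrightarrow> 0 \<le> \<Psi> x"
  using expectation_exp_le_1[of x 1] expectation_exp_pos[of x 1] by (simp add: laplace_exponent_def)

text \<open>If \<open>\<Psi> x\<close> vanished, \<open>1 - exp (- x * L t w)\<close> would be
  nonnegative with mean 0 for each \<open>t\<close>, so \<open>L\<close> would vanish almost surely
  at each time, which the definition of a subordinator excludes.\<close>

lemma \<Psi>_pos: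
  assumes "0 < x"
  shows "0 < \<Psi> x"
proof (rule ccontr)
  assume "\<not> 0 < \<Psi> x"
  with \<Psi>_nonneg[of x] assms have eq: "\<Psi> x = 0" by simp
  have "AE w in M. L t w = 0" if t: "0 \<le> t" for t
  proof -
    have i: "integrable M (\<lambda>w. exp (- x * L t w))" using integrable_exp_L assms t by simp
    have "expectation (\<lambda>w. 1 - exp (- x * L t w)) = 0"
      using expectation_exp_L[of x t] i assms t eq
      by (subst Bochner_Integration.integral_diff) (auto simp: prob_space)
    moreover have "AE w in M. 0 \<le> 1 - exp (- x * L t w)"
      using assms t by (intro AE_I2) (auto intro!: mult_nonneg_nonneg L_nonneg)
    ultimately have "AE w in M. 1 - exp (- x * L t w) = 0"
      using integral_nonneg_eq_0_iff_AE[of M "\<lambda>w. 1 - exp (- x * L t w)"] i by auto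
    then show ?thesis using assms by simp
  qed
  then show False using sub by (auto simp: levy_subordinator_def)
qed

text \<open>Continuity serves to exclude ties: there, combinations are scaled by factors that tend
  to 1, and the exponents have to converge.\<close>

lemma \<Psi>_continuous: "continuous_on {0..} \<Psi>"
proof -
  have "continuous_on {0..} (\<lambda>x. expectation (\<lambda>w. exp (- x * L 1 w)))"
    unfolding continuous_on_sequentially
  proof (intro allI ballI impI)
    fix xs :: "nat \<Rightarrow> real" and a assume a: "a \<in> {0..}" and xs: "(\<forall>m. xs m \<in> {0..}) \<and> xs \<longlonglongrightarrow> a"
    have "(\<lambda>m. expectation (\<lambda>w. exp (- xs m * L 1 w))) \<longlonglongrightarrow> expectation (\<lambda>w. exp (- a * L 1 w))"
    proof (rule integral_dominated_convergence[where w = "\<lambda>_. 1"])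
      show "AE w in M. (\<lambda>m. exp (- xs m * L 1 w)) \<longlonglongrightarrow> exp (- a * L 1 w)"
        using xs by (intro AE_I2 tendsto_intros) auto
      show "AE w in M. norm (exp (- xs m * L 1 w)) \<le> 1" for m
        using xs by (intro AE_I2) (auto intro!: mult_nonneg_nonneg L_nonneg)
    qed auto
    then show "((\<lambda>x. expectation (\<lambda>w. exp (- x * L 1 w))) \<circ> xs) \<longlonglongrightarrow> expectation (\<lambda>w. exp (- a * L 1 w))"
      by (simp add: o_def)
  qed
  moreover have "\<forall>x\<in>{0..}. expectation (\<lambda>w. exp (- x * L 1 w)) \<noteq> 0"
    using expectation_exp_pos[of _ 1] by (auto simp: less_le)
  ultimately have "continuous_on {0..} (\<lambda>x. - ln (expectation (\<lambda>w. exp (- x * L 1 w))))"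
    by (intro continuous_intros) auto
  then show ?thesis by (simp add: laplace_exponent_def[abs_def])
qed

lemma expectation_exp_path_comb_\<Psi>:
  assumes u: "time_grid u p" and c: "\<And>j. j < p \<Longrightarrow> 0 \<le> c j"
  shows "expectation (\<lambda>w. exp (- path_comb L u p c w)) = exp (- psi_comb \<Psi> u p c)"
proof -
  have "(\<Prod>j<p. expectation (\<lambda>w. exp (- c j * L (u (Suc j) - u j) w))) =
      (\<Prod>j<p. exp (- (u (Suc j) - u j) * \<Psi> (c j)))"
    using u c by (intro prod.cong expectation_exp_L) (auto simp: time_grid_def)
  then show ?thesis
    using expectation_exp_path_comb[OF u c]
    by (simp only: psi_comb_def exp_sum[OF finite_lessThan, symmetric] sum_negf mult_minus_left)
qed

text \<open>Given the path, the thresholds are independent with exponential tails, so survival has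
  probability \<open>exp\<close> of minus the sum of the combinations. That sum is again a
  combination, with coefficients \<open>\<Sum>x\<in>J. b x j\<close>, and its Laplace transform is
  known.\<close>

theorem survival_probability:
  assumes iid: "iid_std_exp_indep_of M L I X" and J: "finite J" "J \<subseteq> I"
    and u: "time_grid u p" and b: "\<And>x j. 0 \<le> b x j"
  shows "measure M {w \<in> space M. \<forall>x\<in>J. path_comb L u p (b x) w < X x w} =
    exp (- psi_comb \<Psi> u p (\<lambda>j. \<Sum>x\<in>J. b x j))"
\<comment> \<open>An intersection of events over the empty set would be the whole type, so this case
  is separate.\<close>
proof (cases "J = {}")
  case True
  then show ?thesis by (simp add: prob_space psi_comb_def \<Psi>_zero)
next
  case False
  have u0: "0 \<le> u j" if "j \<le> p" for j using time_grid_nonneg[OF u that] .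
  have u1: "u j \<le> u (Suc j)" if "j < p" for j using u that by (simp add: time_grid_def)
  have expX: "distributed M lborel (X x) (exponential_density 1)" if "x \<in> J" for x
    using iid that J by (auto simp: iid_std_exp_indep_of_def)
  have X[measurable]: "X x \<in> borel_measurable M" if "x \<in> J" for x
    using distributed_measurable[OF expX[OF that]] by simp
  have indX: "indep_vars (\<lambda>_. borel) X J"
    using iid J by (auto simp: iid_std_exp_indep_of_def intro: indep_vars_subset)
  \<comment> \<open>Only finitely many increments and thresholds matter. They are measurable with
    respect to the two independent generated \<open>\<sigma>\<close>-algebras, so their joint law is
    a product and can be integrated one factor at a time.\<close>
  define PZ where "PZ = (PiM {..<p} (\<lambda>_. borel) :: (nat \<Rightarrow> real) measure)"
  define PX where "PX = (PiM J (\<lambda>_. borel) :: ('b \<Rightarrow> real) measure)"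
  define Z where "Z w = (\<lambda>j\<in>{..<p}. L (u (Suc j)) w - L (u j) w)" for w
  define Y where "Y w = (\<lambda>x\<in>J. X x w)" for w
  have Z[measurable]: "Z \<in> measurable M PZ"
    unfolding Z_def PZ_def using u0 by (intro measurable_restrict borel_measurable_diff L_measurable) auto
  have Y[measurable]: "Y \<in> measurable M PX"
    unfolding Y_def PX_def by (intro measurable_restrict) auto
  let ?VL = "vimage_algebra (space M) (\<lambda>w. \<lambda>t\<in>{0..}. L t w) (PiM {0..} (\<lambda>_. borel))"
  let ?VX = "vimage_algebra (space M) (\<lambda>w. \<lambda>i\<in>I. X i w) (PiM I (\<lambda>_. borel))"
  have ZV: "Z \<in> measurable ?VL PZ"
  proof -
    have "(\<lambda>w. \<lambda>j\<in>{..<p}. (w (u (Suc j)) - w (u j) :: real)) \<in> measurable (PiM {0..} (\<lambda>_. borel)) PZ"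
      unfolding PZ_def using u0
      by (intro measurable_restrict borel_measurable_diff measurable_component_singleton) auto
    then have "(\<lambda>w. \<lambda>j\<in>{..<p}. (w (u (Suc j)) - w (u j) :: real)) \<circ> (\<lambda>w. \<lambda>t\<in>{0..}. L t w) \<in> measurable ?VL PZ"
      by (rule measurable_comp[rotated]) (auto intro!: measurable_vimage_algebra1 simp: space_PiM)
    also have "(\<lambda>w. \<lambda>j\<in>{..<p}. (w (u (Suc j)) - w (u j) :: real)) \<circ> (\<lambda>w. \<lambda>t\<in>{0..}. L t w) = Z"
      using u0 by (auto simp: Z_def fun_eq_iff)
    finally show ?thesis .
  qed
  have YV: "Y \<in> measurable ?VX PX"
  proof -
    have "(\<lambda>w. \<lambda>x\<in>J. (w x :: real)) \<in> measurable (PiM I (\<lambda>_. borel)) PX"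
      unfolding PX_def using J by (intro measurable_restrict measurable_component_singleton) auto
    then have "(\<lambda>w. \<lambda>x\<in>J. (w x :: real)) \<circ> (\<lambda>w. \<lambda>i\<in>I. X i w) \<in> measurable ?VX PX"
      by (rule measurable_comp[rotated]) (auto intro!: measurable_vimage_algebra1 simp: space_PiM)
    also have "(\<lambda>w. \<lambda>x\<in>J. (w x :: real)) \<circ> (\<lambda>w. \<lambda>i\<in>I. X i w) = Y"
      using J by (auto simp: Y_def fun_eq_iff)
    finally show ?thesis .
  qed
  define S where "S = {w \<in> space (PZ \<Otimes>\<^sub>M PX). \<forall>x\<in>J. (\<Sum>j<p. b x j * fst w j) < snd w x}"
  have "(\<lambda>w. fst w j) \<in> borel_measurable (PZ \<Otimes>\<^sub>M PX)" if "j < p" for j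
    unfolding PZ_def using that
    by (intro measurable_compose[OF measurable_fst measurable_component_singleton]) simp
  moreover have "(\<lambda>w. snd w x) \<in> borel_measurable (PZ \<Otimes>\<^sub>M PX)" if "x \<in> J" for x
    unfolding PX_def using that
    by (intro measurable_compose[OF measurable_snd measurable_component_singleton]) simp
  ultimately have S[measurable]: "S \<in> sets (PZ \<Otimes>\<^sub>M PX)"
    unfolding S_def using J
    by (intro sets.sets_Collect_finite_All borel_measurable_less borel_measurable_sum
        borel_measurable_times borel_measurable_const) auto
  interpret DZ: prob_space "distr M PZ Z" by (rule prob_space_distr[OF Z])
  interpret DY: prob_space "distr M PX Y" by (rule prob_space_distr[OF Y])
  have "distr M PZ Z \<Otimes>\<^sub>M distr M PX Y = distr M (PZ \<Otimes>\<^sub>M PX) (\<lambda>w. (Z w, Y w))"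
  proof (rule pair_measure_eqI)
    fix A B assume "A \<in> sets (distr M PZ Z)" "B \<in> sets (distr M PX Y)"
    then have AB[measurable]: "A \<in> sets PZ" "B \<in> sets PX" by auto
    have "indep_set (sets ?VL) (sets ?VX)" using iid by (simp add: iid_std_exp_indep_of_def)
    moreover have "Z -` A \<inter> space M \<in> sets ?VL" "Y -` B \<inter> space M \<in> sets ?VX"
      using measurable_sets[OF ZV AB(1)] measurable_sets[OF YV AB(2)] by auto
    ultimately have "prob ((Z -` A \<inter> space M) \<inter> (Y -` B \<inter> space M)) =
        prob (Z -` A \<inter> space M) * prob (Y -` B \<inter> space M)"
      unfolding indep_sets2_eq by blast
    moreover have "(\<lambda>w. (Z w, Y w)) -` (A \<times> B) \<inter> space M = (Z -` A \<inter> space M) \<inter> (Y -` B \<inter> space M)"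
      by auto
    ultimately show "emeasure (distr M PZ Z) A * emeasure (distr M PX Y) B =
        emeasure (distr M (PZ \<Otimes>\<^sub>M PX) (\<lambda>w. (Z w, Y w))) (A \<times> B)"
      by (simp add: emeasure_distr emeasure_eq_measure ennreal_mult'')
  qed (auto intro!: prob_space_imp_sigma_finite prob_space_distr Z Y simp: PZ_def[symmetric] cong: sets_pair_measure_cong)
  note joint = this
  have S_slice: "Pair z -` S \<in> sets PX" for z
    by (rule sets_Pair1[OF S])
  have slice: "emeasure (distr M PX Y) (Pair (Z w) -` S) = ennreal (exp (- path_comb L u p (\<lambda>j. \<Sum>x\<in>J. b x j) w))"
    if w: "w \<in> space M" for w
  proof -
    define c where "c x = path_comb L u p (b x) w" for x
    have c: "0 \<le> c x" for x
      unfolding c_def path_comb_def using b L_mono[OF w u0 u1] by (intro sum_nonneg mult_nonneg_nonneg) auto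
    have cZ: "(\<Sum>j<p. b x j * Z w j) = c x" for x by (simp add: c_def path_comb_def Z_def)
    have "Y -` (Pair (Z w) -` S) \<inter> space M = (\<Inter>x\<in>J. X x -` {c x<..} \<inter> space M)"
      using False measurable_space[OF Z w] measurable_space[OF Y]
      by (auto simp: S_def space_pair_measure cZ Y_def)
    then have "emeasure (distr M PX Y) (Pair (Z w) -` S) = emeasure M (\<Inter>x\<in>J. X x -` {c x<..} \<inter> space M)"
      by (subst emeasure_distr[OF Y S_slice]) simp
    also have "\<dots> = ennreal (prob (\<Inter>x\<in>J. X x -` {c x<..} \<inter> space M))" by (simp add: emeasure_eq_measure)
    also have "prob (\<Inter>x\<in>J. X x -` {c x<..} \<inter> space M) = (\<Prod>x\<in>J. prob (X x -` {c x<..} \<inter> space M))"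
      using False J by (intro indep_varsD_finite[OF indX]) auto
    also have "\<dots> = (\<Prod>x\<in>J. exp (- c x))"
    proof (rule prod.cong)
      fix x assume x: "x \<in> J"
      have "X x -` {c x<..} \<inter> space M = {w \<in> space M. c x < X x w}" by auto
      then show "prob (X x -` {c x<..} \<inter> space M) = exp (- c x)"
        using exponential_distributedD_gt[OF expX[OF x] c[of x]] by simp
    qed simp
    also have "\<dots> = exp (- (\<Sum>x\<in>J. c x))" using J by (simp add: exp_sum[symmetric] sum_negf)
    also have "(\<Sum>x\<in>J. c x) = path_comb L u p (\<lambda>j. \<Sum>x\<in>J. b x j) w"
      unfolding c_def path_comb_def sum_distrib_right by (rule sum.swap)
    finally show ?thesis .
  qed
  have "{w \<in> space M. \<forall>x\<in>J. path_comb L u p (b x) w < X x w} = (\<lambda>w. (Z w, Y w)) -` S \<inter> space M"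
    using measurable_space[OF Z] measurable_space[OF Y]
    by (auto simp: S_def space_pair_measure Y_def Z_def path_comb_def)
  then have "emeasure M {w \<in> space M. \<forall>x\<in>J. path_comb L u p (b x) w < X x w} =
      emeasure (distr M (PZ \<Otimes>\<^sub>M PX) (\<lambda>w. (Z w, Y w))) S"
    by (subst emeasure_distr) auto
  also have "\<dots> = emeasure (distr M PZ Z \<Otimes>\<^sub>M distr M PX Y) S"
    by (simp only: joint)
  also have "\<dots> = (\<integral>\<^sup>+ z. emeasure (distr M PX Y) (Pair z -` S) \<partial>distr M PZ Z)"
    by (rule DY.emeasure_pair_measure_alt) simp
  also have "\<dots> = (\<integral>\<^sup>+ w. emeasure (distr M PX Y) (Pair (Z w) -` S) \<partial>M)"
    by (rule nn_integral_distr[OF Z]) (intro DY.measurable_emeasure_Pair, simp)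
  also have "\<dots> = (\<integral>\<^sup>+ w. ennreal (exp (- path_comb L u p (\<lambda>j. \<Sum>x\<in>J. b x j) w)) \<partial>M)"
    by (rule nn_integral_cong) (rule slice)
  also have "\<dots> = ennreal (expectation (\<lambda>w. exp (- path_comb L u p (\<lambda>j. \<Sum>x\<in>J. b x j) w)))"
  proof (rule nn_integral_eq_integral)
    show "integrable M (\<lambda>w. exp (- path_comb L u p (\<lambda>j. \<Sum>x\<in>J. b x j) w))"
    proof (rule integrable_const_bound[where B = 1])
      show "AE w in M. norm (exp (- path_comb L u p (\<lambda>j. \<Sum>x\<in>J. b x j) w)) \<le> 1"
        using b L_mono[OF _ u0 u1]
        by (intro AE_I2) (auto simp: path_comb_def intro!: sum_nonneg mult_nonneg_nonneg)
      show "(\<lambda>w. exp (- path_comb L u p (\<lambda>j. \<Sum>x\<in>J. b x j) w)) \<in> borel_measurable M"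
        using path_comb_measurable[OF L_measurable u, where c = "\<lambda>j. \<Sum>x\<in>J. b x j"] by simp
    qed
  qed simp
  also have "\<dots> = ennreal (exp (- psi_comb \<Psi> u p (\<lambda>j. \<Sum>x\<in>J. b x j)))"
    using b by (subst expectation_exp_path_comb_\<Psi>[OF u]) (auto intro: sum_nonneg)
  finally show ?thesis by (simp add: emeasure_eq_measure)
qed

end

section \<open>Systems of components with a common frailty\<close>

text \<open>Times are rounded up to multiples of \<open>1 / Suc k\<close>. Rounding up keeps
  right-continuity applicable, and whether a first passage is rounded to a given grid time is
  decided by the states at this grid time and its predecessor.\<close>

definition grid_index :: "nat \<Rightarrow> real \<Rightarrow> nat" where
  "grid_index k t = nat \<lceil>t * real (Suc k)\<rceil>"

definition grid_time :: "nat \<Rightarrow> real \<Rightarrow> real" where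
  "grid_time k t = real (grid_index k t) / real (Suc k)"

lemma grid_time_bounds:
  assumes "0 \<le> t"
  shows "t \<le> grid_time k t" "grid_time k t \<le> t + 1 / real (Suc k)" "grid_time k t \<le> t + 1"
proof -
  have *: "0 \<le> t * real (Suc k)" using assms by simp
  have "0 \<le> \<lceil>t * real (Suc k)\<rceil>" using * by (simp only: zero_le_ceiling)
  then have "t * real (Suc k) \<le> real (grid_index k t)" "real (grid_index k t) \<le> t * real (Suc k) + 1"
    unfolding grid_index_def by (simp_all only: of_nat_nat le_of_int_ceiling of_int_ceiling_le_add_one)
  then show 1: "t \<le> grid_time k t" and 2: "grid_time k t \<le> t + 1 / real (Suc k)"
    by (simp_all add: grid_time_def pos_le_divide_eq pos_divide_le_eq distrib_right)
  have "1 / real (Suc k) \<le> 1" by simp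
  then show "grid_time k t \<le> t + 1" using 2 by linarith
qed

lemma grid_time_tendsto:
  assumes "0 \<le> t"
  shows "(\<lambda>k. grid_time k t) \<longlonglongrightarrow> t"
proof (rule tendsto_sandwich[of "\<lambda>_. t" _ _ "\<lambda>k. t + 1 / real (Suc k)"])
  have "(\<lambda>k. t + 1 / real (Suc k)) \<longlonglongrightarrow> t + 0"
    by (intro tendsto_add tendsto_const LIMSEQ_inverse_real_of_nat[unfolded inverse_eq_divide])
  then show "(\<lambda>k. t + 1 / real (Suc k)) \<longlonglongrightarrow> t" by simp
qed (use grid_time_bounds[OF assms] in auto)

lemma grid_index_eq_iff:
  assumes "0 < l"
  shows "grid_index k t = l \<longleftrightarrow> real (l - 1) / real (Suc k) < t \<and> t \<le> real l / real (Suc k)"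
proof -
  have "grid_index k t = l \<longleftrightarrow> \<lceil>t * real (Suc k)\<rceil> = int l"
    using assms by (auto simp: grid_index_def)
  also have "\<dots> \<longleftrightarrow> real l - 1 < t * real (Suc k) \<and> t * real (Suc k) \<le> real l"
    by (simp only: ceiling_eq_iff of_int_of_nat_eq)
  also have "\<dots> \<longleftrightarrow> real (l - 1) / real (Suc k) < t \<and> t \<le> real l / real (Suc k)"
    using assms by (simp add: pos_divide_less_eq pos_le_divide_eq of_nat_diff)
  finally show ?thesis .
qed

section \<open>First passage of the number of dead components\<close>

definition dead :: "(real \<Rightarrow> 'a \<Rightarrow> real) \<Rightarrow> (nat \<times> nat \<Rightarrow> 'a \<Rightarrow> real) \<Rightarrow> nat \<Rightarrow> real \<Rightarrow> 'a \<Rightarrow> nat set" where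
  "dead L X n t w = {i \<in> {1..n}. X (i, 0) w \<le> L t w}"

text \<open>\<open>X (i, 0)\<close> is the current threshold of component \<open>i\<close>; the
  entries \<open>X (i, Suc m)\<close> are in reserve for later repairs. The infimum is over
  \<open>t > 0\<close> because a repair has to come strictly after the preceding one.\<close>

definition passage :: "(real \<Rightarrow> 'a \<Rightarrow> real) \<Rightarrow> (nat \<times> nat \<Rightarrow> 'a \<Rightarrow> real) \<Rightarrow> nat \<Rightarrow> nat \<Rightarrow> 'a \<Rightarrow> ennreal" where
  "passage L X n q w = Inf {ennreal t | t. 0 < t \<and> q \<le> card (dead L X n t w)}"

definition passage_time :: "(real \<Rightarrow> 'a \<Rightarrow> real) \<Rightarrow> (nat \<times> nat \<Rightarrow> 'a \<Rightarrow> real) \<Rightarrow> nat \<Rightarrow> nat \<Rightarrow> 'a \<Rightarrow> real" where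
  "passage_time L X n q w = enn2real (passage L X n q w)"

definition passage_count :: "(real \<Rightarrow> 'a \<Rightarrow> real) \<Rightarrow> (nat \<times> nat \<Rightarrow> 'a \<Rightarrow> real) \<Rightarrow> nat \<Rightarrow> nat \<Rightarrow> 'a \<Rightarrow> nat" where
  "passage_count L X n q w = card (dead L X n (passage_time L X n q w) w)"

lemma finite_dead[simp]: "finite (dead L X n t w)"
  by (simp add: dead_def)

lemma dead_subset: "dead L X n t w \<subseteq> {1..n}"
  by (auto simp: dead_def)

lemma card_dead_le: "card (dead L X n t w) \<le> n"
  using card_mono[OF _ dead_subset, of n L X t w] by simp

lemma passage_time_nonneg[simp]: "0 \<le> passage_time L X n q w"
  by (simp add: passage_time_def)

text \<open>The probability, per unit of mass, that fewer than \<open>q\<close> components are dead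
  at time \<open>s\<close>; \<open>order_mean\<close> is its integral over \<open>s\<close>.\<close>

definition order_tail :: "(real \<Rightarrow> real) \<Rightarrow> nat \<Rightarrow> nat \<Rightarrow> real \<Rightarrow> real" where
  "order_tail \<Psi> n q s = (\<Sum>i = n - q + 1..n.
     real (n choose i) * real (i - 1 choose (n - q)) * (- 1) ^ (i + q - n - 1) * exp (- s * \<Psi> (real i)))"

definition order_mean :: "(real \<Rightarrow> real) \<Rightarrow> nat \<Rightarrow> nat \<Rightarrow> real" where
  "order_mean \<Psi> n q = (\<Sum>i = n - q + 1..n.
     real (n choose i) * real (i - 1 choose (n - q)) * (- 1) ^ (i + q - n - 1) / \<Psi> (real i))"

lemma exp_decay_tendsto:
  assumes "0 < (a :: real)"
  shows "((\<lambda>s. exp (- s * a)) \<longlongrightarrow> 0) at_top"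
proof (rule filterlim_compose[OF exp_at_bot])
  have "filterlim (\<lambda>s. a * s) at_top at_top"
    by (rule filterlim_tendsto_pos_mult_at_top[OF tendsto_const assms filterlim_ident])
  then show "filterlim (\<lambda>s. - s * a) at_bot at_top"
    by (simp add: filterlim_uminus_at_bot mult.commute)
qed

lemma suminf_ge_term: "f l \<le> suminf f" for f :: "nat \<Rightarrow> ennreal"
  using sum_le_suminf[of f "{l}"] by simp

lemma has_bochner_integral_exp_decay:
  assumes "0 < a"
  shows "has_bochner_integral lborel (\<lambda>s. exp (- s * a) * indicator {0::real..} s) (1 / a)"
proof (rule has_bochner_integral_nn_integral)
  have "(\<integral>\<^sup>+ s. ennreal (exp (- s * a)) * indicator {0..} s \<partial>lborel) = ennreal (0 - (- exp (- 0 * a) / a))"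
  proof (rule nn_integral_FTC_atLeast)
    show "((\<lambda>s. - exp (- s * a) / a) \<longlongrightarrow> 0) at_top"
      using tendsto_divide[OF tendsto_minus[OF exp_decay_tendsto[OF assms]] tendsto_const[of a]] assms by simp
    show "((\<lambda>s. - exp (- s * a) / a) has_real_derivative exp (- x * a)) (at x)" for x
      using assms by (auto intro!: derivative_eq_intros)
  qed auto
  moreover have "ennreal (exp (- s * a) * indicator {0..} s) = ennreal (exp (- s * a)) * indicator {0..} s" for s :: real
    by (auto simp: indicator_def)
  ultimately show "(\<integral>\<^sup>+ s. ennreal (exp (- s * a) * indicator {0..} s) \<partial>lborel) = ennreal (1 / a)"
    by simp
qed (use assms in auto)

text \<open>Layer-cake formula for a single value. It includes \<open>y = \<top>\<close>, so a mean
  can be computed from tails before finiteness is known.\<close>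

lemma nn_integral_below_ennreal:
  "(\<integral>\<^sup>+ s. indicator {s. 0 \<le> s \<and> ennreal s < y} s \<partial>lborel) = y"
proof (cases y)
  case (real r)
  then have "{s. 0 \<le> s \<and> ennreal s < y} = {0..<r}" by (auto simp: ennreal_less_iff)
  then show ?thesis using real by simp
next
  case top
  have "{s. 0 \<le> s \<and> ennreal s < y} = {0..}" using top by (auto simp: less_top[symmetric])
  moreover have "emeasure lborel {0 :: real..} = \<top>"
  proof (rule ccontr)
    assume *: "emeasure lborel {0 :: real..} \<noteq> \<top>"
    define v where "v = enn2real (emeasure lborel {0 :: real..})"
    have v: "emeasure lborel {0 :: real..} = ennreal v" "0 \<le> v" using * by (auto simp: v_def less_top)
    have "ennreal (v + 1) = emeasure lborel {0..v + 1}" using v by simp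
    also have "\<dots> \<le> emeasure lborel {0 :: real..}" by (intro emeasure_mono) auto
    finally show False using v by simp
  qed
  ultimately show ?thesis using top by simp
qed

text \<open>With \<open>I = {1..n} \<times> UNIV\<close> these hypotheses are preserved by
  restarting; \<open>I = {1..n} \<times> {0}\<close> serves for lifetimes without repairs.
  \<open>M\<close> is only finite because restarted systems carry a density, and
  \<open>\<Psi>\<close> is a parameter because it stays the same while the measure changes.\<close>

locale frailty_system = finite_measure M
  for M :: "'a measure" +
  fixes L :: "real \<Rightarrow> 'a \<Rightarrow> real" and X :: "nat \<times> nat \<Rightarrow> 'a \<Rightarrow> real" and I :: "(nat \<times> nat) set"
    and n q :: nat and \<Psi> :: "real \<Rightarrow> real"
  assumes q: "1 \<le> q" "q \<le> n"
    and I: "{1..n} \<times> {0} \<subseteq> I"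
    and \<Psi>_zero: "\<Psi> 0 = 0" and \<Psi>_pos: "\<And>x. 0 < x \<Longrightarrow> 0 < \<Psi> x" and \<Psi>_continuous: "continuous_on {0..} \<Psi>"
    and L_measurable[measurable]: "\<And>t. 0 \<le> t \<Longrightarrow> L t \<in> borel_measurable M"
    and X_measurable[measurable]: "\<And>x. x \<in> I \<Longrightarrow> X x \<in> borel_measurable M"
    and L_zero: "\<And>w. w \<in> space M \<Longrightarrow> L 0 w = 0"
    and L_right_continuous: "\<And>w t. w \<in> space M \<Longrightarrow> 0 \<le> t \<Longrightarrow> continuous (at_right t) (\<lambda>s. L s w)"
    and L_mono: "\<And>w s t. w \<in> space M \<Longrightarrow> 0 \<le> s \<Longrightarrow> s \<le> t \<Longrightarrow> L s w \<le> L t w"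
    and survival: "\<And>J u p b. finite J \<Longrightarrow> J \<subseteq> I \<Longrightarrow> time_grid u p \<Longrightarrow> (\<And>x j. 0 \<le> b x j) \<Longrightarrow>
      measure M {w \<in> space M. \<forall>x\<in>J. path_comb L u p (b x) w < X x w} =
      measure M (space M) * exp (- psi_comb \<Psi> u p (\<lambda>j. \<Sum>x\<in>J. b x j))"
begin

abbreviation "mass \<equiv> measure M (space M)"
abbreviation "D t w \<equiv> dead L X n t w"
abbreviation "fp w \<equiv> passage L X n q w"
abbreviation "T w \<equiv> passage_time L X n q w"
abbreviation "N w \<equiv> passage_count L X n q w"

lemma X0_measurable[measurable]: "i \<in> {1..n} \<Longrightarrow> X (i, 0) \<in> borel_measurable M"
  using I by (intro X_measurable) auto

lemma \<Psi>_nonneg: "0 \<le> x \<Longrightarrow> 0 \<le> \<Psi> x"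
  using \<Psi>_pos[of x] \<Psi>_zero by (cases "x = 0") auto

lemma L_nonneg: "w \<in> space M \<Longrightarrow> 0 \<le> t \<Longrightarrow> 0 \<le> L t w"
  using L_mono[of w 0 t] L_zero[of w] by simp

lemma dead_mono: "w \<in> space M \<Longrightarrow> 0 \<le> s \<Longrightarrow> s \<le> t \<Longrightarrow> D s w \<subseteq> D t w"
  using L_mono[of w s t] by (auto simp: dead_def)

lemma card_dead_mono: "w \<in> space M \<Longrightarrow> 0 \<le> s \<Longrightarrow> s \<le> t \<Longrightarrow> card (D s w) \<le> card (D t w)"
  by (intro card_mono dead_mono) auto

lemma L_seq_tendsto:
  assumes "w \<in> space M" "0 \<le> t" "\<And>k. t \<le> s k" "s \<longlonglongrightarrow> t"
  shows "(\<lambda>k. L (s k) w) \<longlonglongrightarrow> L t w"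
proof -
  have "continuous (at t within {t..}) (\<lambda>s. L s w)"
    using L_right_continuous[OF assms(1,2)] by (simp add: at_within_Ici_at_right)
  then show ?thesis
    using assms(3,4) unfolding continuous_within_sequentially by (auto simp: o_def)
qed

text \<open>A dead component stays dead because \<open>L\<close> is monotone. An alive one has
  \<open>L\<close> strictly below its threshold, which persists for a short time by
  right-continuity.\<close>

lemma eventually_dead_eq:
  assumes "w \<in> space M" "0 \<le> t" "\<And>k. t \<le> s k" "s \<longlonglongrightarrow> t"
  shows "eventually (\<lambda>k. D (s k) w = D t w) sequentially"
proof -
  have lim: "(\<lambda>k. L (s k) w) \<longlonglongrightarrow> L t w" by (rule L_seq_tendsto[OF assms])
  have "eventually (\<lambda>k. \<forall>i\<in>{1..n}. X (i, 0) w \<le> L (s k) w \<longleftrightarrow> X (i, 0) w \<le> L t w) sequentially"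
  proof (intro eventually_ball_finite ballI)
    fix i
    show "eventually (\<lambda>k. X (i, 0) w \<le> L (s k) w \<longleftrightarrow> X (i, 0) w \<le> L t w) sequentially"
    proof (cases "X (i, 0) w \<le> L t w")
      case True
      have "X (i, 0) w \<le> L (s k) w" for k using True L_mono[OF assms(1,2) assms(3)[of k]] by linarith
      then show ?thesis using True by simp
    next
      case False
      then have "eventually (\<lambda>k. L (s k) w < X (i, 0) w) sequentially"
        using lim by (intro order_tendstoD) auto
      then show ?thesis using False by (auto elim!: eventually_mono)
    qed
  qed simp
  then show ?thesis by eventually_elim (auto simp: dead_def)
qed

lemma AE_X_pos: "AE w in M. \<forall>x\<in>I. 0 < X x w"
proof -
  have "AE w in M. 0 < X x w" if x: "x \<in> I" for x
  proof -
    \<comment> \<open>A grid without intervals turns survival into positivity of the threshold, with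
      exponent 0.\<close>
    have "measure M {w \<in> space M. 0 < X x w} = mass"
      using survival[of "{x}" "\<lambda>_. 0" 0 "\<lambda>_ _. 0"] x
      by (simp add: time_grid_def path_comb_def psi_comb_def)
    moreover have "{w \<in> space M. 0 < X x w} \<in> sets M" using x by measurable
    ultimately have "measure M (space M - {w \<in> space M. 0 < X x w}) = 0"
      by (subst finite_measure_compl) auto
    with x show ?thesis
      by (intro AE_I'[of "space M - {w \<in> space M. 0 < X x w}"])
        (auto simp: null_sets_def emeasure_eq_measure)
  qed
  then show ?thesis by (intro AE_ball_countable[THEN iffD2]) auto
qed

lemma AE_X0_pos: "AE w in M. \<forall>i\<in>{1..n}. 0 < X (i, 0) w"
  using AE_X_pos by eventually_elim (use I in auto)

lemma dead_zero_empty: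
  assumes "w \<in> space M" "\<forall>i\<in>{1..n}. 0 < X (i, 0) w"
  shows "D 0 w = {}"
  using assms by (force simp: dead_def L_zero)

text \<open>Right-continuity makes the infimum a minimum: if fewer than \<open>q\<close> components
  are dead at \<open>s\<close>, this persists beyond \<open>s\<close>. Positive thresholds settle
  \<open>s = 0\<close>, a time that the infimum does not admit.\<close>

lemma passage_greater_iff:
  assumes w: "w \<in> space M" "\<forall>i\<in>{1..n}. 0 < X (i, 0) w" and s: "0 \<le> s"
  shows "ennreal s < fp w \<longleftrightarrow> card (D s w) < q"
proof
  assume less: "ennreal s < fp w"
  show "card (D s w) < q"
  proof (rule ccontr)
    assume c: "\<not> card (D s w) < q"
    then have "s \<noteq> 0" using dead_zero_empty[OF w] q by auto
    then have "fp w \<le> ennreal s"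
      unfolding passage_def using c s by (intro Inf_lower) auto
    then show False using less by simp
  qed
next
  assume c: "card (D s w) < q"
  have "eventually (\<lambda>k. D (s + 1 / real (Suc k)) w = D s w) sequentially"
  proof (rule eventually_dead_eq[OF w(1) s])
    have "(\<lambda>k. s + 1 / real (Suc k)) \<longlonglongrightarrow> s + 0"
      by (intro tendsto_add tendsto_const LIMSEQ_inverse_real_of_nat[unfolded inverse_eq_divide])
    then show "(\<lambda>k. s + 1 / real (Suc k)) \<longlonglongrightarrow> s" by simp
  qed simp
  then obtain k where k: "D (s + 1 / real (Suc k)) w = D s w" by (auto simp: eventually_sequentially)
  have "ennreal (s + 1 / real (Suc k)) \<le> fp w"
    unfolding passage_def
  proof (rule Inf_greatest, clarify)
    fix t :: real assume t: "0 < t" "q \<le> card (D t w)"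
    have "s + 1 / real (Suc k) \<le> t"
    proof (rule ccontr)
      assume "\<not> s + 1 / real (Suc k) \<le> t"
      then have "card (D t w) \<le> card (D (s + 1 / real (Suc k)) w)"
        using t by (intro card_dead_mono[OF w(1)]) auto
      then show False using t c k by simp
    qed
    then show "ennreal (s + 1 / real (Suc k)) \<le> ennreal t" by (rule ennreal_leI)
  qed
  moreover have "ennreal s < ennreal (s + 1 / real (Suc k))"
    using s by (intro ennreal_lessI add_nonneg_pos) auto
  ultimately show "ennreal s < fp w" by simp
qed

text \<open>A passage before \<open>y\<close> leaves room for a slightly later rational time. This
  holds at every outcome in the space, so measurability follows without exceptional sets.\<close>

lemma passage_less_iff_rat:
  assumes w: "w \<in> space M"
  shows "fp w < y \<longleftrightarrow> (\<exists>r::rat. 0 < r \<and> ennreal (of_rat r) < y \<and> q \<le> card (D (of_rat r) w))"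
proof
  assume "fp w < y"
  then obtain t where t: "0 < t" "q \<le> card (D t w)" "ennreal t < y"
    unfolding passage_def Inf_less_iff by auto
  obtain z :: real where z: "t < z" "ennreal z \<le> y"
  proof (cases y)
    case (real v)
    then show ?thesis using t that[of v] by (auto simp: ennreal_less_iff)
  next
    case top
    then show ?thesis using that[of "t + 1"] by auto
  qed
  obtain r where r: "t < of_rat r" "of_rat r < z" using of_rat_dense[OF z(1)] by blast
  have "ennreal (of_rat r) < ennreal z" using r t by (intro ennreal_lessI) auto
  moreover have "q \<le> card (D (of_rat r) w)" using card_dead_mono[OF w, of t "of_rat r"] r t by simp
  moreover have "0 < r"
  proof -
    have "0 < (of_rat r :: real)" using r t by linarith
    then show ?thesis by simp
  qed
  moreover note order.strict_trans2[OF calculation(1) z(2)]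
  ultimately show "\<exists>r::rat. 0 < r \<and> ennreal (of_rat r) < y \<and> q \<le> card (D (of_rat r) w)"
    by blast
next
  assume "\<exists>r::rat. 0 < r \<and> ennreal (of_rat r) < y \<and> q \<le> card (D (of_rat r) w)"
  then obtain r :: rat where r: "0 < r" "ennreal (of_rat r) < y" "q \<le> card (D (of_rat r) w)" by blast
  then have "fp w \<le> ennreal (of_rat r)" unfolding passage_def by (intro Inf_lower) auto
  then show "fp w < y" using r(2) by (rule order.strict_trans1)
qed

lemma dead_measurable[measurable]:
  assumes "f \<in> borel_measurable M"
  shows "(\<lambda>w. {i \<in> {1..n}. X (i, 0) w \<le> f w}) \<in> measurable M (count_space UNIV)"
proof -
  have "(\<lambda>w. {i \<in> {1..n}. X (i, 0) w \<le> f w}) \<in> measurable M (count_space (Pow {1..n}))"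
  proof (subst measurable_count_space_eq2, simp, intro conjI ballI)
    fix S assume S: "S \<in> Pow {1..n}"
    have "{i \<in> {1..n}. X (i, 0) w \<le> f w} = S \<longleftrightarrow> (\<forall>i\<in>{1..n}. X (i, 0) w \<le> f w \<longleftrightarrow> i \<in> S)" for w
      using S by blast
    then have "(\<lambda>w. {i \<in> {1..n}. X (i, 0) w \<le> f w}) -` {S} \<inter> space M =
        {w \<in> space M. \<forall>i\<in>{1..n}. X (i, 0) w \<le> f w \<longleftrightarrow> i \<in> S}"
      by blast
    also have "\<dots> \<in> sets M" using assms by measurable
    finally show "(\<lambda>w. {i \<in> {1..n}. X (i, 0) w \<le> f w}) -` {S} \<inter> space M \<in> sets M" .
  qed auto
  then show ?thesis by (rule measurable_compose) simp
qed

lemma D_measurable[measurable]: "0 \<le> t \<Longrightarrow> (\<lambda>w. D t w) \<in> measurable M (count_space UNIV)"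
  unfolding dead_def by (intro dead_measurable) simp

lemma passage_measurable[measurable]: "passage L X n q \<in> borel_measurable M"
proof (rule borel_measurableI_less)
  fix y :: ennreal
  have "{w \<in> space M. fp w < y} =
      {w \<in> space M. \<exists>r::rat. (0 < r \<and> ennreal (of_rat r) < y) \<and> q \<le> card (D (of_rat r) w)}"
    using passage_less_iff_rat[of _ y] by auto
  also have "\<dots> \<in> sets M"
  proof (rule sets.sets_Collect_countable_Ex)
    fix r :: rat
    show "{w \<in> space M. (0 < r \<and> ennreal (of_rat r) < y) \<and> q \<le> card (D (of_rat r) w)} \<in> sets M"
    proof (cases "0 < r \<and> ennreal (of_rat r) < y")
      case True
      then have "0 \<le> (of_rat r :: real)" by simp
      then show ?thesis using True by measurable
    qed simp
  qed
  finally show "{w \<in> space M. fp w < y} \<in> sets M" .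
qed

lemma passage_time_measurable[measurable]: "passage_time L X n q \<in> borel_measurable M"
  unfolding passage_time_def[abs_def] by measurable

text \<open>At a rounded time the value is a countable case distinction; right-continuity passes to
  the limit.\<close>

lemma L_random_time_measurable:
  assumes f[measurable]: "f \<in> borel_measurable M" and f0: "\<And>w. 0 \<le> f w"
  shows "(\<lambda>w. L (f w) w) \<in> borel_measurable M"
proof (rule borel_measurable_LIMSEQ_metric)
  fix k
  have "(\<lambda>w. grid_index k (f w)) \<in> measurable M (count_space UNIV)"
    unfolding grid_index_def by measurable
  then have "(\<lambda>w. (\<lambda>l w. L (real l / real (Suc k)) w) (grid_index k (f w)) w) \<in> borel_measurable M"
    by (rule measurable_compose_countable[rotated]) simp
  then show "(\<lambda>w. L (grid_time k (f w)) w) \<in> borel_measurable M"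
    by (simp add: grid_time_def)
next
  fix w assume "w \<in> space M"
  then show "(\<lambda>k. L (grid_time k (f w)) w) \<longlonglongrightarrow> L (f w) w"
    using f0 by (intro L_seq_tendsto grid_time_bounds grid_time_tendsto)
qed

lemma dead_random_time_measurable:
  assumes "f \<in> borel_measurable M" "\<And>w. 0 \<le> f w"
  shows "(\<lambda>w. D (f w) w) \<in> measurable M (count_space UNIV)"
  unfolding dead_def by (intro dead_measurable L_random_time_measurable assms)

lemma passage_count_measurable[measurable]: "passage_count L X n q \<in> measurable M (count_space UNIV)"
  unfolding passage_count_def[abs_def]
  by (rule measurable_compose[OF dead_random_time_measurable]) auto

lemma measure_alive:
  assumes A: "A \<subseteq> {1..n}" and t: "0 \<le> t"
  shows "measure M {w \<in> space M. \<forall>i\<in>A. L t w < X (i, 0) w} = mass * exp (- t * \<Psi> (real (card A)))"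
proof -
  let ?u = "\<lambda>j::nat. if j = 0 then 0 else t"
  have "measure M {w \<in> space M. \<forall>x\<in>A \<times> {0}. path_comb L ?u 1 (\<lambda>_. 1) w < X x w} =
      mass * exp (- psi_comb \<Psi> ?u 1 (\<lambda>j. \<Sum>x\<in>A \<times> {0::nat}. 1))"
    using A I t finite_subset[OF A] by (intro survival) (auto simp: time_grid_def)
  moreover have "{w \<in> space M. \<forall>x\<in>A \<times> {0}. path_comb L ?u 1 (\<lambda>_. 1) w < X x w} =
      {w \<in> space M. \<forall>i\<in>A. L t w < X (i, 0) w}"
    by (auto simp: path_comb_def L_zero)
  ultimately show ?thesis by (simp add: psi_comb_def card_cartesian_product)
qed

lemma alive_measurable: "i \<in> {1..n} \<Longrightarrow> 0 \<le> t \<Longrightarrow> {w \<in> space M. L t w < X (i, 0) w} \<in> sets M"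
  by measurable

lemma card_alive: "card {i \<in> {1..n}. L t w < X (i, 0) w} = n - card (D t w)"
proof -
  have "{i \<in> {1..n}. L t w < X (i, 0) w} = {1..n} - D t w" by (auto simp: dead_def)
  then show ?thesis by (simp only: card_Diff_subset[OF finite_dead dead_subset] card_atLeastAtMost)
qed

lemma measure_dead_less:
  assumes t: "0 \<le> t"
  shows "measure M {w \<in> space M. card (D t w) < q} = mass * order_tail \<Psi> n q t"
proof -
  \<comment> \<open>The survival formula speaks about alive components, so the event is restated for
    their number.\<close>
  have "card (D t w) < q \<longleftrightarrow> n - q + 1 \<le> card {i \<in> {1..n}. L t w < X (i, 0) w}" for w
    unfolding card_alive using card_dead_le[of L X n t w] q by linarith
  then have eq: "{w \<in> space M. card (D t w) < q} =
      {w \<in> space M. n - q + 1 \<le> card {i \<in> {1..n}. L t w < X (i, 0) w}}"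
    by (simp only:)
  have v: "measure M {w \<in> space M. \<forall>i\<in>A. L t w < X (i, 0) w} = mass * exp (- t * \<Psi> (real (card A)))"
    if "A \<subseteq> {1..n}" for A
    by (rule measure_alive[OF that t])
  have m: "{w \<in> space M. L t w < X (i, 0) w} \<in> sets M" if "i \<in> {1..n}" for i
    by (rule alive_measurable[OF that t])
  have r: "1 \<le> n - q + 1" by simp
  have "measure M {w \<in> space M. card (D t w) < q} =
      (\<Sum>i = n - q + 1..card {1..n}. (- 1) ^ (i - (n - q + 1)) * real (i - 1 choose (n - q + 1 - 1)) *
      (real (card {1..n} choose i) * (mass * exp (- t * \<Psi> (real i)))))"
    unfolding eq
    by (rule measure_count_ge[where P = "\<lambda>i w. L t w < X (i, 0) w" and Q = "space M"
        and V = "{1..n}" and v = "\<lambda>i. mass * exp (- t * \<Psi> (real i))" and r = "n - q + 1",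
        OF finite_atLeastAtMost sets.top m v r])
  moreover have "\<dots> = mass * order_tail \<Psi> n q t"
    unfolding order_tail_def sum_distrib_left card_atLeastAtMost
  proof (rule sum.cong)
    fix i assume "i \<in> {n - q + 1..n}"
    then have *: "i + q - n - 1 = i - (n - q + 1)" using q by auto
    show "(- 1) ^ (i - (n - q + 1)) * real (i - 1 choose (n - q + 1 - 1)) *
      (real (Suc n - 1 choose i) * (mass * exp (- t * \<Psi> (real i)))) =
      mass * (real (n choose i) * real (i - 1 choose (n - q)) * (- 1) ^ (i + q - n - 1) * exp (- t * \<Psi> (real i)))"
      unfolding * by (simp add: mult_ac)
  qed simp
  ultimately show ?thesis by (rule trans)
qed

text \<open>Union bound over the components that may still be alive. It is crude but gives one
  exponential tail for every \<open>q\<close>, hence finiteness and exponential moments of the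
  passage time.\<close>

lemma measure_dead_less_le:
  assumes t: "0 \<le> t"
  shows "measure M {w \<in> space M. card (D t w) < n} \<le> real n * mass * exp (- t * \<Psi> 1)"
proof -
  have "measure M {w \<in> space M. card (D t w) < n} \<le>
      measure M (\<Union>i\<in>{1..n}. {w \<in> space M. L t w < X (i, 0) w})"
  proof (rule finite_measure_mono)
    show "{w \<in> space M. card (D t w) < n} \<subseteq> (\<Union>i\<in>{1..n}. {w \<in> space M. L t w < X (i, 0) w})"
    proof
      fix w assume w: "w \<in> {w \<in> space M. card (D t w) < n}"
      then have "D t w \<noteq> {1..n}" by auto
      then obtain i where i: "i \<in> {1..n}" "i \<notin> D t w" using dead_subset[of L X n t w] by blast
      then have "L t w < X (i, 0) w" by (simp add: dead_def not_le)
      with i(1) w show "w \<in> (\<Union>i\<in>{1..n}. {w \<in> space M. L t w < X (i, 0) w})" by blast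
    qed
  qed (use t in \<open>auto intro!: alive_measurable\<close>)
  also have "\<dots> \<le> (\<Sum>i\<in>{1..n}. measure M {w \<in> space M. L t w < X (i, 0) w})"
    using t by (intro finite_measure_subadditive_finite) (auto intro: alive_measurable)
  also have "\<dots> = (\<Sum>i\<in>{1..n}. mass * exp (- t * \<Psi> 1))"
    using measure_alive[of "{_}" t] t by (intro sum.cong) auto
  finally show ?thesis by simp
qed

lemma emeasure_passage_greater:
  assumes t: "0 \<le> t"
  shows "emeasure M {w \<in> space M. ennreal t < fp w} = ennreal (mass * order_tail \<Psi> n q t)"
proof -
  have "emeasure M {w \<in> space M. ennreal t < fp w} = emeasure M {w \<in> space M. card (D t w) < q}"
  proof (rule emeasure_eq_AE)
    show "AE w in M. (w \<in> {w \<in> space M. ennreal t < fp w}) = (w \<in> {w \<in> space M. card (D t w) < q})"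
      using AE_X0_pos
    proof eventually_elim
      case (elim w)
      then show ?case
        by (cases "w \<in> space M") (simp_all only: passage_greater_iff[OF _ elim t] mem_Collect_eq simp_thms)
    qed
  qed (use t in measurable)
  then show ?thesis using measure_dead_less[OF t] by (simp add: emeasure_eq_measure)
qed

lemma measure_passage_greater_le:
  assumes t: "0 \<le> t"
  shows "measure M {w \<in> space M. ennreal t < fp w} \<le> real n * mass * exp (- t * \<Psi> 1)"
proof -
  have "measure M {w \<in> space M. ennreal t < fp w} = measure M {w \<in> space M. card (D t w) < q}"
    using emeasure_passage_greater[OF t] measure_dead_less[OF t]
    by (metis ennreal_inj emeasure_eq_measure measure_nonneg)
  also have "\<dots> \<le> measure M {w \<in> space M. card (D t w) < n}"
    using q t by (intro finite_measure_mono) auto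
  finally show ?thesis using measure_dead_less_le[OF t] by simp
qed

lemma AE_passage_finite: "AE w in M. fp w < \<infinity>"
proof -
  have "measure M {w \<in> space M. fp w = \<infinity>} \<le> 0"
  proof (rule LIMSEQ_le_const)
    have "((\<lambda>t. real n * mass * exp (- t * \<Psi> 1)) \<longlongrightarrow> 0) at_top"
      using tendsto_mult[OF tendsto_const[of "real n * mass"] exp_decay_tendsto[OF \<Psi>_pos[of 1]]] by simp
    then show "(\<lambda>k. real n * mass * exp (- real k * \<Psi> 1)) \<longlonglongrightarrow> 0"
      by (rule filterlim_compose) (rule filterlim_real_sequentially)
    have "measure M {w \<in> space M. fp w = \<infinity>} \<le> real n * mass * exp (- real k * \<Psi> 1)" for k
    proof -
      have "measure M {w \<in> space M. fp w = \<infinity>} \<le> measure M {w \<in> space M. ennreal (real k) < fp w}"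
      by (rule finite_measure_mono) (auto simp: ennreal_less_top)
      then show ?thesis using measure_passage_greater_le[of "real k"] by simp
    qed
    then show "\<exists>k0. \<forall>k\<ge>k0. measure M {w \<in> space M. fp w = \<infinity>} \<le> real n * mass * exp (- real k * \<Psi> 1)"
      by blast
  qed
  then have "measure M {w \<in> space M. fp w = \<infinity>} = 0" by (simp add: measure_le_0_iff)
  then show ?thesis
    by (intro AE_I'[of "{w \<in> space M. fp w = \<infinity>}"])
      (auto simp: null_sets_def emeasure_eq_measure less_top[symmetric])
qed

lemma AE_passage_time: "AE w in M. fp w = ennreal (T w) \<and> 0 < T w \<and> card (D (T w) w) \<ge> q"
  using AE_passage_finite AE_X0_pos AE_space
proof eventually_elim
  case (elim w)
  then have 1: "fp w = ennreal (T w)" by (simp add: passage_time_def less_top)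
  have "ennreal 0 < fp w"
    using passage_greater_iff[of w 0] elim dead_zero_empty[of w] q by simp
  then have 2: "0 < T w" using 1 by (simp add: ennreal_less_iff)
  have "\<not> ennreal (T w) < fp w" using 1 by simp
  then have "card (D (T w) w) \<ge> q" using passage_greater_iff[of w "T w"] elim by simp
  with 1 2 show ?case by simp
qed

text \<open>The mean is the integral of the tail, by Fubini, and each exponential in the tail
  integrates to the reciprocal of its rate.\<close>

theorem nn_integral_passage:
  "(\<integral>\<^sup>+ w. fp w \<partial>M) = ennreal (mass * order_mean \<Psi> n q)"
proof -
  have m: "(\<lambda>(s, w). indicator {s. 0 \<le> s \<and> ennreal s < fp w} s :: ennreal) \<in> borel_measurable (lborel \<Otimes>\<^sub>M M)"
  proof -
    have "{x \<in> space (lborel \<Otimes>\<^sub>M M). 0 \<le> fst x \<and> ennreal (fst x) < fp (snd x)} \<in> sets (lborel \<Otimes>\<^sub>M M)"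
      by measurable
    moreover have "(\<lambda>(s, w). indicator {s. 0 \<le> s \<and> ennreal s < fp w} s :: ennreal) =
        (\<lambda>x. indicator {x. 0 \<le> fst x \<and> ennreal (fst x) < fp (snd x)} x)"
      by (auto simp: indicator_def fun_eq_iff)
    ultimately show ?thesis
      by (simp add: borel_measurable_indicator_iff Int_def conj_commute)
  qed
  interpret P: pair_sigma_finite lborel M ..
  have pos: "0 \<le> mass * order_tail \<Psi> n q s" if "0 \<le> s" for s
    using measure_dead_less[OF that] measure_nonneg by metis
  have "(\<integral>\<^sup>+ w. fp w \<partial>M) = (\<integral>\<^sup>+ w. (\<integral>\<^sup>+ s. indicator {s. 0 \<le> s \<and> ennreal s < fp w} s \<partial>lborel) \<partial>M)"
    by (simp add: nn_integral_below_ennreal)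
  also have "\<dots> = (\<integral>\<^sup>+ s. (\<integral>\<^sup>+ w. indicator {s. 0 \<le> s \<and> ennreal s < fp w} s \<partial>M) \<partial>lborel)"
    by (rule P.Fubini'[OF m])
  also have "\<dots> = (\<integral>\<^sup>+ s. ennreal (mass * order_tail \<Psi> n q s * indicator {0..} s) \<partial>lborel)"
  proof (rule nn_integral_cong)
    fix s :: real
    show "(\<integral>\<^sup>+ w. indicator {s. 0 \<le> s \<and> ennreal s < fp w} s \<partial>M) = ennreal (mass * order_tail \<Psi> n q s * indicator {0..} s)"
    proof (cases "0 \<le> s")
      case True
      have "(\<integral>\<^sup>+ w. indicator {s. 0 \<le> s \<and> ennreal s < fp w} s \<partial>M) =
          (\<integral>\<^sup>+ w. indicator {w \<in> space M. ennreal s < fp w} w \<partial>M)"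
        using True by (intro nn_integral_cong) (auto simp: indicator_def)
      also have "\<dots> = emeasure M {w \<in> space M. ennreal s < fp w}"
        by (intro nn_integral_indicator) measurable
      finally show ?thesis using emeasure_passage_greater[OF True] True by simp
    qed simp
  qed
  also have "\<dots> = ennreal (mass * order_mean \<Psi> n q)"
  proof -
    have "has_bochner_integral lborel (\<lambda>s. mass * (\<Sum>i = n - q + 1..n.
        real (n choose i) * real (i - 1 choose (n - q)) * (- 1) ^ (i + q - n - 1) *
          (exp (- s * \<Psi> (real i)) * indicator {0..} s))) (mass * (\<Sum>i = n - q + 1..n.
        real (n choose i) * real (i - 1 choose (n - q)) * (- 1) ^ (i + q - n - 1) * (1 / \<Psi> (real i))))"
      by (intro has_bochner_integral_mult_right has_bochner_integral_sum has_bochner_integral_exp_decay \<Psi>_pos) auto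
    moreover have "(\<lambda>s. mass * (\<Sum>i = n - q + 1..n.
        real (n choose i) * real (i - 1 choose (n - q)) * (- 1) ^ (i + q - n - 1) *
          (exp (- s * \<Psi> (real i)) * indicator {0..} s))) = (\<lambda>s. mass * order_tail \<Psi> n q s * indicator {0..} s)"
      unfolding order_tail_def sum_distrib_right by (intro ext) (simp only: mult.assoc sum_distrib_right)
    moreover have "(\<Sum>i = n - q + 1..n.
        real (n choose i) * real (i - 1 choose (n - q)) * (- 1) ^ (i + q - n - 1) * (1 / \<Psi> (real i))) = order_mean \<Psi> n q"
      unfolding order_mean_def by simp
    ultimately have *: "has_bochner_integral lborel (\<lambda>s. mass * order_tail \<Psi> n q s * indicator {0..} s) (mass * order_mean \<Psi> n q)"
      by (simp only:)
    then show ?thesis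
      using pos by (subst nn_integral_eq_integral)
        (auto simp: has_bochner_integral_iff indicator_def intro!: AE_I2)
  qed
  finally show ?thesis .
qed

theorem nn_integral_exp_passage_time_finite:
  assumes th: "th < \<Psi> 1"
  shows "(\<integral>\<^sup>+ w. ennreal (exp (th * T w)) \<partial>M) < \<infinity>"
proof -
  \<comment> \<open>A nonnegative exponent makes the exponential increasing in time, so the passage
    time may be replaced by the next integer.\<close>
  define th' where "th' = max th 0"
  have th': "0 \<le> th'" "th' < \<Psi> 1" using th \<Psi>_pos[of 1] by (auto simp: th'_def)
  let ?A = "\<lambda>l. {w \<in> space M. ennreal (real l) < fp w}"
  have "(\<integral>\<^sup>+ w. ennreal (exp (th * T w)) \<partial>M) \<le>
      (\<integral>\<^sup>+ w. (\<Sum>l. ennreal (exp (th' * real (Suc l))) * indicator (?A l) w) \<partial>M)"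
  proof (rule nn_integral_mono_AE)
    show "AE w in M. ennreal (exp (th * T w)) \<le> (\<Sum>l. ennreal (exp (th' * real (Suc l))) * indicator (?A l) w)"
      using AE_passage_time AE_space
    proof eventually_elim
      case (elim w)
      define l where "l = nat (\<lceil>T w\<rceil> - 1)"
      have "0 \<le> \<lceil>T w\<rceil> - 1" using elim by (simp add: zero_less_ceiling int_one_le_iff_zero_less)
      then have l: "real l < T w" "T w \<le> real (Suc l)"
        unfolding l_def using ceiling_correct[of "T w"] by (simp_all add: of_nat_nat)
      have "th * T w \<le> th' * real (Suc l)"
        using th' l elim by (intro mult_mono) (auto simp: th'_def)
      then have "ennreal (exp (th * T w)) \<le> ennreal (exp (th' * real (Suc l)))"
        by (intro ennreal_leI) simp
      also have "\<dots> = ennreal (exp (th' * real (Suc l))) * indicator (?A l) w"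
        using elim l by (simp add: ennreal_less_iff del: of_nat_Suc)
      also have "\<dots> \<le> (\<Sum>l. ennreal (exp (th' * real (Suc l))) * indicator (?A l) w)"
        by (rule suminf_ge_term)
      finally show ?case .
    qed
  qed
  also have "\<dots> = (\<Sum>l. ennreal (exp (th' * real (Suc l))) * emeasure M (?A l))"
    by (subst nn_integral_suminf) (auto simp: nn_integral_cmult)
  also have "\<dots> \<le> (\<Sum>l. ennreal (exp th' * real n * mass * exp (th' - \<Psi> 1) ^ l))"
  proof (rule suminf_le)
    fix l
    have "ennreal (exp (th' * real (Suc l))) * emeasure M (?A l) \<le>
        ennreal (exp (th' * real (Suc l))) * ennreal (real n * mass * exp (- real l * \<Psi> 1))"
      using measure_passage_greater_le[of "real l"]
      by (intro mult_left_mono) (auto simp: emeasure_eq_measure intro: ennreal_leI)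
    also have "\<dots> = ennreal (exp (th' * real (Suc l)) * (real n * mass * exp (- real l * \<Psi> 1)))"
      by (simp add: ennreal_mult'')
    also have "exp (th' * real (Suc l)) * (real n * mass * exp (- real l * \<Psi> 1)) =
        exp th' * real n * mass * exp (th' - \<Psi> 1) ^ l"
      by (simp add: exp_of_nat_mult[symmetric] exp_add[symmetric] algebra_simps)
    finally show "ennreal (exp (th' * real (Suc l))) * emeasure M (?A l) \<le>
        ennreal (exp th' * real n * mass * exp (th' - \<Psi> 1) ^ l)" .
  qed auto
  also have "\<dots> < \<infinity>"
  proof -
    have "summable (\<lambda>l. exp th' * real n * mass * exp (th' - \<Psi> 1) ^ l)"
      using th' by (intro summable_mult summable_geometric) simp
    then show ?thesis by (subst suminf_ennreal2) (auto simp: less_top[symmetric])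
  qed
  finally show ?thesis .
qed

end

section \<open>The Markov property at fixed times\<close>

lemma (in finite_measure) measure_tendsto_of_eventually_eq:
  assumes A: "\<And>k. A k \<in> sets M" and B: "B \<in> sets M"
    and ev: "AE w in M. eventually (\<lambda>k. w \<in> A k \<longleftrightarrow> w \<in> B) sequentially"
  shows "(\<lambda>k. measure M (A k)) \<longlonglongrightarrow> measure M B"
proof -
  have "(\<lambda>k. \<integral>w. indicator (A k) w \<partial>M) \<longlonglongrightarrow> (\<integral>w. indicator B w \<partial>M :: real)"
  proof (rule integral_dominated_convergence[where w = "\<lambda>_. 1"])
    show "AE w in M. (\<lambda>k. indicator (A k) w) \<longlonglongrightarrow> (indicator B w :: real)"
      using ev
    proof eventually_elim
      case (elim w)
      show ?case
        by (rule tendsto_eventually) (use elim in eventually_elim, auto simp: indicator_def)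
    qed
  qed (use A B in \<open>auto simp: indicator_def\<close>)
  then show ?thesis using A B sets.sets_into_space by (simp add: Int_absorb2)
qed

text \<open>A tie \<open>Y = Z\<close> of positive quantities is squeezed into \<open>c Y < Z \<le> d Y\<close> for all \<open>c < 1 < d\<close>;
  below, \<open>f c\<close> is the measure of \<open>c Y < Z\<close>.\<close>

lemma (in finite_measure) AE_not_in_of_squeeze:
  fixes f :: "real \<Rightarrow> real"
  assumes B: "B \<in> sets M"
    and bound: "\<And>c d. 0 \<le> c \<Longrightarrow> c < 1 \<Longrightarrow> 1 < d \<Longrightarrow> measure M B \<le> f c - f d"
    and f: "continuous_on {0..} f"
  shows "AE w in M. w \<notin> B"
proof -
  have e: "(\<lambda>m. 1 / real (Suc m)) \<longlonglongrightarrow> 0"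
    using LIMSEQ_inverse_real_of_nat by (simp only: inverse_eq_divide)
  have "measure M B \<le> f (1 - 0) - f (1 + 0)"
  proof (rule LIMSEQ_le_const)
    show "(\<lambda>m. f (1 - 1 / real (Suc m)) - f (1 + 1 / real (Suc m))) \<longlonglongrightarrow> f (1 - 0) - f (1 + 0)"
      by (intro tendsto_diff continuous_on_tendsto_compose[OF f] tendsto_add tendsto_const e) auto
    have "measure M B \<le> f (1 - 1 / real (Suc m)) - f (1 + 1 / real (Suc m))" for m
      by (rule bound) auto
    then show "\<exists>N. \<forall>m\<ge>N. measure M B \<le> f (1 - 1 / real (Suc m)) - f (1 + 1 / real (Suc m))" by blast
  qed
  then have "measure M B = 0" by (simp add: measure_le_0_iff)
  then show ?thesis
    using B by (intro AE_not_in) (auto simp: null_sets_def emeasure_eq_measure)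
qed

lemma (in finite_measure) measure_eq_sum_fibres:
  assumes f: "f \<in> measurable M (count_space UNIV)" and W: "W \<in> sets M" and K: "finite K"
    and dec: "\<And>w. w \<in> W \<Longrightarrow> R w \<Longrightarrow> f w \<in> K" and R: "\<And>w. w \<in> W \<Longrightarrow> f w \<in> K \<Longrightarrow> R w"
  shows "measure M {w \<in> W. R w} = (\<Sum>a\<in>K. measure M {w \<in> W. f w = a})"
proof -
  have m: "{w \<in> W. f w = a} \<in> sets M" for a
  proof -
    have "{w \<in> W. f w = a} = W \<inter> (f -` {a} \<inter> space M)"
      using sets.sets_into_space[OF W] by auto
    then show ?thesis using W measurable_sets[OF f, of "{a}"] by auto
  qed
  have "{w \<in> W. R w} = (\<Union>a\<in>K. {w \<in> W. f w = a})" using dec R by auto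
  also have "measure M \<dots> = (\<Sum>a\<in>K. measure M {w \<in> W. f w = a})"
    using K m by (intro finite_measure_finite_Union) (auto simp: disjoint_family_on_def)
  finally show ?thesis .
qed

text \<open>A component that is alive at the repair keeps its current threshold but skips reserve
  entry 1: repair \<open>Suc m\<close> draws from \<open>E i (Suc m)\<close>, so reserve entries
  belong to repair numbers and lapse for components not repaired then.\<close>

definition renew_index :: "nat set \<Rightarrow> nat \<times> nat \<Rightarrow> nat \<times> nat" where
  "renew_index S x = (case x of (i, m) \<Rightarrow> if m = 0 \<and> i \<notin> S then (i, 0) else (i, Suc m))"

lemma inj_renew_index: "inj (renew_index S)"
  by (auto simp: inj_def renew_index_def split: if_splits)

text \<open>An alive component has used up \<open>L s w\<close> of its threshold; fresh thresholds
  count from zero, since the path is restarted too.\<close>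

definition residual ::
  "(real \<Rightarrow> 'a \<Rightarrow> real) \<Rightarrow> (nat \<times> nat \<Rightarrow> 'a \<Rightarrow> real) \<Rightarrow> real \<Rightarrow> nat set \<Rightarrow> nat \<times> nat \<Rightarrow> 'a \<Rightarrow> real" where
  "residual L X s S x w = X (renew_index S x) w - (if snd x = 0 \<and> fst x \<notin> S then L s w else 0)"

definition shifted_path :: "(real \<Rightarrow> 'a \<Rightarrow> real) \<Rightarrow> real \<Rightarrow> real \<Rightarrow> 'a \<Rightarrow> real" where
  "shifted_path L s t w = L (s + t) w - L s w"

lemma path_comb_shifted:
  "path_comb (shifted_path L s) v p c w = (\<Sum>j<p. c j * (L (s + v (Suc j)) w - L (s + v j) w))"
  by (simp add: path_comb_def shifted_path_def)

locale repair_system = frailty_system M L X "{1..n} \<times> UNIV" n q \<Psi>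
  for M :: "'a measure" and L X n q \<Psi>
begin

text \<open>Survival of the system restarted at the fixed time \<open>s\<close>, under the premise
  that \<open>S\<close> is the set of dead components at that time.\<close>

definition future :: "real \<Rightarrow> nat set \<Rightarrow> (nat \<times> nat) set \<Rightarrow> (nat \<Rightarrow> real) \<Rightarrow> nat \<Rightarrow> (nat \<times> nat \<Rightarrow> nat \<Rightarrow> real) \<Rightarrow> 'a set" where
  "future s S J v p b = {w \<in> space M. \<forall>x\<in>J. path_comb (shifted_path L s) v p (b x) w < residual L X s S x w}"

lemma X_measurable'[measurable]: "i \<in> {1..n} \<Longrightarrow> X (i, m) \<in> borel_measurable M"
  by (intro X_measurable) auto

lemma residual_measurable:
  assumes "0 \<le> s" "x \<in> {1..n} \<times> UNIV"
  shows "residual L X s S x \<in> borel_measurable M"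
proof -
  have "renew_index S x \<in> {1..n} \<times> UNIV" using assms(2) by (auto simp: renew_index_def split: prod.splits)
  then show ?thesis
    unfolding residual_def[abs_def] using assms(1) by (intro borel_measurable_diff X_measurable) auto
qed

lemma path_comb_shifted_measurable:
  assumes "0 \<le> s" "time_grid v p"
  shows "path_comb (shifted_path L s) v p c \<in> borel_measurable M"
  unfolding shifted_path_def[abs_def] using assms by (intro path_comb_measurable) (auto intro!: borel_measurable_diff)

lemma future_measurable:
  assumes "0 \<le> s" "finite J" "J \<subseteq> {1..n} \<times> UNIV" "time_grid v p"
  shows "future s S J v p b \<in> sets M"
  unfolding future_def using assms
  by (intro sets.sets_Collect_finite_All borel_measurable_less path_comb_shifted_measurable residual_measurable) auto

text \<open>Everything is a single survival event of the original system: being alive at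
  \<open>s0\<close> or \<open>s\<close> and surviving later are all of the form
  \<open>combination < threshold\<close> on a common grid. The exponent is a sum over grid
  intervals, hence the product.\<close>

lemma measure_alive_future:
  assumes s: "0 \<le> s0" "s0 \<le> s" and A: "A1 \<subseteq> S" "A2 \<subseteq> S" and S: "S \<subseteq> {1..n}"
    and J: "finite J" "J \<subseteq> {1..n} \<times> UNIV" and v: "time_grid v p" and b: "\<And>x j. 0 \<le> b x j"
  shows "measure M ({w \<in> space M. (\<forall>i\<in>A1. L s0 w < X (i, 0) w) \<and> (\<forall>i\<in>A2. L s w < X (i, 0) w)} \<inter>
      ({w \<in> space M. \<forall>i\<in>{1..n} - S. L s w < X (i, 0) w} \<inter> future s S J v p b)) =
    mass * exp (- (s0 * \<Psi> (real (card (A1 \<union> A2 \<union> ({1..n} - S)))) + (s - s0) * \<Psi> (real (card (A2 \<union> ({1..n} - S)))))) *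
      exp (- psi_comb \<Psi> v p (\<lambda>j. \<Sum>x\<in>J. b x j))"
proof -
  let ?\<sigma> = "renew_index S"
  define C1 where "C1 = A1 \<union> A2 \<union> ({1..n} - S)"
  define C2 where "C2 = A2 \<union> ({1..n} - S)"
  \<comment> \<open>The grid \<open>0, s0, s, s + v 0, s + v 1, ...\<close>. The piece from
    \<open>s\<close> to \<open>s + v 0\<close> gets coefficient 0, since the future grid may start
    later than 0.\<close>
  define u where "u j = (if j = 0 then 0 else if j = 1 then s0 else if j = 2 then s else s + v (j - 3))" for j :: nat
  \<comment> \<open>Coefficient 1 up to the last time at which a component is required to be alive;
    after \<open>s\<close>, the coefficients of the future index that is renamed to
    \<open>y\<close>.\<close>
  define c where "c y j =
      (if j = 0 then (if snd y = 0 \<and> fst y \<in> C1 then 1 else 0)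
       else if j = 1 then (if snd y = 0 \<and> fst y \<in> C2 then 1 else 0)
       else if j = 2 then 0 else if y \<in> ?\<sigma> ` J then b (inv ?\<sigma> y) (j - 3) else 0)" for y j
  define J2 where "J2 = C1 \<times> {0} \<union> ?\<sigma> ` J"
  have C: "C2 \<subseteq> C1" "C1 \<subseteq> {1..n}" using A S by (auto simp: C1_def C2_def)
  have fin: "finite C1" "finite C2" using C by (auto intro: finite_subset)
  have v0: "0 \<le> v j" if "j \<le> p" for j using time_grid_nonneg[OF v that] .
  have v1: "v j \<le> v (Suc j)" if "j < p" for j using v that by (simp add: time_grid_def)
  have "u j \<le> u (Suc j)" if "j < p + 3" for j
  proof -
    consider "j = 0" | "j = 1" | "j = 2" | k where "j = k + 3" "k < p" 
    proof (cases "j < 3")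
      case False
      then show ?thesis using that(4)[of "j - 3"] \<open>j < p + 3\<close> by simp
    qed (use that(1-3) in linarith)
    then show ?thesis
    proof cases
      case 4
      then show ?thesis using v1[of k] by (simp add: u_def)
    qed (use s v0[of 0] in \<open>simp_all add: u_def\<close>)
  qed
  then have u: "time_grid u (p + 3)" by (simp add: time_grid_def u_def)
  have J2: "finite J2" "J2 \<subseteq> {1..n} \<times> UNIV"
    using fin J C by (auto simp: J2_def renew_index_def split: if_splits)
  have c: "0 \<le> c y j" for y j using b by (simp add: c_def)
  have split3: "(\<Sum>j<p + 3. f j) = f 0 + f 1 + f 2 + (\<Sum>j<p. f (j + 3))" for f :: "nat \<Rightarrow> real"
    by (simp add: numeral_3_eq_3 sum.lessThan_Suc_shift numeral_2_eq_2 del: sum.lessThan_Suc)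
  have fut: "path_comb (shifted_path L s) v p (b x) w = (\<Sum>j<p. b x j * (L (s + v (Suc j)) w - L (s + v j) w))" for x w
    by (rule path_comb_shifted)
  have fut0: "0 \<le> path_comb (shifted_path L s) v p (b x) w" if "w \<in> space M" for x w
    unfolding fut using b L_mono[OF that] s v0 v1 by (intro sum_nonneg mult_nonneg_nonneg) auto
  have pc: "path_comb L u (p + 3) (c y) w =
      c y 0 * L s0 w + c y 1 * (L s w - L s0 w) +
      (if y \<in> ?\<sigma> ` J then path_comb (shifted_path L s) v p (b (inv ?\<sigma> y)) w else 0)"
    if "w \<in> space M" for y w
    unfolding path_comb_def[of L] split3 fut using L_zero[OF that]
    by (simp add: u_def c_def numeral_2_eq_2 numeral_3_eq_3)
  \<comment> \<open>For a component outside \<open>S\<close>, subtracting \<open>L s\<close> in the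
    residual is the same as having coefficient 1 on both intervals before \<open>s\<close>.\<close>
  have pc\<sigma>: "path_comb L u (p + 3) (c (?\<sigma> x)) w < X (?\<sigma> x) w \<longleftrightarrow>
      path_comb (shifted_path L s) v p (b x) w < residual L X s S x w" if x: "x \<in> J" and w: "w \<in> space M" for x w
  proof -
    have "fst x \<in> {1..n}" using J x by auto
    then have "c (?\<sigma> x) 0 = (if snd x = 0 \<and> fst x \<notin> S then 1 else 0)" "c (?\<sigma> x) 1 = (if snd x = 0 \<and> fst x \<notin> S then 1 else 0)"
      using A S by (auto simp: c_def renew_index_def C1_def C2_def split: prod.splits)
    then show ?thesis
      unfolding pc[OF w] residual_def using x by (auto simp: inv_f_f[OF inj_renew_index])
  qed
  have pc0: "path_comb L u (p + 3) (c (i, 0)) w < X (i, 0) w \<longleftrightarrow>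
      (if i \<in> C2 then L s w < X (i, 0) w else L s0 w < X (i, 0) w)"
    if "w \<in> space M" "i \<in> C1" "(i, 0) \<notin> ?\<sigma> ` J" for i w
    unfolding pc[OF that(1)] using that by (auto simp: c_def)
  have "{w \<in> space M. (\<forall>i\<in>A1. L s0 w < X (i, 0) w) \<and> (\<forall>i\<in>A2. L s w < X (i, 0) w)} \<inter>
      ({w \<in> space M. \<forall>i\<in>{1..n} - S. L s w < X (i, 0) w} \<inter> future s S J v p b) =
      {w \<in> space M. \<forall>y\<in>J2. path_comb L u (p + 3) (c y) w < X y w}" (is "?E1 = ?E2")
  proof (intro set_eqI iffI)
    fix w assume 1: "w \<in> ?E1"
    then have w: "w \<in> space M" by simp
    have le: "L s0 w \<le> L s w" using L_mono[OF w s] .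
    have "path_comb L u (p + 3) (c y) w < X y w" if y: "y \<in> J2" for y
    proof (cases "y \<in> ?\<sigma> ` J")
      case True
      then show ?thesis using 1 pc\<sigma>[OF _ w] by (auto simp: future_def)
    next
      case False
      then obtain i where i: "y = (i, 0)" "i \<in> C1" using y by (auto simp: J2_def)
      then show ?thesis using pc0[OF w i(2)] False 1 le by (auto simp: C1_def C2_def)
    qed
    then show "w \<in> ?E2" using w by blast
  next
    fix w assume 2: "w \<in> ?E2"
    then have w: "w \<in> space M" by simp
    have le: "L s0 w \<le> L s w" using L_mono[OF w s] .
    have F: "w \<in> future s S J v p b"
      using 2 pc\<sigma>[OF _ w] by (auto simp: future_def J2_def)
    \<comment> \<open>If \<open>(i, 0)\<close> arises from the renaming, then \<open>i\<close> lies
      outside \<open>S\<close>, and since its future combination is nonnegative, surviving the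
      future implies being alive at \<open>s\<close>.\<close>
    have al: "if i \<in> C2 then L s w < X (i, 0) w else L s0 w < X (i, 0) w" if i: "i \<in> C1" for i
    proof (cases "(i, 0) \<in> ?\<sigma> ` J")
      case True
      then obtain x where x: "x \<in> J" "(i, 0) = ?\<sigma> x" by auto
      then have x': "x = (i, 0)" "i \<notin> S" by (auto simp: renew_index_def split: prod.splits if_splits)
      have "path_comb (shifted_path L s) v p (b x) w < residual L X s S x w"
        using F x(1) by (auto simp: future_def)
      moreover have "residual L X s S x w = X (i, 0) w - L s w"
        using x' by (simp add: residual_def renew_index_def)
      ultimately have "L s w < X (i, 0) w"
        using fut0[OF w, of x] by linarith
      then show ?thesis using le by simp
    next
      case False
      have "(i, 0) \<in> J2" using i by (simp add: J2_def)
      then show ?thesis using pc0[OF w i False] 2 by blast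
    qed
    have "L s w < X (i, 0) w" if "i \<in> A2 \<union> ({1..n} - S)" for i
      using al[of i] that by (simp add: C1_def C2_def)
    moreover have "L s0 w < X (i, 0) w" if "i \<in> A1" for i
      using al[of i] that le by (simp add: C1_def split: if_splits)
    ultimately show "w \<in> ?E1" using w F by blast
  qed
  moreover have "measure M ?E2 = mass * exp (- psi_comb \<Psi> u (p + 3) (\<lambda>j. \<Sum>y\<in>J2. c y j))"
    by (rule survival[OF J2 u c])
  moreover have "psi_comb \<Psi> u (p + 3) (\<lambda>j. \<Sum>y\<in>J2. c y j) =
      s0 * \<Psi> (real (card C1)) + (s - s0) * \<Psi> (real (card C2)) + psi_comb \<Psi> v p (\<lambda>j. \<Sum>x\<in>J. b x j)"
  proof -
    have cs: "(\<Sum>y\<in>J2. if snd y = 0 \<and> fst y \<in> C then 1 else 0) = real (card C)" if "C \<subseteq> C1" for C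
    proof -
      have "(\<Sum>y\<in>J2. if snd y = 0 \<and> fst y \<in> C then 1 else 0) = (\<Sum>y\<in>C \<times> {0::nat}. (1::real))"
        using J2 that by (intro sum.mono_neutral_cong_right) (auto simp: J2_def)
      then show ?thesis by (simp add: card_cartesian_product)
    qed
    have "(\<Sum>y\<in>J2. c y 0) = real (card C1)" "(\<Sum>y\<in>J2. c y 1) = real (card C2)" "(\<Sum>y\<in>J2. c y 2) = 0"
      using cs[of C1] cs[of C2] C by (simp_all add: c_def)
    moreover have "(\<Sum>y\<in>J2. c y (j + 3)) = (\<Sum>x\<in>J. b x j)" for j
    proof -
      have "(\<Sum>y\<in>J2. c y (j + 3)) = (\<Sum>y\<in>?\<sigma> ` J. b (inv ?\<sigma> y) j)"
        using J2 by (intro sum.mono_neutral_cong_right) (auto simp: J2_def c_def)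
      also have "\<dots> = (\<Sum>x\<in>J. b x j)"
        using inj_renew_index by (subst sum.reindex) (auto simp: inj_def inj_on_def inv_f_f[OF inj_renew_index])
      finally show ?thesis .
    qed
    ultimately show ?thesis
      unfolding psi_comb_def split3 by (simp add: u_def numeral_2_eq_2 numeral_3_eq_3 \<Psi>_zero)
  qed
  ultimately show ?thesis by (simp add: C1_def C2_def exp_add[symmetric] algebra_simps)
qed

text \<open>Exact dead sets are not survival events, so a Dynkin argument is used: the alive events
  with indices in \<open>S\<close> are stable under intersection, the factor is the same for all of
  them, and the dead sets are determined by the generated \<open>\<sigma>\<close>-algebra together
  with \<open>B\<close>.\<close>

lemma measure_dead_future:
  assumes s: "0 \<le> s0" "s0 \<le> s" and A: "A \<subseteq> S" and S: "S \<subseteq> {1..n}"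
    and J: "finite J" "J \<subseteq> {1..n} \<times> UNIV" and v: "time_grid v p" and b: "\<And>x j. 0 \<le> b x j"
  shows "measure M ({w \<in> space M. D s0 w = A \<and> D s w = S} \<inter> future s S J v p b) =
    measure M {w \<in> space M. D s0 w = A \<and> D s w = S} * exp (- psi_comb \<Psi> v p (\<lambda>j. \<Sum>x\<in>J. b x j))"
proof -
  define V where "V = exp (- psi_comb \<Psi> v p (\<lambda>j. \<Sum>x\<in>J. b x j))"
  define Q where "Q A1 A2 = {w \<in> space M. (\<forall>i\<in>A1. L s0 w < X (i, 0) w) \<and> (\<forall>i\<in>A2. L s w < X (i, 0) w)}" for A1 A2
  \<comment> \<open>All components outside \<open>S\<close> are alive at \<open>s\<close>. This
    event stays fixed throughout the induction, because the factorization of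
    \<open>future s S\<close> is available only together with it.\<close>
  define B where "B = {w \<in> space M. \<forall>i\<in>{1..n} - S. L s w < X (i, 0) w}"
  define G where "G = {Q A1 A2 | A1 A2. A1 \<subseteq> S \<and> A2 \<subseteq> S}"
  let ?F = "future s S J v p b"
  have fS: "finite S" using S finite_subset by blast
  have F: "?F \<in> sets M" using s by (intro future_measurable J v) auto
  have B: "B \<in> sets M"
    unfolding B_def using s
    by (intro sets.sets_Collect_finite_All borel_measurable_less L_measurable X_measurable') auto
  have Q: "Q A1 A2 \<in> sets M" if "A1 \<subseteq> S" "A2 \<subseteq> S" for A1 A2
  proof -
    have "finite A1" "finite A2" using that fS finite_subset by auto
    then show ?thesis
      unfolding Q_def using that S s
      by (intro sets.sets_Collect_conj sets.sets_Collect_finite_All borel_measurable_less L_measurable X_measurable') auto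
  qed
  have Gsets: "G \<subseteq> sets M" using Q by (auto simp: G_def)
  have Gpow: "G \<subseteq> Pow (space M)" by (auto simp: G_def Q_def)
  have Q_Int: "Q A1 A2 \<inter> Q B1 B2 = Q (A1 \<union> B1) (A2 \<union> B2)" for A1 A2 B1 B2 by (auto simp: Q_def)
  have "Int_stable G"
    unfolding Int_stable_def G_def using Q_Int by (auto, metis Un_least)
  have QF: "measure M (Q A1 A2 \<inter> (B \<inter> ?F)) = measure M (Q A1 A2 \<inter> B) * V" if "A1 \<subseteq> S" "A2 \<subseteq> S" for A1 A2
  proof -
    have "Q A1 A2 \<inter> B = Q A1 A2 \<inter> (B \<inter> future s S {} v p b)" by (auto simp: future_def B_def)
    then have "measure M (Q A1 A2 \<inter> B) = measure M (Q A1 A2 \<inter> (B \<inter> future s S {} v p b))" by (rule arg_cong)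
    then show ?thesis
      using measure_alive_future[OF s that S J v b] measure_alive_future[OF s that S _ _ v b, of "{}"]
      by (simp add: Q_def B_def V_def psi_comb_def \<Psi>_zero)
  qed
  have step: "E \<in> sets M \<and> measure M (E \<inter> (B \<inter> ?F)) = measure M (E \<inter> B) * V" if "E \<in> sigma_sets (space M) G" for E
    using \<open>Int_stable G\<close> Gpow that
  proof (induction rule: sigma_sets_induct_disjoint)
    case (basic E)
    then show ?case using QF Q by (auto simp: G_def)
  next
    case (compl E)
    have "measure M ((space M - E) \<inter> C) = measure M C - measure M (E \<inter> C)" if "C \<in> sets M" for C
    proof -
      have "(space M - E) \<inter> C = C - E \<inter> C" using sets.sets_into_space[OF that] by auto
      then show ?thesis using compl that finite_measure_Diff[of C "E \<inter> C"] by (metis sets.Int inf_le2)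
    qed
    moreover have "measure M (B \<inter> ?F) = measure M B * V"
    proof -
      have "Q {} {} \<inter> C = C" if "C \<subseteq> B" for C using that by (auto simp: Q_def B_def)
      then show ?thesis using QF[of "{}" "{}"] by simp
    qed
    ultimately have "measure M ((space M - E) \<inter> (B \<inter> ?F)) = measure M ((space M - E) \<inter> B) * V"
      using compl B F by (simp add: left_diff_distrib)
    moreover have "space M - E \<in> sets M" using compl by blast
    ultimately show ?case by blast
  next
    case (union E)
    have sum: "(\<lambda>k. measure M (E k \<inter> C)) sums measure M ((\<Union>k. E k) \<inter> C)" if "C \<in> sets M" for C
    proof -
      have "(\<lambda>k. measure M (E k \<inter> C)) sums measure M (\<Union>k. E k \<inter> C)"
        using union that by (intro finite_measure_UNION) (auto simp: disjoint_family_on_def)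
      then show ?thesis by simp
    qed
    have "(\<lambda>k. measure M (E k \<inter> (B \<inter> ?F))) sums (measure M ((\<Union>k. E k) \<inter> B) * V)"
      using sums_mult2[OF sum[OF B], of V] union by simp
    moreover have "(\<lambda>k. measure M (E k \<inter> (B \<inter> ?F))) sums measure M ((\<Union>k. E k) \<inter> (B \<inter> ?F))"
      using B F by (intro sum) auto
    ultimately have "measure M ((\<Union>k. E k) \<inter> (B \<inter> ?F)) = measure M ((\<Union>k. E k) \<inter> B) * V"
      by (rule sums_unique2[OF _ _, symmetric])
    then show ?case using union by auto
  qed auto
  let ?E = "{w \<in> space M. \<forall>i\<in>S. \<not> L s w < X (i, 0) w \<and> (L s0 w < X (i, 0) w \<longleftrightarrow> i \<notin> A)}"
  let ?N = "sigma (space M) G"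
  have "{w \<in> space ?N. \<forall>i\<in>S. \<not> L s w < X (i, 0) w \<and> (L s0 w < X (i, 0) w \<longleftrightarrow> i \<notin> A)} \<in> sets ?N"
  proof (intro sets.sets_Collect_finite_All fS sets.sets_Collect_conj sets.sets_Collect_neg)
    fix i assume i: "i \<in> S"
    have sN: "sets ?N = sigma_sets (space M) G" "space ?N = space M" using Gpow by auto
    have "Q {} {i} \<in> sets ?N" "Q {i} {} \<in> sets ?N"
      unfolding sN using i by (auto intro!: sigma_sets.Basic simp: G_def)
    then have 1: "{w \<in> space ?N. L s w < X (i, 0) w} \<in> sets ?N" and 2: "{w \<in> space ?N. L s0 w < X (i, 0) w} \<in> sets ?N"
      by (simp_all add: Q_def sN)
    show "{w \<in> space ?N. L s w < X (i, 0) w} \<in> sets ?N" by (rule 1)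
    show "{w \<in> space ?N. L s0 w < X (i, 0) w \<longleftrightarrow> i \<notin> A} \<in> sets ?N"
      using 2 sets.sets_Collect_neg[OF 2] by (cases "i \<in> A") simp_all
  qed
  then have "?E \<in> sigma_sets (space M) G" using Gpow by simp
  then have eq: "measure M (?E \<inter> (B \<inter> ?F)) = measure M (?E \<inter> B) * V" using step by blast
  have "{w \<in> space M. D s0 w = A \<and> D s w = S} = ?E \<inter> B"
  proof (intro set_eqI iffI)
    fix w assume w: "w \<in> {w \<in> space M. D s0 w = A \<and> D s w = S}"
    have "i \<in> D s0 w \<longleftrightarrow> \<not> L s0 w < X (i, 0) w" "i \<in> D s w \<longleftrightarrow> \<not> L s w < X (i, 0) w" if "i \<in> {1..n}" for i
      using that by (simp_all add: dead_def not_less)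
    with w S show "w \<in> ?E \<inter> B" unfolding B_def by blast
  next
    fix w assume w: "w \<in> ?E \<inter> B"
    have iff: "i \<in> D s0 w \<longleftrightarrow> \<not> L s0 w < X (i, 0) w" "i \<in> D s w \<longleftrightarrow> \<not> L s w < X (i, 0) w" if "i \<in> {1..n}" for i
      using that by (simp_all add: dead_def not_less)
    have "i \<in> D s w \<longleftrightarrow> i \<in> S" for i
      using w S iff(2)[of i] dead_subset[of L X n s w] unfolding B_def by blast
    then have Ds: "D s w = S" by blast
    have "D s0 w \<subseteq> S" using dead_mono[of w s0 s] s w Ds by auto
    then have "i \<in> D s0 w \<longleftrightarrow> i \<in> A" for i
      using w A S iff(1)[of i] by blast
    then show "w \<in> {w \<in> space M. D s0 w = A \<and> D s w = S}" using Ds w by blast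
  qed
  then show ?thesis using eq unfolding V_def by (simp add: Int_assoc)
qed

text \<open>The past enters through a property \<open>R\<close> of the dead set at the earlier time;
  for the first repair it will say that the repair was not yet due.\<close>

lemma measure_dead_pred_future:
  assumes s: "0 \<le> s0" "s0 \<le> s" and S: "S \<subseteq> {1..n}"
    and J: "finite J" "J \<subseteq> {1..n} \<times> UNIV" and v: "time_grid v p" and b: "\<And>x j. 0 \<le> b x j"
  shows "measure M ({w \<in> space M. R (D s0 w) \<and> D s w = S} \<inter> future s S J v p b) =
    measure M {w \<in> space M. R (D s0 w) \<and> D s w = S} * exp (- psi_comb \<Psi> v p (\<lambda>j. \<Sum>x\<in>J. b x j))"
proof -
  let ?K = "{A. A \<subseteq> S \<and> R A}" and ?F = "future s S J v p b"
  have fS: "finite S" using S finite_subset by blast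
  have s': "0 \<le> s" using s by simp
  have F: "?F \<in> sets M" using s by (intro future_measurable J v) auto
  have W: "{w \<in> space M. D s w = S} \<in> sets M" using s' by measurable
  have *: "measure M ({w \<in> space M. R (D s0 w) \<and> D s w = S} \<inter> C) =
      (\<Sum>A\<in>?K. measure M ({w \<in> space M. D s0 w = A \<and> D s w = S} \<inter> C))" if C: "C \<in> sets M" for C
  proof -
    have "measure M {w \<in> {w \<in> space M. D s w = S} \<inter> C. R (D s0 w)} =
        (\<Sum>A\<in>?K. measure M {w \<in> {w \<in> space M. D s w = S} \<inter> C. D s0 w = A})"
      using fS W C s dead_mono[OF _ s] by (intro measure_eq_sum_fibres D_measurable) auto
    moreover have "{w \<in> {w \<in> space M. D s w = S} \<inter> C. R (D s0 w)} =
        {w \<in> space M. R (D s0 w) \<and> D s w = S} \<inter> C" by auto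
    moreover have "{w \<in> {w \<in> space M. D s w = S} \<inter> C. D s0 w = A} =
        {w \<in> space M. D s0 w = A \<and> D s w = S} \<inter> C" for A by auto
    ultimately show ?thesis by (simp only:)
  qed
  have "measure M {w \<in> space M. R (D s0 w) \<and> D s w = S} =
      (\<Sum>A\<in>?K. measure M {w \<in> space M. D s0 w = A \<and> D s w = S})"
  proof -
    have "{w \<in> space M. Q w} \<inter> space M = {w \<in> space M. Q w}" for Q by auto
    then show ?thesis using *[OF sets.top] by simp
  qed
  then show ?thesis
    unfolding *[OF F] sum_distrib_right
    using measure_dead_future[OF s _ S J v b] by (simp add: sum_distrib_right)
qed

end

section \<open>The number of failed components at the first repair\<close>

text \<open>\<open>a\<close> and \<open>b\<close> count alive components: the probability that
  exactly \<open>b\<close> of \<open>a\<close> alive ones are alive after a further time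
  \<open>h\<close>, by inclusion-exclusion.\<close>

definition step_prob :: "(real \<Rightarrow> real) \<Rightarrow> real \<Rightarrow> nat \<Rightarrow> nat \<Rightarrow> real" where
  "step_prob \<Psi> h a b = (\<Sum>i = b..a. (- 1) ^ (i - b) * real (i choose b) * (real (a choose i) * exp (- h * \<Psi> (real i))))"

lemma step_prob_same: "step_prob \<Psi> h a a = exp (- h * \<Psi> (real a))"
  by (simp add: step_prob_def)

text \<open>Pascal's rule as summation by parts; it trades the increments of \<open>\<Psi>\<close>
  in \<open>lfmo_rate\<close> for plain values.\<close>

lemma alternating_sum_by_parts:
  fixes g :: "nat \<Rightarrow> real"
  shows "(\<Sum>m\<le>Suc e. (- 1) ^ m * real (Suc e choose m) * g m) =
    - (\<Sum>i\<le>e. real (e choose i) * (- 1) ^ i * (g (Suc i) - g i))"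
proof -
  have "(\<Sum>m\<le>Suc e. (- 1) ^ m * real (Suc e choose m) * g m) =
      g 0 + (\<Sum>i\<le>e. (- 1) ^ Suc i * real (e choose i) * g (Suc i) + (- 1) ^ Suc i * real (e choose Suc i) * g (Suc i))"
    unfolding sum.atMost_Suc_shift by (simp add: algebra_simps)
  also have "\<dots> = (\<Sum>i\<le>e. (- 1) ^ Suc i * real (e choose i) * g (Suc i)) +
      (g 0 + (\<Sum>i\<le>e. (- 1) ^ Suc i * real (e choose Suc i) * g (Suc i)))"
    by (simp only: sum.distrib add.left_commute)
  also have "g 0 + (\<Sum>i\<le>e. (- 1) ^ Suc i * real (e choose Suc i) * g (Suc i)) =
      (\<Sum>i\<le>Suc e. (- 1) ^ i * real (e choose i) * g i)"
    unfolding sum.atMost_Suc_shift by simp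
  also have "\<dots> = (\<Sum>i\<le>e. (- 1) ^ i * real (e choose i) * g i)" by (simp add: binomial_eq_0)
  finally show ?thesis
    by (simp add: sum.distrib[symmetric] sum_negf[symmetric] algebra_simps)
qed

text \<open>The right-hand side is the derivative of \<open>step_prob\<close> at
  \<open>h = 0\<close>. So this product is the intensity of jumps from \<open>a\<close> to
  \<open>b\<close> alive components.\<close>

lemma choose_rate_eq:
  assumes "b < a"
  shows "real (a choose b) * lfmo_rate \<Psi> a (a - b) =
    - (\<Sum>i = b..a. (- 1) ^ (i - b) * real (i choose b) * (real (a choose i) * \<Psi> (real i)))"
proof -
  define e where "e = a - b - 1"
  have a: "a = Suc e + b" using assms by (simp add: e_def)
  have "(\<Sum>i = b..a. (- 1) ^ (i - b) * real (i choose b) * (real (a choose i) * \<Psi> (real i))) =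
      (\<Sum>i = 0 + b..Suc e + b. (- 1) ^ (i - b) * real (i choose b) * (real (a choose i) * \<Psi> (real i)))"
    by (simp add: a)
  also have "\<dots> = (\<Sum>m = 0..Suc e. (- 1) ^ m * real ((m + b) choose b) * (real (a choose (m + b)) * \<Psi> (real (m + b))))"
    by (subst sum.shift_bounds_cl_nat_ivl) simp
  also have "\<dots> = (\<Sum>m = 0..Suc e. real (a choose b) * ((- 1) ^ m * real (Suc e choose m) * \<Psi> (real (b + m))))"
  proof (rule sum.cong)
    fix m assume "m \<in> {0..Suc e}"
    then have "real ((a choose (m + b)) * ((m + b) choose b)) = real ((a choose b) * (Suc e choose m))"
      using choose_mult[of b "m + b" a] a by simp
    then show "(- 1) ^ m * real ((m + b) choose b) * (real (a choose (m + b)) * \<Psi> (real (m + b))) =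
        real (a choose b) * ((- 1) ^ m * real (Suc e choose m) * \<Psi> (real (b + m)))"
      by (simp only: of_nat_mult add.commute[of m b]) (simp add: algebra_simps)
  qed simp
  also have "\<dots> = real (a choose b) * (\<Sum>m\<le>Suc e. (- 1) ^ m * real (Suc e choose m) * \<Psi> (real (b + m)))"
    by (simp only: sum_distrib_left atLeast0AtMost)
  also have "\<dots> = - (real (a choose b) * (\<Sum>i\<le>e. real (e choose i) * (- 1) ^ i * (\<Psi> (real (b + Suc i)) - \<Psi> (real (b + i)))))"
    unfolding alternating_sum_by_parts by simp
  also have "(\<Sum>i\<le>e. real (e choose i) * (- 1) ^ i * (\<Psi> (real (b + Suc i)) - \<Psi> (real (b + i)))) = lfmo_rate \<Psi> a (a - b)"
    unfolding lfmo_rate_def by (intro sum.cong) (auto simp: a atLeast0AtMost)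
  finally show ?thesis by simp
qed

lemma exp_difference_quotient_tendsto:
  "(\<lambda>k. (exp (- (1 / real (Suc k)) * c) - 1) * real (Suc k)) \<longlonglongrightarrow> - c" for c :: real
proof -
  have "((\<lambda>x. exp (- x * c)) has_real_derivative - c) (at 0)"
    by (auto intro!: derivative_eq_intros)
  then have "((\<lambda>h. (exp (- h * c) - 1) / h) \<longlongrightarrow> - c) (at 0)"
    by (simp add: has_field_derivative_iff)
  moreover have "filterlim (\<lambda>k. 1 / real (Suc k)) (at 0) sequentially"
    using LIMSEQ_inverse_real_of_nat unfolding inverse_eq_divide
    by (intro filterlim_atI) auto
  ultimately have "(\<lambda>k. (exp (- (1 / real (Suc k)) * c) - 1) / (1 / real (Suc k))) \<longlonglongrightarrow> - c"
    by (rule filterlim_compose)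
  then show ?thesis by simp
qed

lemma step_prob_tendsto:
  assumes "b < a"
  shows "(\<lambda>k. step_prob \<Psi> (1 / real (Suc k)) a b * real (Suc k)) \<longlonglongrightarrow> real (a choose b) * lfmo_rate \<Psi> a (a - b)"
proof -
  have "(\<lambda>k. \<Sum>i = b..a. (- 1) ^ (i - b) * real (i choose b) *
      (real (a choose i) * ((exp (- (1 / real (Suc k)) * \<Psi> (real i)) - 1) * real (Suc k))))
    \<longlonglongrightarrow> (\<Sum>i = b..a. (- 1) ^ (i - b) * real (i choose b) * (real (a choose i) * - \<Psi> (real i)))"
    by (intro tendsto_sum tendsto_mult tendsto_const exp_difference_quotient_tendsto)
  moreover have "(\<Sum>i = b..a. (- 1) ^ (i - b) * real (i choose b) * (real (a choose i) * - \<Psi> (real i))) =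
      real (a choose b) * lfmo_rate \<Psi> a (a - b)"
    using choose_rate_eq[OF assms] by (simp add: sum_negf)
  moreover have "(\<Sum>i = b..a. (- 1) ^ (i - b) * real (i choose b) *
      (real (a choose i) * ((exp (- (1 / real (Suc k)) * \<Psi> (real i)) - 1) * real (Suc k)))) =
      step_prob \<Psi> (1 / real (Suc k)) a b * real (Suc k)" for k
  proof -
    \<comment> \<open>The alternating sum without exponentials is zero for \<open>b < a\<close>, so
      \<open>exp\<close> may be replaced by \<open>exp - 1\<close> to form difference
      quotients.\<close>
    have z: "(\<Sum>i = b..a. (- 1) ^ (i - b) * real (a choose i) * real (i choose b)) = 0"
      using alternating_sum_choose_choose[of a a b] assms by simp
    have "(\<Sum>i = b..a. (- 1) ^ (i - b) * real (i choose b) *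
      (real (a choose i) * ((exp (- (1 / real (Suc k)) * \<Psi> (real i)) - 1) * real (Suc k)))) =
      (\<Sum>i = b..a. (- 1) ^ (i - b) * real (i choose b) * (real (a choose i) * exp (- (1 / real (Suc k)) * \<Psi> (real i))) * real (Suc k)
        - (- 1) ^ (i - b) * real (a choose i) * real (i choose b) * real (Suc k))"
      by (intro sum.cong refl) (simp only: algebra_simps)
    also have "\<dots> = step_prob \<Psi> (1 / real (Suc k)) a b * real (Suc k)"
      unfolding sum_subtractf sum_distrib_right[symmetric] z step_prob_def by simp
    finally show ?thesis .
  qed
  ultimately show ?thesis by simp
qed

text \<open>The probability that the number of dead components ever takes the value
  \<open>j\<close>: the first state beyond \<open>j - 1\<close> is then \<open>j\<close>
  itself.\<close>

definition visit_prob :: "(real \<Rightarrow> real) \<Rightarrow> nat \<Rightarrow> nat \<Rightarrow> real" where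
  "visit_prob \<Psi> n j = (if j = 0 then 1 else F_prob \<Psi> n (j - 1) j)"

text \<open>Decomposition by the last state \<open>l \<le> i\<close> before the jump beyond
  \<open>i\<close>; each step of the recursion adds one possible last state.\<close>

lemma F_prob_eq_sum:
  "F_prob \<Psi> n i j = (if i < j then \<Sum>l\<le>i. visit_prob \<Psi> n l * trans_prob \<Psi> n l j else 0)"
  by (induction i) (auto simp: visit_prob_def)

lemma visit_prob_eq_sum:
  "visit_prob \<Psi> n j = (if j = 0 then 1 else \<Sum>l<j. visit_prob \<Psi> n l * trans_prob \<Psi> n l j)"
proof (cases j)
  case (Suc i)
  then have "visit_prob \<Psi> n j = F_prob \<Psi> n i (Suc i)" by (simp add: visit_prob_def)
  also have "\<dots> = (\<Sum>l\<le>i. visit_prob \<Psi> n l * trans_prob \<Psi> n l (Suc i))"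
    unfolding F_prob_eq_sum by simp
  finally show ?thesis using Suc by (simp add: lessThan_Suc_atMost)
qed (simp add: visit_prob_def)

section \<open>The number of dead components as a Markov chain on a grid\<close>

context repair_system
begin

text \<open>Markov property with a future of one interval: given the dead set \<open>S\<close>, a
  set of remaining components survives a further \<open>h\<close> with probability depending on its
  size only, so exact counting applies on the event \<open>Q\<close>.\<close>

lemma measure_dead_step:
  assumes s: "0 \<le> s" "0 \<le> h" and S: "S \<subseteq> {1..n}" and j: "j \<le> n"
  shows "measure M {w \<in> space M. D s w = S \<and> card (D (s + h) w) = j} =
    measure M {w \<in> space M. D s w = S} * step_prob \<Psi> h (n - card S) (n - j)"
proof -
  define Q where "Q = {w \<in> space M. D s w = S}"
  have Q: "Q \<in> sets M" unfolding Q_def using s by measurable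
  have fS: "finite S" using S finite_subset by blast
  have v: "measure M {w \<in> Q. \<forall>i\<in>A. L (s + h) w < X (i, 0) w} = measure M Q * exp (- h * \<Psi> (real (card A)))"
    if A: "A \<subseteq> {1..n} - S" for A
  proof -
    let ?v = "\<lambda>j::nat. if j = 0 then 0 else h"
    have g: "time_grid ?v 1" using s by (simp add: time_grid_def)
    have fA: "finite A" using A finite_subset by blast
    have "measure M ({w \<in> space M. True \<and> D s w = S} \<inter> future s S (A \<times> {0}) ?v 1 (\<lambda>_ _. 1)) =
        measure M {w \<in> space M. True \<and> D s w = S} * exp (- psi_comb \<Psi> ?v 1 (\<lambda>j. \<Sum>x\<in>A \<times> {0::nat}. 1))"
      using A fA by (intro measure_dead_pred_future[OF s(1) order_refl S _ _ g, where R = "\<lambda>_. True"]) auto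
    moreover have "{w \<in> space M. True \<and> D s w = S} \<inter> future s S (A \<times> {0}) ?v 1 (\<lambda>_ _. 1) =
        {w \<in> Q. \<forall>i\<in>A. L (s + h) w < X (i, 0) w}"
    proof -
      have "residual L X s S (i, 0) w = X (i, 0) w - L s w" if "i \<in> A" for i w
        using A that by (auto simp: residual_def renew_index_def)
      then show ?thesis by (auto simp: future_def Q_def path_comb_shifted)
    qed
    ultimately show ?thesis
      by (simp add: psi_comb_def Q_def card_cartesian_product)
  qed
  have m: "{w \<in> space M. L (s + h) w < X (i, 0) w} \<in> sets M" if "i \<in> {1..n} - S" for i
    using that s by (intro alive_measurable) auto
  have "measure M {w \<in> Q. card {i \<in> {1..n} - S. L (s + h) w < X (i, 0) w} = n - j} =
    (\<Sum>i = n - j..card ({1..n} - S). (- 1) ^ (i - (n - j)) * real (i choose (n - j)) *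
       (real (card ({1..n} - S) choose i) * (measure M Q * exp (- h * \<Psi> (real i)))))"
    by (rule measure_count_eq[where P = "\<lambda>i w. L (s + h) w < X (i, 0) w" and v = "\<lambda>c. measure M Q * exp (- h * \<Psi> (real c))",
          OF _ Q m v]) auto
  moreover have "card ({1..n} - S) = n - card S" using S fS by (simp add: card_Diff_subset)
  moreover have "(\<Sum>i = n - j..a. (- 1) ^ (i - (n - j)) * real (i choose (n - j)) *
       (real (a choose i) * (measure M Q * exp (- h * \<Psi> (real i))))) = measure M Q * step_prob \<Psi> h a (n - j)" for a
    unfolding step_prob_def sum_distrib_left by (intro sum.cong refl) (simp only: mult_ac)
  moreover have "{w \<in> Q. card {i \<in> {1..n} - S. L (s + h) w < X (i, 0) w} = n - j} =
      {w \<in> space M. D s w = S \<and> card (D (s + h) w) = j}"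
  proof -
    have "card {i \<in> {1..n} - S. L (s + h) w < X (i, 0) w} = n - card (D (s + h) w)" if "w \<in> Q" for w
    proof -
      have "D s w \<subseteq> D (s + h) w" using that s by (intro dead_mono) (auto simp: Q_def)
      then have "{i \<in> {1..n} - S. L (s + h) w < X (i, 0) w} = {1..n} - D (s + h) w"
        using that by (auto simp: Q_def dead_def not_le)
      then show ?thesis by (simp only: card_Diff_subset[OF finite_dead dead_subset] card_atLeastAtMost)
    qed
    moreover have "n - card (D (s + h) w) = n - j \<longleftrightarrow> card (D (s + h) w) = j" for w
      using j card_dead_le[of L X n "s + h" w] by linarith
    ultimately have "card {i \<in> {1..n} - S. L (s + h) w < X (i, 0) w} = n - j \<longleftrightarrow> card (D (s + h) w) = j"
      if "w \<in> Q" for w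
      using that by presburger
    then show ?thesis unfolding Q_def by blast
  qed
  ultimately show ?thesis by (simp add: Q_def)
qed

lemma measure_card_dead_step:
  assumes s: "0 \<le> s" "0 \<le> h" and j: "j \<le> n"
  shows "measure M {w \<in> space M. card (D s w) = i \<and> card (D (s + h) w) = j} =
    measure M {w \<in> space M. card (D s w) = i} * step_prob \<Psi> h (n - i) (n - j)"
proof -
  let ?K = "{S. S \<subseteq> {1..n} \<and> card S = i}"
  have *: "measure M {w \<in> W. card (D s w) = i} = (\<Sum>S\<in>?K. measure M {w \<in> W. D s w = S})" if "W \<in> sets M" for W
    using that s dead_subset[of L X n s] by (intro measure_eq_sum_fibres D_measurable) (blast | simp)+
  have "0 \<le> s + h" using s by simp
  then have W: "{w \<in> space M. card (D (s + h) w) = j} \<in> sets M" by measurable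
  have "measure M {w \<in> space M. card (D s w) = i \<and> card (D (s + h) w) = j} =
      measure M {w \<in> {w \<in> space M. card (D (s + h) w) = j}. card (D s w) = i}"
    by (rule arg_cong[where f = "measure M"]) auto
  also have "\<dots> = (\<Sum>S\<in>?K. measure M {w \<in> {w \<in> space M. card (D (s + h) w) = j}. D s w = S})"
    by (rule *[OF W])
  also have "\<dots> = (\<Sum>S\<in>?K. measure M {w \<in> space M. D s w = S} * step_prob \<Psi> h (n - i) (n - j))"
  proof (rule sum.cong)
    fix S assume S: "S \<in> ?K"
    have "{w \<in> {w \<in> space M. card (D (s + h) w) = j}. D s w = S} =
        {w \<in> space M. D s w = S \<and> card (D (s + h) w) = j}" by auto
    then show "measure M {w \<in> {w \<in> space M. card (D (s + h) w) = j}. D s w = S} =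
        measure M {w \<in> space M. D s w = S} * step_prob \<Psi> h (n - i) (n - j)"
      using measure_dead_step[OF s _ j, of S] S by simp
  qed simp
  also have "\<dots> = measure M {w \<in> space M. card (D s w) = i} * step_prob \<Psi> h (n - i) (n - j)"
    using *[OF sets.top] by (simp add: sum_distrib_right)
  finally show ?thesis .
qed

text \<open>The mass in state \<open>i\<close> after \<open>l\<close> steps of the chain with mesh
  \<open>1 / Suc k\<close>; \<open>occupation_sum\<close> is the expected number of steps spent in
  \<open>i\<close>.\<close>

definition occupation :: "nat \<Rightarrow> nat \<Rightarrow> nat \<Rightarrow> real" where
  "occupation k i l = measure M {w \<in> space M. card (D (real l / real (Suc k)) w) = i}"

definition occupation_sum :: "nat \<Rightarrow> nat \<Rightarrow> real" where
  "occupation_sum k i = (\<Sum>l. occupation k i l)"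

lemma real_Suc_divide: "real (Suc l) / c = real l / c + 1 / c"
  by (simp add: add_divide_distrib)

lemma measure_occupation_step:
  assumes j: "j \<le> n"
  shows "measure M {w \<in> space M. card (D (real l / real (Suc k)) w) = i \<and> card (D (real (Suc l) / real (Suc k)) w) = j} =
    occupation k i l * step_prob \<Psi> (1 / real (Suc k)) (n - i) (n - j)"
  unfolding occupation_def real_Suc_divide by (intro measure_card_dead_step j) auto

lemma summable_occupation:
  assumes i: "i < n"
  shows "summable (occupation k i)"
proof (rule summable_comparison_test)
  let ?r = "exp (- \<Psi> 1 / real (Suc k))"
  have "\<Psi> 1 / real (Suc k) > 0" using \<Psi>_pos[of 1] by simp
  then show "summable (\<lambda>l. real n * mass * ?r ^ l)"
    by (intro summable_mult summable_geometric) simp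
  have "occupation k i l \<le> real n * mass * ?r ^ l" for l
  proof -
    have t: "0 \<le> real l / real (Suc k)" by simp
    have "occupation k i l \<le> measure M {w \<in> space M. card (D (real l / real (Suc k)) w) < n}"
      unfolding occupation_def using i t by (intro finite_measure_mono) auto
    also have "\<dots> \<le> real n * mass * exp (- (real l / real (Suc k)) * \<Psi> 1)" by (rule measure_dead_less_le[OF t])
    also have "exp (- (real l / real (Suc k)) * \<Psi> 1) = ?r ^ l"
      by (simp add: exp_of_nat_mult[symmetric])
    finally show ?thesis .
  qed
  then show "\<exists>N. \<forall>l\<ge>N. norm (occupation k i l) \<le> real n * mass * ?r ^ l"
    by (auto simp: occupation_def)
qed

lemma occupation_Suc:
  assumes j: "j \<le> n"
  shows "occupation k j (Suc l) = (\<Sum>i\<le>j. occupation k i l * step_prob \<Psi> (1 / real (Suc k)) (n - i) (n - j))"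
proof -
  let ?s = "real l / real (Suc k)" and ?t = "real (Suc l) / real (Suc k)"
  have st: "0 \<le> ?s" "?s \<le> ?t" "0 \<le> ?t" by (simp_all add: divide_right_mono del: of_nat_Suc)
  have W: "{w \<in> space M. card (D ?t w) = j} \<in> sets M" using st by measurable
  have f: "(\<lambda>w. card (D ?s w)) \<in> measurable M (count_space UNIV)" using st by measurable
  have "measure M {w \<in> {w \<in> space M. card (D ?t w) = j}. True} =
      (\<Sum>i\<in>{..j}. measure M {w \<in> {w \<in> space M. card (D ?t w) = j}. card (D ?s w) = i})"
    using card_dead_mono[OF _ st(1,2)] by (intro measure_eq_sum_fibres[OF f W]) auto
  also have "\<dots> = (\<Sum>i\<le>j. occupation k i l * step_prob \<Psi> (1 / real (Suc k)) (n - i) (n - j))"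
  proof (rule sum.cong)
    fix i
    have "{w \<in> {w \<in> space M. card (D ?t w) = j}. card (D ?s w) = i} =
        {w \<in> space M. card (D ?s w) = i \<and> card (D ?t w) = j}" by auto
    then show "measure M {w \<in> {w \<in> space M. card (D ?t w) = j}. card (D ?s w) = i} =
        occupation k i l * step_prob \<Psi> (1 / real (Suc k)) (n - i) (n - j)"
      using measure_occupation_step[OF j, of l k i] by (simp only:)
  qed simp
  finally show ?thesis by (simp add: occupation_def)
qed

lemma occupation_0: "occupation k j 0 = (if j = 0 then mass else 0)"
proof -
  have "measure M {w \<in> space M. card (D 0 w) = j} = measure M {w \<in> space M. j = 0}"
  proof (rule measure_eq_AE)
    show "AE w in M. (w \<in> {w \<in> space M. card (D 0 w) = j}) = (w \<in> {w \<in> space M. j = 0})"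
      using AE_X0_pos AE_space
    proof eventually_elim
      case (elim w)
      then have "card (D 0 w) = 0" using dead_zero_empty by simp
      then show ?case by auto
    qed
  qed (auto intro: D_measurable)
  then show ?thesis by (simp add: occupation_def)
qed

text \<open>The chain with holding times removed. With \<open>h = 1 / Suc k\<close>, the probability
  of leaving state \<open>i\<close> in one step is \<open>1 - exp (- h * \<Psi> (n - i))\<close>.
  Expected number of steps in a state times this probability is the chance of ever visiting it, up
  to the mass: this is \<open>embedded_visits\<close>.\<close>

definition embedded_step :: "nat \<Rightarrow> nat \<Rightarrow> nat \<Rightarrow> real" where
  "embedded_step k i j = step_prob \<Psi> (1 / real (Suc k)) (n - i) (n - j) / (1 - exp (- (1 / real (Suc k)) * \<Psi> (real (n - i))))"

definition embedded_visits :: "nat \<Rightarrow> nat \<Rightarrow> real" where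
  "embedded_visits k i = occupation_sum k i * (1 - exp (- (1 / real (Suc k)) * \<Psi> (real (n - i))))"

lemma exp_\<Psi>_less_1: "i < n \<Longrightarrow> exp (- (1 / real (Suc k)) * \<Psi> (real (n - i))) < 1"
  using \<Psi>_pos[of "real (n - i)"] by simp

lemma embedded_visits_step:
  assumes "i < n"
  shows "embedded_visits k i * embedded_step k i j = occupation_sum k i * step_prob \<Psi> (1 / real (Suc k)) (n - i) (n - j)"
proof -
  have "1 - exp (- (1 / real (Suc k)) * \<Psi> (real (n - i))) \<noteq> 0"
    using exp_\<Psi>_less_1[OF assms, of k] by linarith
  moreover have "a * c * (p / c) = a * p" if "c \<noteq> 0" for a c p :: real using that by simp
  ultimately show ?thesis unfolding embedded_visits_def embedded_step_def by blast
qed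

text \<open>The one-step equations are summed over all grid times, and the diagonal term
  \<open>i = j\<close> is moved to the left, where it produces the leaving probability.\<close>

lemma embedded_visits_rec:
  assumes j: "j < n"
  shows "embedded_visits k j = (if j = 0 then mass else 0) + (\<Sum>i<j. embedded_visits k i * embedded_step k i j)"
proof -
  let ?p = "\<lambda>i. step_prob \<Psi> (1 / real (Suc k)) (n - i) (n - j)"
  have "occupation_sum k j - occupation k j 0 = (\<Sum>l. occupation k j (Suc l))"
    unfolding occupation_sum_def by (rule suminf_split_head[OF summable_occupation[OF j], symmetric])
  also have "\<dots> = (\<Sum>l. \<Sum>i\<le>j. occupation k i l * ?p i)"
    using j by (simp add: occupation_Suc)
  also have "\<dots> = (\<Sum>i\<le>j. \<Sum>l. occupation k i l * ?p i)"
    using j by (intro suminf_sum summable_mult2 summable_occupation) auto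
  also have "\<dots> = (\<Sum>i\<le>j. occupation_sum k i * ?p i)"
    unfolding occupation_sum_def
    using j by (intro sum.cong refl suminf_mult2[symmetric] summable_occupation) auto
  also have "\<dots> = (\<Sum>i<j. occupation_sum k i * ?p i) + occupation_sum k j * exp (- (1 / real (Suc k)) * \<Psi> (real (n - j)))"
    by (simp add: lessThan_Suc_atMost[symmetric] step_prob_same)
  also have "(\<Sum>i<j. occupation_sum k i * ?p i) = (\<Sum>i<j. embedded_visits k i * embedded_step k i j)"
    using j by (intro sum.cong) (auto simp: embedded_visits_step)
  finally show ?thesis
    unfolding occupation_0 embedded_visits_def[of k j] right_diff_distrib by linarith
qed

text \<open>Multiplying numerator and denominator by \<open>Suc k\<close> makes both of them
  difference quotients; the limit is the jump intensity over the total intensity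
  \<open>\<Psi> (n - i)\<close>.\<close>

lemma embedded_step_tendsto:
  assumes "i < j" "j \<le> n"
  shows "(\<lambda>k. embedded_step k i j) \<longlonglongrightarrow> trans_prob \<Psi> n i j"
proof -
  have c: "n - i choose (n - j) = n - i choose (j - i)"
    using assms binomial_symmetric[of "n - j" "n - i"] by simp
  have d: "n - i - (n - j) = j - i" using assms by simp
  have pos: "0 < \<Psi> (real (n - i))" using assms by (intro \<Psi>_pos) simp
  have "(\<lambda>k. (step_prob \<Psi> (1 / real (Suc k)) (n - i) (n - j) * real (Suc k)) /
      - ((exp (- (1 / real (Suc k)) * \<Psi> (real (n - i))) - 1) * real (Suc k)))
    \<longlonglongrightarrow> real (n - i choose (n - j)) * lfmo_rate \<Psi> (n - i) (n - i - (n - j)) / - (- \<Psi> (real (n - i)))"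
    using assms pos
    by (intro tendsto_divide step_prob_tendsto tendsto_minus exp_difference_quotient_tendsto) auto
  moreover have "(step_prob \<Psi> (1 / real (Suc k)) (n - i) (n - j) * real (Suc k)) /
      - ((exp (- (1 / real (Suc k)) * \<Psi> (real (n - i))) - 1) * real (Suc k)) = embedded_step k i j" for k
    unfolding embedded_step_def mult_minus_left[symmetric] minus_diff_eq
    by (rule mult_divide_mult_cancel_right) simp
  ultimately have "(\<lambda>k. embedded_step k i j) \<longlonglongrightarrow>
      real (n - i choose (n - j)) * lfmo_rate \<Psi> (n - i) (n - i - (n - j)) / - (- \<Psi> (real (n - i)))"
    by (simp only:)
  then show ?thesis unfolding c d trans_prob_def by (simp only: minus_minus)
qed

lemma embedded_visits_tendsto:
  assumes "j < n"
  shows "(\<lambda>k. embedded_visits k j) \<longlonglongrightarrow> mass * visit_prob \<Psi> n j"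
  using assms
proof (induction j rule: less_induct)
  case (less j)
  have "(\<lambda>k. (if j = 0 then mass else 0) + (\<Sum>i<j. embedded_visits k i * embedded_step k i j)) \<longlonglongrightarrow>
      (if j = 0 then mass else 0) + (\<Sum>i<j. mass * visit_prob \<Psi> n i * trans_prob \<Psi> n i j)"
    using less by (intro tendsto_intros embedded_step_tendsto) auto
  moreover have "(if j = 0 then mass else 0) + (\<Sum>i<j. mass * visit_prob \<Psi> n i * trans_prob \<Psi> n i j) =
      mass * visit_prob \<Psi> n j"
    unfolding visit_prob_eq_sum[of \<Psi> n j] by (auto simp: sum_distrib_left mult.assoc)
  ultimately show ?case
    unfolding embedded_visits_rec[OF less.prems, abs_def] by (simp only:)
qed

lemma grid_index_passage_iff:
  assumes w: "w \<in> space M" "\<forall>i\<in>{1..n}. 0 < X (i, 0) w" "fp w = ennreal (T w)"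
  shows "grid_index k (T w) = Suc l \<longleftrightarrow>
    card (D (real l / real (Suc k)) w) < q \<and> q \<le> card (D (real (Suc l) / real (Suc k)) w)"
proof -
  have *: "t < T w \<longleftrightarrow> card (D t w) < q" if "0 \<le> t" for t
    using passage_greater_iff[OF w(1,2) that] w(3) that by (simp add: ennreal_less_iff)
  have "grid_index k (T w) = Suc l \<longleftrightarrow> real l / real (Suc k) < T w \<and> \<not> real (Suc l) / real (Suc k) < T w"
    by (subst grid_index_eq_iff) (auto simp: not_less)
  then show ?thesis
    using *[of "real l / real (Suc k)"] *[of "real (Suc l) / real (Suc k)"] by (simp add: not_less del: of_nat_Suc)
qed

lemma AE_good: "AE w in M. w \<in> space M \<and> (\<forall>x\<in>{1..n} \<times> UNIV. 0 < X x w) \<and> (\<forall>i\<in>{1..n}. 0 < X (i, 0) w) \<and>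
    fp w = ennreal (T w) \<and> 0 < T w \<and> q \<le> card (D (T w) w)"
  using AE_passage_time AE_X_pos AE_space by eventually_elim auto

lemma grid_index_measurable[measurable]: "(\<lambda>w. grid_index k (T w)) \<in> measurable M (count_space UNIV)"
  unfolding grid_index_def by measurable

text \<open>Decomposition by the grid cell that contains \<open>T\<close> and by the state before
  it. Summing over cells turns occupation into visits, so this is the formula for \<open>F\<close>
  at positive mesh.\<close>

lemma measure_grid_count:
  assumes j: "q \<le> j" "j \<le> n"
  shows "measure M {w \<in> space M. card (D (grid_time k (T w)) w) = j} =
    (\<Sum>i<q. embedded_visits k i * embedded_step k i j)"
proof -
  let ?t = "\<lambda>l. real l / real (Suc k)"
  let ?E = "\<lambda>l. {w \<in> space M. card (D (?t l) w) < q \<and> card (D (?t (Suc l)) w) = j}"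
  let ?G = "\<lambda>l. {w \<in> space M. grid_index k (T w) = Suc l \<and> card (D (?t (Suc l)) w) = j}"
  have G: "?G l \<in> sets M" for l
  proof -
    have "0 \<le> ?t (Suc l)" by simp
    then show ?thesis by measurable
  qed
  have E: "?E l \<in> sets M" for l
  proof -
    have "0 \<le> ?t (Suc l)" "0 \<le> ?t l" by simp_all
    then show ?thesis by measurable
  qed
  have "measure M {w \<in> space M. card (D (grid_time k (T w)) w) = j} = measure M (\<Union>l. ?G l)"
  proof (rule measure_eq_AE)
    show "AE w in M. (w \<in> {w \<in> space M. card (D (grid_time k (T w)) w) = j}) = (w \<in> (\<Union>l. ?G l))"
      using AE_good
    proof eventually_elim
      case (elim w)
      have "grid_index k (T w) \<noteq> 0"
      proof
        assume "grid_index k (T w) = 0"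
        then have "T w \<le> 0" using grid_time_bounds(1)[of "T w" k] by (simp add: grid_time_def)
        then show False using elim by simp
      qed
      then obtain l where "grid_index k (T w) = Suc l" by (cases "grid_index k (T w)") auto
      then show ?case using elim by (auto simp: grid_time_def)
    qed
    show "{w \<in> space M. card (D (grid_time k (T w)) w) = j} \<in> sets M"
    proof -
      have "(\<lambda>w. grid_time k (T w)) \<in> borel_measurable M"
        unfolding grid_time_def by measurable
      then have "(\<lambda>w. D (grid_time k (T w)) w) \<in> measurable M (count_space UNIV)"
        by (rule dead_random_time_measurable) (simp add: grid_time_def)
      then show ?thesis by measurable
    qed
  qed (use G in auto)
  also have "\<dots> = (\<Sum>l. measure M (?G l))"
    using G by (intro sums_unique finite_measure_UNION) (auto simp: disjoint_family_on_def)
  also have "\<dots> = (\<Sum>l. \<Sum>i<q. occupation k i l * step_prob \<Psi> (1 / real (Suc k)) (n - i) (n - j))"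
  proof (rule arg_cong[where f = suminf], rule ext)
    fix l
    have "measure M (?G l) = measure M (?E l)"
    proof (rule measure_eq_AE[OF _ G E])
      show "AE w in M. (w \<in> ?G l) = (w \<in> ?E l)"
        using AE_good
      proof eventually_elim
        case (elim w)
        then show ?case using grid_index_passage_iff[of w k l] j by auto
      qed
    qed
    also have "\<dots> = measure M {w \<in> {w \<in> space M. card (D (?t (Suc l)) w) = j}. card (D (?t l) w) < q}"
      by (rule arg_cong[where f = "measure M"]) auto
    also have "\<dots> = (\<Sum>i\<in>{..<q}. measure M {w \<in> {w \<in> space M. card (D (?t (Suc l)) w) = j}. card (D (?t l) w) = i})"
    proof (rule measure_eq_sum_fibres)
      have "0 \<le> ?t (Suc l)" "0 \<le> ?t l" by simp_all
      then show "(\<lambda>w. card (D (?t l) w)) \<in> measurable M (count_space UNIV)"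
        "{w \<in> space M. card (D (?t (Suc l)) w) = j} \<in> sets M" by measurable
    qed auto
    also have "\<dots> = (\<Sum>i<q. occupation k i l * step_prob \<Psi> (1 / real (Suc k)) (n - i) (n - j))"
    proof (rule sum.cong)
      fix i
      have "{w \<in> {w \<in> space M. card (D (?t (Suc l)) w) = j}. card (D (?t l) w) = i} =
          {w \<in> space M. card (D (?t l) w) = i \<and> card (D (?t (Suc l)) w) = j}" by auto
      then show "measure M {w \<in> {w \<in> space M. card (D (?t (Suc l)) w) = j}. card (D (?t l) w) = i} =
          occupation k i l * step_prob \<Psi> (1 / real (Suc k)) (n - i) (n - j)"
        using measure_occupation_step[OF j(2), of l k i] by (simp only:)
    qed simp
    finally show "measure M (?G l) = (\<Sum>i<q. occupation k i l * step_prob \<Psi> (1 / real (Suc k)) (n - i) (n - j))" .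
  qed
  also have "\<dots> = (\<Sum>i<q. \<Sum>l. occupation k i l * step_prob \<Psi> (1 / real (Suc k)) (n - i) (n - j))"
    using q by (intro suminf_sum summable_mult2 summable_occupation) auto
  also have "\<dots> = (\<Sum>i<q. occupation_sum k i * step_prob \<Psi> (1 / real (Suc k)) (n - i) (n - j))"
    unfolding occupation_sum_def
    using q by (intro sum.cong refl suminf_mult2[symmetric] summable_occupation) auto
  also have "\<dots> = (\<Sum>i<q. embedded_visits k i * embedded_step k i j)"
    using q by (intro sum.cong) (auto simp: embedded_visits_step)
  finally show ?thesis .
qed

lemma grid_dead_measurable:
  "(\<lambda>w. D (grid_time k (T w)) w) \<in> measurable M (count_space UNIV)"
proof (rule dead_random_time_measurable)
  show "(\<lambda>w. grid_time k (T w)) \<in> borel_measurable M"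
    unfolding grid_time_def by measurable
qed (simp add: grid_time_def)

text \<open>Both sides have limits as the mesh vanishes: the dead set at the rounded time eventually
  equals the one at \<open>T\<close>, and the embedded chains converge.\<close>

theorem measure_passage_count:
  assumes j: "q \<le> j" "j \<le> n"
  shows "measure M {w \<in> space M. N w = j} = mass * F_prob \<Psi> n (q - 1) j"
proof (rule LIMSEQ_unique)
  show "(\<lambda>k. measure M {w \<in> space M. card (D (grid_time k (T w)) w) = j}) \<longlonglongrightarrow> measure M {w \<in> space M. N w = j}"
  proof (rule measure_tendsto_of_eventually_eq)
    show "{w \<in> space M. card (D (grid_time k (T w)) w) = j} \<in> sets M" for k
      using grid_dead_measurable[of k] by measurable
    show "AE w in M. \<forall>\<^sub>F k in sequentially. (w \<in> {w \<in> space M. card (D (grid_time k (T w)) w) = j}) = (w \<in> {w \<in> space M. N w = j})"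
      using AE_space
    proof eventually_elim
      case (elim w)
      have "eventually (\<lambda>k. D (grid_time k (T w)) w = D (T w) w) sequentially"
        by (intro eventually_dead_eq[OF elim] grid_time_bounds grid_time_tendsto) auto
      then show ?case by eventually_elim (simp add: passage_count_def)
    qed
  qed measurable
  have "(\<lambda>k. \<Sum>i<q. embedded_visits k i * embedded_step k i j) \<longlonglongrightarrow>
      (\<Sum>i<q. mass * visit_prob \<Psi> n i * trans_prob \<Psi> n i j)"
    using q j by (intro tendsto_intros embedded_visits_tendsto embedded_step_tendsto) auto
  moreover have "(\<Sum>i<q. mass * visit_prob \<Psi> n i * trans_prob \<Psi> n i j) = mass * F_prob \<Psi> n (q - 1) j"
  proof -
    have "{..q - 1} = {..<q}" using q by auto
    then show ?thesis using q j by (simp add: F_prob_eq_sum sum_distrib_left mult.assoc)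
  qed
  ultimately show "(\<lambda>k. measure M {w \<in> space M. card (D (grid_time k (T w)) w) = j}) \<longlonglongrightarrow> mass * F_prob \<Psi> n (q - 1) j"
    unfolding measure_grid_count[OF j] by simp
qed

lemma AE_passage_count: "AE w in M. q \<le> N w \<and> N w \<le> n"
  using AE_good by eventually_elim (auto simp: passage_count_def card_dead_le)

end

section \<open>Restarting at the first repair\<close>

definition restart_path :: "(real \<Rightarrow> 'a \<Rightarrow> real) \<Rightarrow> (nat \<times> nat \<Rightarrow> 'a \<Rightarrow> real) \<Rightarrow> nat \<Rightarrow> nat \<Rightarrow> real \<Rightarrow> 'a \<Rightarrow> real" where
  "restart_path L X n q t w = shifted_path L (passage_time L X n q w) t w"

definition restart_threshold :: "(real \<Rightarrow> 'a \<Rightarrow> real) \<Rightarrow> (nat \<times> nat \<Rightarrow> 'a \<Rightarrow> real) \<Rightarrow> nat \<Rightarrow> nat \<Rightarrow> nat \<times> nat \<Rightarrow> 'a \<Rightarrow> real" where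
  "restart_threshold L X n q x w =
     residual L X (passage_time L X n q w) (dead L X n (passage_time L X n q w) w) x w"

context repair_system
begin

definition future_at :: "('a \<Rightarrow> real) \<Rightarrow> (nat \<times> nat) set \<Rightarrow> (nat \<Rightarrow> real) \<Rightarrow> nat \<Rightarrow> (nat \<times> nat \<Rightarrow> nat \<Rightarrow> real) \<Rightarrow> 'a set" where
  "future_at f J v p b = {w \<in> space M. \<forall>x\<in>J.
     path_comb (shifted_path L (f w)) v p (b x) w < residual L X (f w) (D (f w) w) x w}"

lemma shifted_path_random_measurable:
  assumes "f \<in> borel_measurable M" "\<And>w. 0 \<le> f w" "0 \<le> t"
  shows "(\<lambda>w. shifted_path L (f w) t w) \<in> borel_measurable M"
  unfolding shifted_path_def using assms
  by (intro borel_measurable_diff L_random_time_measurable) auto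

lemma path_comb_random_measurable:
  assumes "f \<in> borel_measurable M" "\<And>w. 0 \<le> f w" "time_grid v p"
  shows "(\<lambda>w. path_comb (shifted_path L (f w)) v p c w) \<in> borel_measurable M"
  unfolding path_comb_def using assms time_grid_nonneg[OF assms(3)]
  by (intro borel_measurable_sum borel_measurable_times borel_measurable_const borel_measurable_diff
      shifted_path_random_measurable) auto

lemma residual_random_measurable:
  assumes f: "f \<in> borel_measurable M" "\<And>w. 0 \<le> f w" and x: "x \<in> {1..n} \<times> UNIV"
  shows "(\<lambda>w. residual L X (f w) (D (f w) w) x w) \<in> borel_measurable M"
proof -
  obtain i m where x': "x = (i, m)" "i \<in> {1..n}" using x by auto
  have LT[measurable]: "(\<lambda>w. L (f w) w) \<in> borel_measurable M"
    by (rule L_random_time_measurable[OF f])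
  have "(\<lambda>w. if m = 0 \<and> L (f w) w < X (i, 0) w then X (i, 0) w - L (f w) w else X (i, Suc m) w) \<in> borel_measurable M"
    using x'(2) by measurable
  \<comment> \<open>Membership in the random dead set is a comparison of \<open>X (i, 0)\<close>
    with \<open>L\<close> at the random time, so the random index becomes a measurable case
    distinction.\<close>
  moreover have "residual L X (f w) (D (f w) w) x w =
      (if m = 0 \<and> L (f w) w < X (i, 0) w then X (i, 0) w - L (f w) w else X (i, Suc m) w)" for w
    using x' by (auto simp: residual_def renew_index_def dead_def)
  ultimately show ?thesis by simp
qed

lemma future_at_measurable:
  assumes "f \<in> borel_measurable M" "\<And>w. 0 \<le> f w" "finite J" "J \<subseteq> {1..n} \<times> UNIV" "time_grid v p"
  shows "future_at f J v p b \<in> sets M"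
  unfolding future_at_def using assms
  by (intro sets.sets_Collect_finite_All borel_measurable_less path_comb_random_measurable
      residual_random_measurable) auto

abbreviation "Tk k w \<equiv> grid_time k (T w)"

lemma Tk_measurable: "Tk k \<in> borel_measurable M"
  unfolding grid_time_def by measurable

lemma Tk_nonneg: "0 \<le> Tk k w"
  by (simp add: grid_time_def)

text \<open>The rounded time and the dead set at this time take countably many values, so the weight
  \<open>g\<close> is constant on each piece.\<close>

lemma nn_integral_grid_decomposition:
  fixes g :: "real \<Rightarrow> nat \<Rightarrow> ennreal"
  assumes C: "C \<in> sets M"
  shows "(\<integral>\<^sup>+ w. g (Tk k w) (card (D (Tk k w) w)) * indicator C w \<partial>M) =
    (\<Sum>l. \<Sum>S\<in>Pow {1..n}. g (real (Suc l) / real (Suc k)) (card S) *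
      emeasure M ({w \<in> space M. grid_index k (T w) = Suc l \<and> D (real (Suc l) / real (Suc k)) w = S} \<inter> C))"
proof -
  let ?t = "\<lambda>l. real (Suc l) / real (Suc k)"
  let ?E = "\<lambda>l S. {w \<in> space M. grid_index k (T w) = Suc l \<and> D (?t l) w = S}"
  have E: "?E l S \<inter> C \<in> sets M" for l S
  proof -
    have "0 \<le> ?t l" by simp
    then have "?E l S \<in> sets M" by measurable
    then show ?thesis using C by auto
  qed
  have "(\<integral>\<^sup>+ w. g (Tk k w) (card (D (Tk k w) w)) * indicator C w \<partial>M) =
      (\<integral>\<^sup>+ w. (\<Sum>l. \<Sum>S\<in>Pow {1..n}. g (?t l) (card S) * indicator (?E l S \<inter> C) w) \<partial>M)"
  proof (rule nn_integral_cong_AE)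
    show "AE w in M. g (Tk k w) (card (D (Tk k w) w)) * indicator C w =
        (\<Sum>l. \<Sum>S\<in>Pow {1..n}. g (?t l) (card S) * indicator (?E l S \<inter> C) w)"
      using AE_good
    proof eventually_elim
      case (elim w)
      have "grid_index k (T w) \<noteq> 0"
      proof
        assume "grid_index k (T w) = 0"
        then have "T w \<le> 0" using grid_time_bounds(1)[of "T w" k] by (simp add: grid_time_def)
        then show False using elim by simp
      qed
      then obtain l0 where l0: "grid_index k (T w) = Suc l0" by (cases "grid_index k (T w)") auto
      have inner: "(\<Sum>S\<in>Pow {1..n}. g (?t l) (card S) * indicator (?E l S \<inter> C) w) =
          (if l = l0 then g (?t l) (card (D (?t l) w)) * indicator C w else 0)" for l
      proof -
        have "(\<Sum>S\<in>Pow {1..n}. g (?t l) (card S) * indicator (?E l S \<inter> C) w) =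
            (\<Sum>S\<in>Pow {1..n}. if S = D (?t l) w then (if l = l0 then g (?t l) (card S) * indicator C w else 0) else 0)"
          using elim l0 by (intro sum.cong) (auto simp: indicator_def)
        also have "\<dots> = (if l = l0 then g (?t l) (card (D (?t l) w)) * indicator C w else 0)"
          using dead_subset[of L X n "?t l" w] by (subst sum.delta) simp_all
        finally show ?thesis .
      qed
      have "(\<Sum>l. \<Sum>S\<in>Pow {1..n}. g (?t l) (card S) * indicator (?E l S \<inter> C) w) =
          (\<Sum>l\<in>{l0}. if l = l0 then g (?t l) (card (D (?t l) w)) * indicator C w else 0)"
        unfolding inner by (rule suminf_finite) auto
      also have "\<dots> = g (?t l0) (card (D (?t l0) w)) * indicator C w"
        by (simp only: sum.insert finite.emptyI sum.empty empty_iff not_False_eq_True simp_thms if_True add_0_right)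
      finally show ?case by (simp only: grid_time_def l0)
    qed
  qed
  also have "\<dots> = (\<Sum>l. \<integral>\<^sup>+ w. (\<Sum>S\<in>Pow {1..n}. g (?t l) (card S) * indicator (?E l S \<inter> C) w) \<partial>M)"
  proof (rule nn_integral_suminf)
    note [measurable] = E
    show "(\<lambda>w. \<Sum>S\<in>Pow {1..n}. g (?t l) (card S) * indicator (?E l S \<inter> C) w) \<in> borel_measurable M" for l
      by measurable
  qed
  also have "\<dots> = (\<Sum>l. \<Sum>S\<in>Pow {1..n}. g (?t l) (card S) * emeasure M (?E l S \<inter> C))"
  proof (intro arg_cong[where f = suminf] ext)
    fix l
    have "(\<integral>\<^sup>+ w. (\<Sum>S\<in>Pow {1..n}. g (?t l) (card S) * indicator (?E l S \<inter> C) w) \<partial>M) =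
        (\<Sum>S\<in>Pow {1..n}. \<integral>\<^sup>+ w. g (?t l) (card S) * indicator (?E l S \<inter> C) w \<partial>M)"
    proof (rule nn_integral_sum)
      note [measurable] = E
      show "(\<lambda>w. g (?t l) (card S) * indicator (?E l S \<inter> C) w) \<in> borel_measurable M" for S
        by measurable
    qed
    also have "\<dots> = (\<Sum>S\<in>Pow {1..n}. g (?t l) (card S) * emeasure M (?E l S \<inter> C))"
      by (intro sum.cong refl nn_integral_cmult_indicator E)
    finally show "(\<integral>\<^sup>+ w. (\<Sum>S\<in>Pow {1..n}. g (?t l) (card S) * indicator (?E l S \<inter> C) w) \<partial>M) =
        (\<Sum>S\<in>Pow {1..n}. g (?t l) (card S) * emeasure M (?E l S \<inter> C))" .
  qed
  finally show ?thesis .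
qed

text \<open>On a piece with given rounded time and dead set, the future at the random time is the
  one at a fixed time. The piece itself is almost surely an event about the dead sets at two fixed
  times, so the Markov property at fixed times applies.\<close>

lemma measure_grid_event_future:
  assumes S: "S \<subseteq> {1..n}" and J: "finite J" "J \<subseteq> {1..n} \<times> UNIV" and v: "time_grid v p" and b: "\<And>x j. 0 \<le> b x j"
  shows "measure M ({w \<in> space M. grid_index k (T w) = Suc l \<and> D (real (Suc l) / real (Suc k)) w = S} \<inter> future_at (Tk k) J v p b) =
    measure M {w \<in> space M. grid_index k (T w) = Suc l \<and> D (real (Suc l) / real (Suc k)) w = S} *
      exp (- psi_comb \<Psi> v p (\<lambda>j. \<Sum>x\<in>J. b x j))"
proof -
  let ?t = "\<lambda>l. real l / real (Suc k)"
  have t: "0 \<le> ?t l" "?t l \<le> ?t (Suc l)" "0 \<le> ?t (Suc l)" by (simp_all add: divide_right_mono del: of_nat_Suc)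
  let ?E = "{w \<in> space M. grid_index k (T w) = Suc l \<and> D (?t (Suc l)) w = S}"
  let ?E' = "{w \<in> space M. (card (D (?t l) w) < q \<and> q \<le> card S) \<and> D (?t (Suc l)) w = S}"
  let ?F = "future_at (Tk k) J v p b" and ?F' = "future (?t (Suc l)) S J v p b"
  have E: "?E \<in> sets M" using t by measurable
  have E': "?E' \<in> sets M" using t by measurable
  have F: "?F \<in> sets M" by (intro future_at_measurable Tk_measurable Tk_nonneg J v)
  have F': "?F' \<in> sets M" using t by (intro future_measurable J v)
  have "AE w in M. w \<in> ?E \<longleftrightarrow> w \<in> ?E'"
    using AE_good
  proof eventually_elim
    case (elim w)
    then show ?case using grid_index_passage_iff[of w k l] by auto
  qed
  then have "measure M ?E = measure M ?E'" "measure M (?E \<inter> ?F) = measure M (?E' \<inter> ?F)"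
    using E E' F by (auto intro!: measure_eq_AE elim: AE_mp)
  moreover have "measure M (?E \<inter> ?F) = measure M (?E \<inter> ?F')"
  proof -
    have "?E \<inter> ?F = ?E \<inter> ?F'" by (auto simp: future_at_def future_def grid_time_def)
    then show ?thesis by (rule arg_cong)
  qed
  moreover have "measure M (?E \<inter> ?F') = measure M (?E' \<inter> ?F')"
    using \<open>AE w in M. w \<in> ?E \<longleftrightarrow> w \<in> ?E'\<close> E E' F' by (auto intro!: measure_eq_AE elim: AE_mp)
  moreover have "measure M (?E' \<inter> ?F') = measure M ?E' * exp (- psi_comb \<Psi> v p (\<lambda>j. \<Sum>x\<in>J. b x j))"
    by (rule measure_dead_pred_future[OF t(1,2) S J v b, where R = "\<lambda>A. card A < q \<and> q \<le> card S"])
  ultimately show ?thesis by simp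
qed

lemma nn_integral_grid_future:
  fixes g :: "real \<Rightarrow> nat \<Rightarrow> ennreal"
  assumes J: "finite J" "J \<subseteq> {1..n} \<times> UNIV" and v: "time_grid v p" and b: "\<And>x j. 0 \<le> b x j"
  shows "(\<integral>\<^sup>+ w. g (Tk k w) (card (D (Tk k w) w)) * indicator (future_at (Tk k) J v p b) w \<partial>M) =
    ennreal (exp (- psi_comb \<Psi> v p (\<lambda>j. \<Sum>x\<in>J. b x j))) * (\<integral>\<^sup>+ w. g (Tk k w) (card (D (Tk k w) w)) \<partial>M)"
    (is "_ = ennreal ?V * _")
proof -
  let ?t = "\<lambda>l. real (Suc l) / real (Suc k)"
  let ?E = "\<lambda>l S. {w \<in> space M. grid_index k (T w) = Suc l \<and> D (?t l) w = S}"
  have F: "future_at (Tk k) J v p b \<in> sets M" by (intro future_at_measurable Tk_measurable Tk_nonneg J v)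
  have "(\<integral>\<^sup>+ w. g (Tk k w) (card (D (Tk k w) w)) \<partial>M) =
      (\<integral>\<^sup>+ w. g (Tk k w) (card (D (Tk k w) w)) * indicator (space M) w \<partial>M)"
    by (intro nn_integral_cong) simp
  also have "\<dots> = (\<Sum>l. \<Sum>S\<in>Pow {1..n}. g (?t l) (card S) * emeasure M (?E l S \<inter> space M))"
    by (rule nn_integral_grid_decomposition) simp
  finally have "ennreal ?V * (\<integral>\<^sup>+ w. g (Tk k w) (card (D (Tk k w) w)) \<partial>M) =
      (\<Sum>l. \<Sum>S\<in>Pow {1..n}. g (?t l) (card S) * (ennreal ?V * emeasure M (?E l S \<inter> space M)))"
    by (simp add: ennreal_suminf_cmult[symmetric] sum_distrib_left mult.left_commute del: of_nat_Suc)
  also have "\<dots> = (\<Sum>l. \<Sum>S\<in>Pow {1..n}. g (?t l) (card S) * emeasure M (?E l S \<inter> future_at (Tk k) J v p b))"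
  proof (intro arg_cong[where f = suminf] ext sum.cong refl arg_cong2[where f = "(*)"])
    fix l S assume "S \<in> Pow {1..n}"
    then have S: "S \<subseteq> {1..n}" by simp
    have "?E l S \<inter> space M = ?E l S" by auto
    then show "ennreal ?V * emeasure M (?E l S \<inter> space M) = emeasure M (?E l S \<inter> future_at (Tk k) J v p b)"
      using measure_grid_event_future[OF S J v b, of k l]
      by (simp add: emeasure_eq_measure ennreal_mult'' mult.commute)
  qed
  also have "\<dots> = (\<integral>\<^sup>+ w. g (Tk k w) (card (D (Tk k w) w)) * indicator (future_at (Tk k) J v p b) w \<partial>M)"
    by (rule nn_integral_grid_decomposition[OF F, symmetric])
  finally show ?thesis by simp
qed

lemma measure_future_at_grid:
  assumes J: "finite J" "J \<subseteq> {1..n} \<times> UNIV" and v: "time_grid v p" and b: "\<And>x j. 0 \<le> b x j"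
  shows "measure M (future_at (Tk k) J v p b) = mass * exp (- psi_comb \<Psi> v p (\<lambda>j. \<Sum>x\<in>J. b x j))"
proof -
  have F: "future_at (Tk k) J v p b \<in> sets M" by (intro future_at_measurable Tk_measurable Tk_nonneg J v)
  have "emeasure M (future_at (Tk k) J v p b) =
      ennreal (exp (- psi_comb \<Psi> v p (\<lambda>j. \<Sum>x\<in>J. b x j))) * emeasure M (space M)"
    using nn_integral_grid_future[where b = b and g = "\<lambda>_ _. 1" and k = k, OF J v b] F by simp
  then have "ennreal (measure M (future_at (Tk k) J v p b)) =
      ennreal (mass * exp (- psi_comb \<Psi> v p (\<lambda>j. \<Sum>x\<in>J. b x j)))"
    by (simp add: emeasure_eq_measure ennreal_mult'' mult.commute)
  then show ?thesis by (subst (asm) ennreal_inj) auto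
qed

lemma path_comb_grid_tendsto:
  assumes w: "w \<in> space M" and v: "time_grid v p"
  shows "(\<lambda>k. path_comb (shifted_path L (Tk k w)) v p c w) \<longlonglongrightarrow> path_comb (shifted_path L (T w)) v p c w"
proof -
  have "(\<lambda>k. L (Tk k w + t) w) \<longlonglongrightarrow> L (T w + t) w" if "0 \<le> t" for t
    using that by (intro L_seq_tendsto[OF w] add_right_mono grid_time_bounds tendsto_add grid_time_tendsto tendsto_const) auto
  then show ?thesis
    unfolding path_comb_shifted using time_grid_nonneg[OF v]
    by (intro tendsto_sum tendsto_mult tendsto_const tendsto_diff) auto
qed

lemma residual_grid_tendsto:
  assumes w: "w \<in> space M"
  shows "(\<lambda>k. residual L X (Tk k w) (D (Tk k w) w) x w) \<longlonglongrightarrow> residual L X (T w) (D (T w) w) x w"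
proof -
  have L: "(\<lambda>k. L (Tk k w) w) \<longlonglongrightarrow> L (T w) w"
    by (intro L_seq_tendsto[OF w] grid_time_bounds grid_time_tendsto) auto
  have "(\<lambda>k. residual L X (Tk k w) (D (T w) w) x w) \<longlonglongrightarrow> residual L X (T w) (D (T w) w) x w"
    unfolding residual_def using L by (cases "snd x = 0 \<and> fst x \<notin> D (T w) w") (auto intro!: tendsto_intros)
  moreover have "eventually (\<lambda>k. D (Tk k w) w = D (T w) w) sequentially"
    by (intro eventually_dead_eq[OF w] grid_time_bounds grid_time_tendsto) auto
  then have "eventually (\<lambda>k. residual L X (Tk k w) (D (T w) w) x w = residual L X (Tk k w) (D (Tk k w) w) x w) sequentially"
    by eventually_elim simp
  ultimately show ?thesis by (rule Lim_transform_eventually)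
qed

lemma AE_residual_pos: "AE w in M. \<forall>x\<in>{1..n} \<times> UNIV. 0 < residual L X (T w) (D (T w) w) x w"
  using AE_good
proof eventually_elim
  case (elim w)
  show ?case
  proof
    fix x :: "nat \<times> nat" assume "x \<in> {1..n} \<times> UNIV"
    then obtain i m where x: "x = (i, m)" "i \<in> {1..n}" by auto
    have "(i, Suc m) \<in> {1..n} \<times> UNIV" using x by simp
    then have "0 < X (i, Suc m) w" using elim by blast
    then show "0 < residual L X (T w) (D (T w) w) x w"
      using x by (auto simp: residual_def renew_index_def dead_def not_le)
  qed
qed

lemma path_comb_shifted_nonneg:
  assumes "w \<in> space M" "0 \<le> s" "time_grid v p" "\<And>j. 0 \<le> c j"
  shows "0 \<le> path_comb (shifted_path L s) v p c w"
proof -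
  have "L (s + v j) w \<le> L (s + v (Suc j)) w" if "j < p" for j
    using that assms time_grid_nonneg[OF assms(3), of j] by (intro L_mono) (auto simp: time_grid_def)
  then show ?thesis
    unfolding path_comb_shifted using assms(4) by (intro sum_nonneg mult_nonneg_nonneg) auto
qed

lemma path_comb_scale: "path_comb K v p (\<lambda>j. c * b j) w = c * path_comb K v p b w"
  by (simp add: path_comb_def sum_distrib_left mult.assoc)

text \<open>The law is known at rounded times only. A tie at \<open>T\<close> is eventually
  captured, at the rounded times, by the gap between scaling with \<open>c < 1\<close> and with
  \<open>d > 1\<close>, and this gap has measure \<open>mass * V c - mass * V d\<close> for every
  \<open>k\<close>.\<close>

lemma AE_no_tie:
  assumes x: "x \<in> {1..n} \<times> UNIV" and v: "time_grid v p" and b: "\<And>j. 0 \<le> b j"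
  shows "AE w in M. path_comb (shifted_path L (T w)) v p b w \<noteq> residual L X (T w) (D (T w) w) x w"
proof -
  define B where "B = {w \<in> space M. 0 < residual L X (T w) (D (T w) w) x w \<and>
    path_comb (shifted_path L (T w)) v p b w = residual L X (T w) (D (T w) w) x w}"
  have T: "passage_time L X n q \<in> borel_measurable M" by (rule passage_time_measurable)
  note m1 = residual_random_measurable[OF T passage_time_nonneg x]
  note m2 = path_comb_random_measurable[OF T passage_time_nonneg v]
  have B: "B \<in> sets M" unfolding B_def using m1 m2 by measurable
  define V where "V c = exp (- psi_comb \<Psi> v p (\<lambda>j. c * b j))" for c
  define A where "A c k = future_at (Tk k) {x} v p (\<lambda>_ j. c * b j)" for c k
  have A: "A c k \<in> sets M" for c k
    unfolding A_def using x by (intro future_at_measurable Tk_measurable Tk_nonneg v) auto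
  have mA: "measure M (A c k) = mass * V c" if "0 \<le> c" for c k
    using measure_future_at_grid[of "{x}" v p "\<lambda>_ j. c * b j" k] x v b that by (simp add: A_def V_def)
  have bound: "measure M B \<le> mass * V c - mass * V d" if c: "0 \<le> c" "c < 1" and d: "1 < d" for c d
  proof (rule LIMSEQ_le_const2)
    show "(\<lambda>k. measure M (B \<inter> (A c k - A d k))) \<longlonglongrightarrow> measure M B"
    proof (rule measure_tendsto_of_eventually_eq)
      show "AE w in M. eventually (\<lambda>k. (w \<in> B \<inter> (A c k - A d k)) = (w \<in> B)) sequentially"
      proof (rule AE_I2)
        fix w assume w: "w \<in> space M"
        show "eventually (\<lambda>k. (w \<in> B \<inter> (A c k - A d k)) = (w \<in> B)) sequentially"
        proof (cases "w \<in> B")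
          case True
          let ?Y = "\<lambda>k. path_comb (shifted_path L (Tk k w)) v p b w" and ?R = "\<lambda>k. residual L X (Tk k w) (D (Tk k w) w) x w"
          let ?y = "path_comb (shifted_path L (T w)) v p b w"
          have Y: "?Y \<longlonglongrightarrow> ?y" by (rule path_comb_grid_tendsto[OF w v])
          have R: "?R \<longlonglongrightarrow> ?y" using residual_grid_tendsto[OF w, of x] True by (simp add: B_def)
          \<comment> \<open>Positivity of the tied value makes both scaled inequalities strict in
            the limit, hence true at late rounded times.\<close>
          have y: "0 < ?y" using True by (simp add: B_def)
          have "(\<lambda>k. ?R k - c * ?Y k) \<longlonglongrightarrow> ?y - c * ?y" "(\<lambda>k. d * ?Y k - ?R k) \<longlonglongrightarrow> d * ?y - ?y"
            using Y R by (auto intro!: tendsto_intros)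
          moreover have "0 < ?y - c * ?y" "0 < d * ?y - ?y" using y c d by (simp_all)
          ultimately have "eventually (\<lambda>k. 0 < ?R k - c * ?Y k) sequentially" "eventually (\<lambda>k. 0 < d * ?Y k - ?R k) sequentially"
            by (blast dest: order_tendstoD(1))+
          then show ?thesis
            by eventually_elim (use True w in \<open>auto simp: A_def future_at_def path_comb_scale\<close>)
        qed simp
      qed
    qed (use A B in auto)
    have "measure M (B \<inter> (A c k - A d k)) \<le> mass * V c - mass * V d" for k
    proof -
      have "A d k \<subseteq> A c k"
      proof
        fix w assume w: "w \<in> A d k"
        then have "0 \<le> path_comb (shifted_path L (Tk k w)) v p b w"
          using b v by (intro path_comb_shifted_nonneg Tk_nonneg) (auto simp: A_def future_at_def)
        then have "c * path_comb (shifted_path L (Tk k w)) v p b w \<le> d * path_comb (shifted_path L (Tk k w)) v p b w"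
          using c d by (intro mult_right_mono) auto
        then show "w \<in> A c k" using w by (auto simp: A_def future_at_def path_comb_scale)
      qed
      then have "measure M (A c k - A d k) = mass * V c - mass * V d"
        using c d by (subst finite_measure_Diff[OF A A]) (auto simp: mA)
      moreover have "measure M (B \<inter> (A c k - A d k)) \<le> measure M (A c k - A d k)"
        using A by (intro finite_measure_mono) auto
      ultimately show ?thesis by simp
    qed
    then show "\<exists>N. \<forall>k\<ge>N. measure M (B \<inter> (A c k - A d k)) \<le> mass * V c - mass * V d" by blast
  qed
  have "continuous_on {0..} (\<lambda>c. mass * V c)"
    unfolding V_def psi_comb_def using b
    by (intro continuous_intros continuous_on_compose2[OF \<Psi>_continuous]) auto
  with B bound have "AE w in M. w \<notin> B" by (rule AE_not_in_of_squeeze)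
  then show ?thesis
    using AE_residual_pos AE_space by eventually_elim (use x in \<open>auto simp: B_def\<close>)
qed

text \<open>Dominated convergence from rounded times. In the absence of ties the future events agree
  eventually, and so do the dead sets, hence the values of \<open>\<psi>\<close>.\<close>

lemma nn_integral_future_at_passage:
  assumes J: "finite J" "J \<subseteq> {1..n} \<times> UNIV" and v: "time_grid v p" and b: "\<And>x j. 0 \<le> b x j"
    and th: "th < \<Psi> 1" and \<psi>: "\<And>j. 0 \<le> \<psi> j"
  shows "(\<integral>\<^sup>+ w. ennreal (exp (th * T w) * \<psi> (N w)) * indicator (future_at T J v p b) w \<partial>M) =
    ennreal (exp (- psi_comb \<Psi> v p (\<lambda>j. \<Sum>x\<in>J. b x j))) * (\<integral>\<^sup>+ w. ennreal (exp (th * T w) * \<psi> (N w)) \<partial>M)"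
proof -
  define g where "g t j = ennreal (exp (th * t) * \<psi> j)" for t :: real and j :: nat
  define th' where "th' = max th 0"
  have th': "0 \<le> th'" "th \<le> th'" "th' < \<Psi> 1" using th \<Psi>_pos[of 1] by (auto simp: th'_def)
  \<comment> \<open>Rounding adds at most 1 to the time, which costs the factor
    \<open>exp th'\<close>; the weights \<open>\<psi> j\<close> with \<open>j \<le> n\<close> are
    bounded by their sum.\<close>
  define C where "C = exp th' * (\<Sum>j\<le>n. \<psi> j)"
  have C: "0 \<le> C" using \<psi> by (auto simp: C_def intro!: mult_nonneg_nonneg sum_nonneg)
  have Dk: "(\<lambda>w. D (Tk k w) w) \<in> measurable M (count_space UNIV)" for k by (rule grid_dead_measurable)
  have gk: "(\<lambda>w. g (Tk k w) (card (D (Tk k w) w))) \<in> borel_measurable M" for k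
  proof -
    note [measurable] = Dk[of k] Tk_measurable[of k]
    show ?thesis unfolding g_def by measurable
  qed
  have g: "(\<lambda>w. g (T w) (N w)) \<in> borel_measurable M" unfolding g_def by measurable
  \<comment> \<open>Stated for all \<open>J\<close> because the case \<open>J = {}\<close> supplies
    the limit of the normalizing integral.\<close>
  have lim: "(\<lambda>k. \<integral>\<^sup>+ w. g (Tk k w) (card (D (Tk k w) w)) * indicator (future_at (Tk k) J v p b) w \<partial>M) \<longlonglongrightarrow>
      (\<integral>\<^sup>+ w. g (T w) (N w) * indicator (future_at T J v p b) w \<partial>M)"
    if J: "finite J" "J \<subseteq> {1..n} \<times> UNIV" for J
  proof (rule nn_integral_dominated_convergence)
    have Fk: "future_at (Tk k) J v p b \<in> sets M" for k by (intro future_at_measurable Tk_measurable Tk_nonneg J v)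
    have F: "future_at T J v p b \<in> sets M" by (intro future_at_measurable passage_time_measurable passage_time_nonneg J v)
    show "(\<lambda>w. g (Tk k w) (card (D (Tk k w) w)) * indicator (future_at (Tk k) J v p b) w) \<in> borel_measurable M" for k
    proof -
      note [measurable] = gk[of k] Fk[of k]
      show ?thesis by measurable
    qed
    show "(\<lambda>w. g (T w) (N w) * indicator (future_at T J v p b) w) \<in> borel_measurable M"
    proof -
      note [measurable] = g F
      show ?thesis by measurable
    qed
    show "(\<lambda>w. ennreal (C * exp (th' * T w))) \<in> borel_measurable M" by measurable
    have "(\<integral>\<^sup>+ w. ennreal (C * exp (th' * T w)) \<partial>M) = ennreal C * (\<integral>\<^sup>+ w. ennreal (exp (th' * T w)) \<partial>M)"
      using C by (subst nn_integral_cmult[symmetric]) (auto simp: ennreal_mult)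
    then show "(\<integral>\<^sup>+ w. ennreal (C * exp (th' * T w)) \<partial>M) < \<infinity>"
      using nn_integral_exp_passage_time_finite[OF th'(3)] by (simp add: ennreal_mult_less_top)
    show "AE w in M. g (Tk k w) (card (D (Tk k w) w)) * indicator (future_at (Tk k) J v p b) w \<le> ennreal (C * exp (th' * T w))" for k
    proof (rule AE_I2)
      fix w
      have "th * Tk k w \<le> th' * Tk k w" using th' Tk_nonneg by (intro mult_right_mono) auto
      also have "\<dots> \<le> th' * (T w + 1)" using th' grid_time_bounds(3)[of "T w" k] by (intro mult_left_mono) auto
      finally have "exp (th * Tk k w) \<le> exp th' * exp (th' * T w)"
        by (simp add: exp_add[symmetric] distrib_left)
      moreover have "\<psi> (card (D (Tk k w) w)) \<le> (\<Sum>j\<le>n. \<psi> j)"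
        using \<psi> card_dead_le by (intro member_le_sum) auto
      ultimately have "exp (th * Tk k w) * \<psi> (card (D (Tk k w) w)) \<le> exp th' * exp (th' * T w) * (\<Sum>j\<le>n. \<psi> j)"
        using \<psi> by (intro mult_mono) (auto intro: sum_nonneg)
      then have "g (Tk k w) (card (D (Tk k w) w)) \<le> ennreal (C * exp (th' * T w))"
        unfolding g_def C_def by (intro ennreal_leI) (simp only: mult_ac)
      then show "g (Tk k w) (card (D (Tk k w) w)) * indicator (future_at (Tk k) J v p b) w \<le> ennreal (C * exp (th' * T w))"
        by (auto simp: indicator_def)
    qed
    have "AE w in M. \<forall>x\<in>J. path_comb (shifted_path L (T w)) v p (b x) w \<noteq> residual L X (T w) (D (T w) w) x w"
      using J b v by (intro AE_finite_allI AE_no_tie) auto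
    then show "AE w in M. (\<lambda>k. g (Tk k w) (card (D (Tk k w) w)) * indicator (future_at (Tk k) J v p b) w) \<longlonglongrightarrow>
        g (T w) (N w) * indicator (future_at T J v p b) w"
      using AE_space
    proof eventually_elim
      case (elim w)
      then have w: "w \<in> space M" by simp
      have evD: "eventually (\<lambda>k. D (Tk k w) w = D (T w) w) sequentially"
        by (intro eventually_dead_eq[OF w] grid_time_bounds grid_time_tendsto) auto
      have "eventually (\<lambda>k. \<forall>x\<in>J. path_comb (shifted_path L (Tk k w)) v p (b x) w < residual L X (Tk k w) (D (Tk k w) w) x w \<longleftrightarrow>
          path_comb (shifted_path L (T w)) v p (b x) w < residual L X (T w) (D (T w) w) x w) sequentially"
      proof (intro eventually_ball_finite ballI J(1))
        fix x assume x: "x \<in> J"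
        let ?Y = "\<lambda>k. path_comb (shifted_path L (Tk k w)) v p (b x) w" and ?R = "\<lambda>k. residual L X (Tk k w) (D (Tk k w) w) x w"
        let ?y = "path_comb (shifted_path L (T w)) v p (b x) w" and ?r = "residual L X (T w) (D (T w) w) x w"
        have l: "(\<lambda>k. ?R k - ?Y k) \<longlonglongrightarrow> ?r - ?y"
          by (intro tendsto_diff residual_grid_tendsto[OF w] path_comb_grid_tendsto[OF w v])
        have "?y \<noteq> ?r" using elim x by blast
        then consider "?y < ?r" | "?r < ?y" by linarith
        then show "eventually (\<lambda>k. ?Y k < ?R k \<longleftrightarrow> ?y < ?r) sequentially"
        proof cases
          case 1
          then have "eventually (\<lambda>k. 0 < ?R k - ?Y k) sequentially" using l by (intro order_tendstoD) auto
          then show ?thesis by eventually_elim (use 1 in simp)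
        next
          case 2
          then have "eventually (\<lambda>k. ?R k - ?Y k < 0) sequentially" using l by (intro order_tendstoD) auto
          then show ?thesis by eventually_elim (use 2 in simp)
        qed
      qed
      then have "eventually (\<lambda>k. (indicator (future_at (Tk k) J v p b) w :: real) = indicator (future_at T J v p b) w) sequentially"
        by eventually_elim (auto simp: indicator_def future_at_def)
      then have ind: "(\<lambda>k. indicator (future_at (Tk k) J v p b) w :: real) \<longlonglongrightarrow> indicator (future_at T J v p b) w"
        by (rule tendsto_eventually)
      have "eventually (\<lambda>k. \<psi> (card (D (Tk k w) w)) = \<psi> (N w)) sequentially"
        using evD by eventually_elim (simp add: passage_count_def)
      then have "(\<lambda>k. \<psi> (card (D (Tk k w) w))) \<longlonglongrightarrow> \<psi> (N w)" by (rule tendsto_eventually)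
      then have "(\<lambda>k. ennreal (exp (th * Tk k w) * \<psi> (card (D (Tk k w) w)) * indicator (future_at (Tk k) J v p b) w)) \<longlonglongrightarrow>
          ennreal (exp (th * T w) * \<psi> (N w) * indicator (future_at T J v p b) w)"
        by (intro tendsto_ennrealI tendsto_mult ind tendsto_exp tendsto_const grid_time_tendsto) auto
      moreover have "ennreal (a * indicator F w) = ennreal a * indicator F w" for a and F :: "'a set"
        by (simp add: indicator_def)
      ultimately show ?case unfolding g_def by simp
    qed
  qed
  have all: "future_at f {} v p b = space M" for f by (auto simp: future_at_def)
  have triv: "(\<integral>\<^sup>+ w. h w * indicator (space M) w \<partial>M) = (\<integral>\<^sup>+ w. h w \<partial>M)" for h :: "'a \<Rightarrow> ennreal"
    by (intro nn_integral_cong) simp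
  have "(\<lambda>k. \<integral>\<^sup>+ w. g (Tk k w) (card (D (Tk k w) w)) \<partial>M) \<longlonglongrightarrow> (\<integral>\<^sup>+ w. g (T w) (N w) \<partial>M)"
    using lim[of "{}"] unfolding all triv by simp
  then have "(\<lambda>k. ennreal (exp (- psi_comb \<Psi> v p (\<lambda>j. \<Sum>x\<in>J. b x j))) * (\<integral>\<^sup>+ w. g (Tk k w) (card (D (Tk k w) w)) \<partial>M)) \<longlonglongrightarrow>
      ennreal (exp (- psi_comb \<Psi> v p (\<lambda>j. \<Sum>x\<in>J. b x j))) * (\<integral>\<^sup>+ w. g (T w) (N w) \<partial>M)"
    by (intro ennreal_tendsto_cmult) auto
  with lim[OF J] show ?thesis
    unfolding nn_integral_grid_future[where b = b, OF J v b] unfolding g_def by (rule LIMSEQ_unique)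
qed

end

context repair_system
begin

text \<open>The survival axiom for the restarted data is the preceding factorization, read under the
  weighted measure. The weight is a function of the completed cycle, so keeping it in the measure
  expresses independence of the later cycles from this one.\<close>

theorem restart:
  assumes th: "th < \<Psi> 1" and \<psi>: "\<And>j. 0 \<le> \<psi> j"
  shows "repair_system (density M (\<lambda>w. ennreal (exp (th * T w) * \<psi> (N w))))
    (restart_path L X n q) (restart_threshold L X n q) n q \<Psi>"
proof -
  define f where "f w = ennreal (exp (th * T w) * \<psi> (N w))" for w
  have f[measurable]: "f \<in> borel_measurable M" unfolding f_def[abs_def] by measurable
  define M' where "M' = density M f"
  have sp: "space M' = space M" and st: "sets M' = sets M" by (simp_all add: M'_def)
  have finite: "(\<integral>\<^sup>+ w. f w \<partial>M) < \<infinity>"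
  proof -
    have "(\<integral>\<^sup>+ w. f w \<partial>M) \<le> (\<integral>\<^sup>+ w. ennreal (\<Sum>j\<le>n. \<psi> j) * ennreal (exp (th * T w)) \<partial>M)"
    proof (rule nn_integral_mono)
      fix w
      have "\<psi> (N w) \<le> (\<Sum>j\<le>n. \<psi> j)"
        using \<psi> card_dead_le by (intro member_le_sum) (auto simp: passage_count_def)
      then have "exp (th * T w) * \<psi> (N w) \<le> (\<Sum>j\<le>n. \<psi> j) * exp (th * T w)"
        by (simp add: mult.commute)
      then show "f w \<le> ennreal (\<Sum>j\<le>n. \<psi> j) * ennreal (exp (th * T w))"
        unfolding f_def using \<psi> by (subst ennreal_mult[symmetric]) (auto intro: ennreal_leI sum_nonneg)
    qed
    also have "\<dots> = ennreal (\<Sum>j\<le>n. \<psi> j) * (\<integral>\<^sup>+ w. ennreal (exp (th * T w)) \<partial>M)"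
      by (rule nn_integral_cmult) measurable
    also have "\<dots> < \<infinity>"
      using nn_integral_exp_passage_time_finite[OF th] by (simp add: ennreal_mult_less_top)
    finally show ?thesis .
  qed
  have em: "emeasure M' A = (\<integral>\<^sup>+ w. f w * indicator A w \<partial>M)" if "A \<in> sets M" for A
    unfolding M'_def using that by (intro emeasure_density) auto
  have em_space: "emeasure M' (space M) = (\<integral>\<^sup>+ w. f w \<partial>M)"
    by (subst em) (auto intro!: nn_integral_cong)
  interpret F: finite_measure M'
    using finite by (intro finite_measureI) (simp add: sp em_space)
  have "repair_system M' (restart_path L X n q) (restart_threshold L X n q) n q \<Psi>"
  proof (intro repair_system.intro frailty_system.intro frailty_system_axioms.intro)
    show "finite_measure M'" by unfold_locales
    show "1 \<le> q" "q \<le> n" by (rule q)+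
    show "{1..n} \<times> {0} \<subseteq> {1..n} \<times> (UNIV :: nat set)" by auto
    show "\<Psi> 0 = 0" by (rule \<Psi>_zero)
    show "0 < \<Psi> x" if "0 < x" for x by (rule \<Psi>_pos[OF that])
    show "continuous_on {0..} \<Psi>" by (rule \<Psi>_continuous)
    show "restart_path L X n q t \<in> borel_measurable M'" if "0 \<le> t" for t
    proof -
      have "restart_path L X n q t \<in> borel_measurable M"
        unfolding restart_path_def[abs_def] using that
        by (intro shifted_path_random_measurable passage_time_measurable passage_time_nonneg)
      then show ?thesis by (simp add: M'_def)
    qed
    show "restart_threshold L X n q x \<in> borel_measurable M'" if "x \<in> {1..n} \<times> UNIV" for x
    proof -
      have "restart_threshold L X n q x \<in> borel_measurable M"
        unfolding restart_threshold_def[abs_def] using that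
        by (intro residual_random_measurable passage_time_measurable passage_time_nonneg)
      then show ?thesis by (simp add: M'_def)
    qed
    show "restart_path L X n q 0 w = 0" for w by (simp add: restart_path_def shifted_path_def)
    show "restart_path L X n q s w \<le> restart_path L X n q t w" if "w \<in> space M'" "0 \<le> s" "s \<le> t" for w s t
      using that by (simp add: restart_path_def shifted_path_def L_mono sp)
    show "continuous (at_right t) (\<lambda>s. restart_path L X n q s w)" if "w \<in> space M'" "0 \<le> t" for w t
    proof -
      have "((\<lambda>s. L s w) \<longlongrightarrow> L (T w + t) w) (at_right (T w + t))"
        using L_right_continuous[of w "T w + t"] that by (simp add: continuous_within sp)
      moreover have "filterlim (\<lambda>s. T w + s) (at_right (T w + t)) (at_right t)"
        unfolding filterlim_at
        by (auto intro!: tendsto_intros simp: eventually_at_filter)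
      ultimately have "((\<lambda>s. L (T w + s) w) \<longlongrightarrow> L (T w + t) w) (at_right t)"
        by (rule filterlim_compose)
      then show ?thesis
        unfolding continuous_within restart_path_def shifted_path_def by (intro tendsto_diff tendsto_const)
    qed
    fix J :: "(nat \<times> nat) set" and u :: "nat \<Rightarrow> real" and p and b :: "nat \<times> nat \<Rightarrow> nat \<Rightarrow> real"
    assume J: "finite J" "J \<subseteq> {1..n} \<times> UNIV" and u: "time_grid u p" and b: "\<And>x j. 0 \<le> b x j"
    have eq: "{w \<in> space M'. \<forall>x\<in>J. path_comb (restart_path L X n q) u p (b x) w < restart_threshold L X n q x w} =
        future_at T J u p b"
      by (simp add: future_at_def restart_path_def restart_threshold_def path_comb_def sp)
    have "future_at T J u p b \<in> sets M"
      by (intro future_at_measurable passage_time_measurable passage_time_nonneg J u)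
    then have "emeasure M' (future_at T J u p b) =
        ennreal (exp (- psi_comb \<Psi> u p (\<lambda>j. \<Sum>x\<in>J. b x j))) * emeasure M' (space M')"
      using nn_integral_future_at_passage[where b = b, OF J u b th \<psi>] by (simp add: em sp em_space f_def)
    then show "measure M' {w \<in> space M'. \<forall>x\<in>J. path_comb (restart_path L X n q) u p (b x) w < restart_threshold L X n q x w} =
        measure M' (space M') * exp (- psi_comb \<Psi> u p (\<lambda>j. \<Sum>x\<in>J. b x j))"
      unfolding eq measure_def by (simp add: enn2real_mult mult.commute)
  qed
  then show ?thesis unfolding M'_def f_def[abs_def] .
qed

section \<open>The laws of the length and of the repair size of a cycle\<close>

lemma emeasure_passage_time_greater:
  "emeasure M {w \<in> space M. x < T w} = ennreal mass * ennreal (if x < 0 then 1 else order_tail \<Psi> n q x)"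
proof (cases "x < 0")
  case True
  then have "{w \<in> space M. x < T w} = space M" using passage_time_nonneg by (auto intro: order.strict_trans2)
  then show ?thesis using True by (simp add: emeasure_eq_measure)
next
  case False
  have "emeasure M {w \<in> space M. x < T w} = emeasure M {w \<in> space M. ennreal x < fp w}"
  proof (rule emeasure_eq_AE)
    show "AE w in M. (w \<in> {w \<in> space M. x < T w}) = (w \<in> {w \<in> space M. ennreal x < fp w})"
      using AE_good by eventually_elim (use False in \<open>auto simp: ennreal_less_iff\<close>)
  qed measurable
  then show ?thesis using emeasure_passage_greater[of x] False by (simp add: ennreal_mult')
qed

lemma nn_integral_passage_count:
  "(\<integral>\<^sup>+ w. ennreal (\<psi> (N w)) \<partial>M) = ennreal mass * (\<Sum>j\<in>{q..n}. ennreal (\<psi> j) * ennreal (F_prob \<Psi> n (q - 1) j))"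
proof -
  have "(\<integral>\<^sup>+ w. ennreal (\<psi> (N w)) \<partial>M) = (\<integral>\<^sup>+ w. (\<Sum>j\<in>{q..n}. ennreal (\<psi> j) * indicator {w \<in> space M. N w = j} w) \<partial>M)"
  proof (rule nn_integral_cong_AE)
    show "AE w in M. ennreal (\<psi> (N w)) = (\<Sum>j\<in>{q..n}. ennreal (\<psi> j) * indicator {w \<in> space M. N w = j} w)"
      using AE_passage_count AE_space
    proof eventually_elim
      case (elim w)
      have "(\<Sum>j\<in>{q..n}. ennreal (\<psi> j) * indicator {w \<in> space M. N w = j} w) =
          (\<Sum>j\<in>{q..n}. if N w = j then ennreal (\<psi> j) else 0)"
        using elim by (intro sum.cong) (auto simp: indicator_def)
      then show ?case using elim by simp
    qed
  qed
  also have "\<dots> = (\<Sum>j\<in>{q..n}. \<integral>\<^sup>+ w. ennreal (\<psi> j) * indicator {w \<in> space M. N w = j} w \<partial>M)"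
    by (rule nn_integral_sum) measurable
  also have "\<dots> = (\<Sum>j\<in>{q..n}. ennreal (\<psi> j) * emeasure M {w \<in> space M. N w = j})"
    by (intro sum.cong refl nn_integral_cmult_indicator) measurable
  also have "\<dots> = (\<Sum>j\<in>{q..n}. ennreal mass * (ennreal (\<psi> j) * ennreal (F_prob \<Psi> n (q - 1) j)))"
    by (intro sum.cong refl) (simp add: emeasure_eq_measure measure_passage_count ennreal_mult' mult.left_commute)
  finally show ?thesis by (simp add: sum_distrib_left)
qed

end

text \<open>The tails of \<open>T\<close> depend on the system through its mass only, and tails
  determine a finite measure on the line. Multiplying crosswise by the masses avoids dividing by a
  mass that may be zero.\<close>

lemma nn_integral_passage_time_proportional:
  fixes f :: "real \<Rightarrow> ennreal"
  assumes R1: "repair_system M1 L1 X1 n q \<Psi>" and R2: "repair_system M2 L2 X2 n q \<Psi>"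
    and f: "f \<in> borel_measurable borel"
  shows "emeasure M2 (space M2) * (\<integral>\<^sup>+ w. f (passage_time L1 X1 n q w) \<partial>M1) =
    emeasure M1 (space M1) * (\<integral>\<^sup>+ w. f (passage_time L2 X2 n q w) \<partial>M2)"
proof -
  interpret A: repair_system M1 L1 X1 n q \<Psi> by (rule R1)
  interpret B: repair_system M2 L2 X2 n q \<Psi> by (rule R2)
  let ?D1 = "distr M1 borel A.T" and ?D2 = "distr M2 borel B.T"
  have e1: "emeasure ?D1 {x<..} = ennreal (measure M1 (space M1)) * ennreal (if x < 0 then 1 else order_tail \<Psi> n q x)" for x
  proof -
    have "A.T -` {x<..} \<inter> space M1 = {w \<in> space M1. x < A.T w}" by auto
    then show ?thesis using A.emeasure_passage_time_greater[of x] by (simp add: emeasure_distr)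
  qed
  have e2: "emeasure ?D2 {x<..} = ennreal (measure M2 (space M2)) * ennreal (if x < 0 then 1 else order_tail \<Psi> n q x)" for x
  proof -
    have "B.T -` {x<..} \<inter> space M2 = {w \<in> space M2. x < B.T w}" by auto
    then show ?thesis using B.emeasure_passage_time_greater[of x] by (simp add: emeasure_distr)
  qed
  have "scale_measure (emeasure M2 (space M2)) ?D1 = scale_measure (emeasure M1 (space M1)) ?D2"
  proof (rule measure_eqI_lessThan)
    fix x :: real
    show "emeasure (scale_measure (emeasure M2 (space M2)) ?D1) {x<..} < \<infinity>"
      by (simp add: e1 A.emeasure_eq_measure B.emeasure_eq_measure ennreal_mult_less_top)
    show "emeasure (scale_measure (emeasure M2 (space M2)) ?D1) {x<..} =
        emeasure (scale_measure (emeasure M1 (space M1)) ?D2) {x<..}"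
      by (simp add: e1 e2 A.emeasure_eq_measure B.emeasure_eq_measure mult_ac)
  qed simp_all
  then have "(\<integral>\<^sup>+ x. f x \<partial>scale_measure (emeasure M2 (space M2)) ?D1) =
      (\<integral>\<^sup>+ x. f x \<partial>scale_measure (emeasure M1 (space M1)) ?D2)" by simp
  then show ?thesis using f by (simp add: nn_integral_scale_measure nn_integral_distr)
qed

section \<open>Independence of the repair cycles\<close>

text \<open>All cycles live on one sample space: restarting is applied outcome by outcome, and only
  the measure will be reweighted.\<close>

fun cycle_system :: "(real \<Rightarrow> 'a \<Rightarrow> real) \<Rightarrow> (nat \<times> nat \<Rightarrow> 'a \<Rightarrow> real) \<Rightarrow> nat \<Rightarrow> nat \<Rightarrow> nat \<Rightarrow>
    (real \<Rightarrow> 'a \<Rightarrow> real) \<times> (nat \<times> nat \<Rightarrow> 'a \<Rightarrow> real)" where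
  "cycle_system L X n q 0 = (L, X)"
| "cycle_system L X n q (Suc m) = (case cycle_system L X n q m of (K, Y) \<Rightarrow>
     (restart_path K Y n q, restart_threshold K Y n q))"

definition cycle_path where "cycle_path L X n q m = fst (cycle_system L X n q m)"
definition cycle_threshold where "cycle_threshold L X n q m = snd (cycle_system L X n q m)"

lemma cycle_0[simp]: "cycle_path L X n q 0 = L" "cycle_threshold L X n q 0 = X"
  by (simp_all add: cycle_path_def cycle_threshold_def)

lemma cycle_Suc:
  "cycle_path L X n q (Suc m) = restart_path (cycle_path L X n q m) (cycle_threshold L X n q m) n q"
  "cycle_threshold L X n q (Suc m) = restart_threshold (cycle_path L X n q m) (cycle_threshold L X n q m) n q"
  by (simp_all add: cycle_path_def cycle_threshold_def split_beta)

definition cycle_length where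
  "cycle_length L X n q m = passage_time (cycle_path L X n q m) (cycle_threshold L X n q m) n q"

definition cycle_count where
  "cycle_count L X n q m = passage_count (cycle_path L X n q m) (cycle_threshold L X n q m) n q"

context repair_system
begin

abbreviation "CT m \<equiv> cycle_length L X n q m"
abbreviation "CN m \<equiv> cycle_count L X n q m"

text \<open>Each restart multiplies the density by the weight of one more cycle. Measurability is
  part of the induction because it comes from the system reached so far.\<close>

lemma cycle_repair_system_weighted:
  assumes th: "th < \<Psi> 1" and \<psi>: "\<And>j. 0 \<le> \<psi> j"
  shows "(\<lambda>w. \<Prod>l<m. ennreal (exp (th * CT l w) * \<psi> (CN l w))) \<in> borel_measurable M \<and>
    repair_system (density M (\<lambda>w. \<Prod>l<m. ennreal (exp (th * CT l w) * \<psi> (CN l w))))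
      (cycle_path L X n q m) (cycle_threshold L X n q m) n q \<Psi>"
proof (induction m)
  case 0
  then show ?case using repair_system_axioms by (simp add: density_1)
next
  case (Suc m)
  let ?f = "\<lambda>w. \<Prod>l<m. ennreal (exp (th * CT l w) * \<psi> (CN l w))"
  let ?g = "\<lambda>w. ennreal (exp (th * CT m w) * \<psi> (CN m w))"
  have f: "?f \<in> borel_measurable M" using Suc by blast
  interpret R: repair_system "density M ?f" "cycle_path L X n q m" "cycle_threshold L X n q m" n q \<Psi>
    using Suc by blast
  have CTm: "CT m = R.T" and CNm: "CN m = R.N" by (simp_all add: cycle_length_def cycle_count_def)
  have "CT m \<in> borel_measurable M" "CN m \<in> measurable M (count_space UNIV)"
    using R.passage_time_measurable R.passage_count_measurable
    unfolding cycle_length_def cycle_count_def by simp_all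
  note [measurable] = this
  have g: "?g \<in> borel_measurable M" by measurable
  have "repair_system (density (density M ?f) ?g) (cycle_path L X n q (Suc m)) (cycle_threshold L X n q (Suc m)) n q \<Psi>"
    unfolding CTm CNm cycle_Suc by (rule R.restart[OF th \<psi>])
  also have "density (density M ?f) ?g = density M (\<lambda>w. ?f w * ?g w)"
    by (rule density_density_eq[OF f g])
  finally show ?case using f g by (simp add: mult.commute)
qed

lemma cycle_repair_system: "repair_system M (cycle_path L X n q m) (cycle_threshold L X n q m) n q \<Psi>"
proof -
  have "(\<lambda>w. \<Prod>l<m. ennreal (exp (0 * CT l w) * (\<lambda>_. 1) (CN l w))) = (\<lambda>_. 1)" by simp
  moreover have "0 < \<Psi> 1" using \<Psi>_pos[of 1] by simp
  ultimately show ?thesis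
    using cycle_repair_system_weighted[of 0 "\<lambda>_. 1" m] by (simp add: density_1)
qed

lemma cycle_measurable[measurable]:
  "CT m \<in> borel_measurable M" "CN m \<in> measurable M (count_space UNIV)"
proof -
  interpret R: repair_system M "cycle_path L X n q m" "cycle_threshold L X n q m" n q \<Psi>
    by (rule cycle_repair_system)
  show "CT m \<in> borel_measurable M" "CN m \<in> measurable M (count_space UNIV)"
    unfolding cycle_length_def cycle_count_def by measurable
qed

text \<open>The last cycle is integrated under the measure weighted by the earlier ones, where it
  contributes \<open>\<kappa>\<close> times the mass. A common \<open>\<kappa>\<close> for all
  systems is available for weights in the length alone or in the count alone, since these two laws
  are known.\<close>

lemma nn_integral_cycle_prod:
  assumes th: "th < \<Psi> 1" and \<psi>: "\<And>j. 0 \<le> \<psi> j"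
    and \<kappa>: "\<And>(M' :: 'a measure) L' X'. repair_system M' L' X' n q \<Psi> \<Longrightarrow>
      (\<integral>\<^sup>+ w. ennreal (exp (th * passage_time L' X' n q w) * \<psi> (passage_count L' X' n q w)) \<partial>M') =
        \<kappa> * emeasure M' (space M')"
  shows "(\<integral>\<^sup>+ w. (\<Prod>l<m. ennreal (exp (th * CT l w) * \<psi> (CN l w))) \<partial>M) = \<kappa> ^ m * emeasure M (space M)"
proof (induction m)
  case (Suc m)
  let ?f = "\<lambda>w. \<Prod>l<m. ennreal (exp (th * CT l w) * \<psi> (CN l w))"
  let ?g = "\<lambda>w. ennreal (exp (th * CT m w) * \<psi> (CN m w))"
  have f: "?f \<in> borel_measurable M" and R: "repair_system (density M ?f) (cycle_path L X n q m) (cycle_threshold L X n q m) n q \<Psi>"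
    using cycle_repair_system_weighted[where m = m and \<psi> = \<psi>, OF th \<psi>] by blast+
  have g: "?g \<in> borel_measurable M" by measurable
  have "(\<integral>\<^sup>+ w. (\<Prod>l<Suc m. ennreal (exp (th * CT l w) * \<psi> (CN l w))) \<partial>M) = (\<integral>\<^sup>+ w. ?f w * ?g w \<partial>M)"
    by (simp add: mult.commute)
  also have "\<dots> = (\<integral>\<^sup>+ w. ?g w \<partial>density M ?f)" by (rule nn_integral_density[OF f g, symmetric])
  also have "\<dots> = \<kappa> * emeasure (density M ?f) (space M)"
    using \<kappa>[OF R] by (simp add: cycle_length_def cycle_count_def)
  also have "emeasure (density M ?f) (space M) = (\<integral>\<^sup>+ w. ?f w * indicator (space M) w \<partial>M)"
    by (rule emeasure_density[OF f]) simp
  also have "\<dots> = (\<integral>\<^sup>+ w. ?f w \<partial>M)" by (intro nn_integral_cong) simp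
  finally show ?case using Suc by (simp add: mult.assoc)
qed simp

text \<open>The mean length of cycle \<open>m\<close> is not affected by weights on the counts of
  earlier cycles. With indicator weights it gives the mean time spent in cycle \<open>m\<close>
  before any system failure.\<close>

lemma nn_integral_weighted_passage:
  assumes \<psi>: "\<And>j. 0 \<le> \<psi> j"
  shows "(\<integral>\<^sup>+ w. (\<Prod>l<m. ennreal (\<psi> (CN l w))) * passage (cycle_path L X n q m) (cycle_threshold L X n q m) n q w \<partial>M) =
    (\<integral>\<^sup>+ w. (\<Prod>l<m. ennreal (\<psi> (CN l w))) \<partial>M) * ennreal (order_mean \<Psi> n q)"
proof -
  let ?f = "\<lambda>w. \<Prod>l<m. ennreal (\<psi> (CN l w))"
  have "0 < \<Psi> 1" using \<Psi>_pos[of 1] by simp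
  from cycle_repair_system_weighted[where m = m and \<psi> = \<psi>, OF this \<psi>]
  have f: "?f \<in> borel_measurable M" and R: "repair_system (density M ?f) (cycle_path L X n q m) (cycle_threshold L X n q m) n q \<Psi>"
    by simp_all
  interpret R: repair_system "density M ?f" "cycle_path L X n q m" "cycle_threshold L X n q m" n q \<Psi>
    by (rule R)
  have g: "passage (cycle_path L X n q m) (cycle_threshold L X n q m) n q \<in> borel_measurable M"
    using R.passage_measurable by simp
  have "(\<integral>\<^sup>+ w. ?f w * passage (cycle_path L X n q m) (cycle_threshold L X n q m) n q w \<partial>M) =
      ennreal (R.mass * order_mean \<Psi> n q)"
    using R.nn_integral_passage by (simp add: nn_integral_density[OF f g])
  also have "\<dots> = emeasure (density M ?f) (space M) * ennreal (order_mean \<Psi> n q)"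
    using R.emeasure_eq_measure[of "space M"] by (simp add: ennreal_mult')
  also have "emeasure (density M ?f) (space M) = (\<integral>\<^sup>+ w. ?f w * indicator (space M) w \<partial>M)"
    by (rule emeasure_density[OF f]) simp
  also have "\<dots> = (\<integral>\<^sup>+ w. ?f w \<partial>M)" by (intro nn_integral_cong) simp
  finally show ?thesis .
qed

end

locale repair_process = repair_system +
  assumes mass_1: "measure M (space M) = 1"
begin

sublocale prob_space M
  by (intro prob_spaceI) (simp add: emeasure_eq_measure mass_1)

lemma integrable_exp_passage_time: "th < \<Psi> 1 \<Longrightarrow> integrable M (\<lambda>w. exp (th * T w))"
  using nn_integral_exp_passage_time_finite[of th] by (intro integrableI_nonneg) auto

theorem AE_mean_cycle_length: "AE w in M. (\<lambda>m. (\<Sum>l<m. CT l w) / real m) \<longlonglongrightarrow> expectation T"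
\<comment> \<open>The radius has to stay below \<open>\<Psi> 1\<close>, where the exponential
  moments are finite.\<close>
proof (rule AE_mean_tendsto_of_exp_moments[where ?th0.0 = "\<Psi> 1 / 2"])
  show "0 < \<Psi> 1 / 2" using \<Psi>_pos[of 1] by simp
  fix th :: real assume "\<bar>th\<bar> \<le> \<Psi> 1 / 2"
  then have th: "th < \<Psi> 1" using \<Psi>_pos[of 1] by simp
  show int: "integrable M (\<lambda>w. exp (th * T w))" by (rule integrable_exp_passage_time[OF th])
  fix m
  have "(\<integral>\<^sup>+ w. (\<Prod>l<m. ennreal (exp (th * CT l w) * (\<lambda>_. 1) (CN l w))) \<partial>M) =
      (\<integral>\<^sup>+ w. ennreal (exp (th * T w)) \<partial>M) ^ m * emeasure M (space M)"
  proof (rule nn_integral_cycle_prod[OF th])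
    fix M' :: "'a measure" and L' X' assume R: "repair_system M' L' X' n q \<Psi>"
    show "(\<integral>\<^sup>+ w. ennreal (exp (th * passage_time L' X' n q w) * 1) \<partial>M') =
        (\<integral>\<^sup>+ w. ennreal (exp (th * T w)) \<partial>M) * emeasure M' (space M')"
      using nn_integral_passage_time_proportional[OF R repair_system_axioms, of "\<lambda>x. ennreal (exp (th * x))"]
      by (simp add: emeasure_space_1 mult.commute)
  qed simp
  moreover have "(\<Prod>l<m. ennreal (exp (th * CT l w))) = ennreal (exp (th * (\<Sum>l<m. CT l w)))" for w
    by (simp add: prod_ennreal exp_sum[symmetric] sum_distrib_left)
  ultimately show "(\<integral>\<^sup>+ w. ennreal (exp (th * (\<Sum>l<m. CT l w))) \<partial>M) = ennreal (expectation (\<lambda>w. exp (th * T w)) ^ m)"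
    using int by (simp add: nn_integral_eq_integral emeasure_space_1 ennreal_power)
qed measurable

lemma expectation_passage_count:
  "expectation (\<lambda>w. g (N w)) = (\<Sum>j\<in>{q..n}. F_prob \<Psi> n (q - 1) j * (g j :: real))"
proof -
  have "expectation (\<lambda>w. g (N w)) = expectation (\<lambda>w. \<Sum>j\<in>{q..n}. indicator {w \<in> space M. N w = j} w * g j)"
  proof (rule integral_cong_AE)
    show "AE w in M. g (N w) = (\<Sum>j\<in>{q..n}. indicator {w \<in> space M. N w = j} w * g j)"
      using AE_passage_count AE_space
    proof eventually_elim
      case (elim w)
      have "(\<Sum>j\<in>{q..n}. indicator {w \<in> space M. N w = j} w * g j) = (\<Sum>j\<in>{q..n}. if N w = j then g j else 0)"
        using elim by (intro sum.cong) (auto simp: indicator_def)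
      then show ?case using elim by simp
    qed
  qed measurable
  also have "\<dots> = (\<Sum>j\<in>{q..n}. measure M {w \<in> space M. N w = j} * g j)"
    by (subst Bochner_Integration.integral_sum) (auto simp: emeasure_eq_measure intro!: sum.cong)
  finally show ?thesis by (simp add: measure_passage_count mass_1)
qed

theorem AE_mean_cycle_count:
  fixes g :: "nat \<Rightarrow> real"
  shows "AE w in M. (\<lambda>m. (\<Sum>l<m. g (CN l w)) / real m) \<longlonglongrightarrow> (\<Sum>j\<in>{q..n}. F_prob \<Psi> n (q - 1) j * g j)"
proof -
  have "AE w in M. (\<lambda>m. (\<Sum>l<m. g (CN l w)) / real m) \<longlonglongrightarrow> expectation (\<lambda>w. g (N w))"
  \<comment> \<open>Counts are bounded, so any radius works; the function of the count goes into
    \<open>\<psi>\<close> and the length gets exponent 0.\<close>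
  proof (rule AE_mean_tendsto_of_exp_moments[where ?th0.0 = 1])
    fix th :: real assume "\<bar>th\<bar> \<le> 1"
    have b: "exp (th * g (N w)) \<le> (\<Sum>j\<le>n. exp (th * g j))" for w
      by (rule member_le_sum) (auto simp: passage_count_def card_dead_le)
    show int: "integrable M (\<lambda>w. exp (th * g (N w)))"
      using b by (intro integrable_const_bound[where B = "\<Sum>j\<le>n. exp (th * g j)"]) auto
    fix m
    define \<psi> where "\<psi> j = exp (th * g j)" for j
    have \<psi>: "0 \<le> \<psi> j" for j by (simp add: \<psi>_def)
    have "0 < \<Psi> 1" using \<Psi>_pos[of 1] by simp
    have "(\<integral>\<^sup>+ w. (\<Prod>l<m. ennreal (exp (0 * CT l w) * \<psi> (CN l w))) \<partial>M) =
        (\<integral>\<^sup>+ w. ennreal (\<psi> (N w)) \<partial>M) ^ m * emeasure M (space M)"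
    proof (rule nn_integral_cycle_prod[OF \<open>0 < \<Psi> 1\<close> \<psi>])
      fix M' :: "'a measure" and L' X' assume R: "repair_system M' L' X' n q \<Psi>"
      interpret R: repair_system M' L' X' n q \<Psi> by (rule R)
      show "(\<integral>\<^sup>+ w. ennreal (exp (0 * passage_time L' X' n q w) * \<psi> (passage_count L' X' n q w)) \<partial>M') =
        (\<integral>\<^sup>+ w. ennreal (\<psi> (N w)) \<partial>M) * emeasure M' (space M')"
        using R.nn_integral_passage_count[of \<psi>] nn_integral_passage_count[of \<psi>]
        by (simp add: mass_1 R.emeasure_eq_measure mult.commute)
    qed
    moreover have "(\<Prod>l<m. ennreal (\<psi> (CN l w))) = ennreal (exp (th * (\<Sum>l<m. g (CN l w))))" for w
      by (simp add: \<psi>_def prod_ennreal exp_sum[symmetric] sum_distrib_left)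
    ultimately show "(\<integral>\<^sup>+ w. ennreal (exp (th * (\<Sum>l<m. g (CN l w)))) \<partial>M) = ennreal (expectation (\<lambda>w. exp (th * g (N w))) ^ m)"
      using int by (simp add: \<psi>_def nn_integral_eq_integral emeasure_space_1 ennreal_power)
  next
    show "(\<lambda>w. g (CN m w)) \<in> borel_measurable M" for m by measurable
    show "(\<lambda>w. g (N w)) \<in> borel_measurable M" by measurable
  qed simp
  then show ?thesis by (simp only: expectation_passage_count)
qed

lemma expectation_passage_time: "expectation T = order_mean \<Psi> n q" "0 < order_mean \<Psi> n q"
proof -
  have "(\<integral>\<^sup>+ w. ennreal (T w) \<partial>M) = (\<integral>\<^sup>+ w. fp w \<partial>M)"
    by (rule nn_integral_cong_AE) (use AE_good in eventually_elim, simp)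
  then have eq: "(\<integral>\<^sup>+ w. ennreal (T w) \<partial>M) = ennreal (order_mean \<Psi> n q)"
    using nn_integral_passage by (simp add: mass_1)
  have "(\<integral>\<^sup>+ w. ennreal (T w) \<partial>M) \<noteq> 0"
  proof
    assume "(\<integral>\<^sup>+ w. ennreal (T w) \<partial>M) = 0"
    then have "AE w in M. ennreal (T w) = 0" by (subst (asm) nn_integral_0_iff_AE) auto
    with AE_good have "AE w in M. False" by eventually_elim auto
    then show False by simp
  qed
  then show pos: "0 < order_mean \<Psi> n q" unfolding eq by (simp add: ennreal_eq_0_iff not_le)
  show "expectation T = order_mean \<Psi> n q"
    using eq pos by (intro integral_eq_nn_integral[THEN trans]) auto
qed

end

section \<open>Order statistics of LFMO lifetimes\<close>

context frailty_system
begin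

text \<open>Lifetimes are defined by \<open>L > eps\<close>, dead components by
  \<open>L \<ge> X\<close>. At a fixed time the two conditions differ only on ties, which are
  squeezed by scaling the path.\<close>

lemma AE_no_tie_fixed_time:
  assumes i: "i \<in> {1..n}" and t: "0 \<le> t"
  shows "AE w in M. X (i, 0) w \<noteq> L t w"
proof -
  define B where "B = {w \<in> space M. 0 < X (i, 0) w \<and> X (i, 0) w = L t w}"
  define A where "A c = {w \<in> space M. c * L t w < X (i, 0) w}" for c
  have B: "B \<in> sets M" unfolding B_def using i t by measurable
  have A: "A c \<in> sets M" for c unfolding A_def using i t by measurable
  have mA: "measure M (A c) = mass * exp (- t * \<Psi> c)" if "0 \<le> c" for c
  proof -
    let ?u = "\<lambda>j::nat. if j = 0 then 0 else t"
    have "measure M {w \<in> space M. \<forall>x\<in>{(i, 0)}. path_comb L ?u 1 (\<lambda>_. c) w < X x w} =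
        mass * exp (- psi_comb \<Psi> ?u 1 (\<lambda>j. \<Sum>x\<in>{(i, 0::nat)}. c))"
      using i I t that by (intro survival) (auto simp: time_grid_def)
    moreover have "{w \<in> space M. \<forall>x\<in>{(i, 0)}. path_comb L ?u 1 (\<lambda>_. c) w < X x w} = A c"
      by (auto simp: path_comb_def L_zero A_def)
    ultimately show ?thesis by (simp add: psi_comb_def)
  qed
  have bound: "measure M B \<le> mass * exp (- t * \<Psi> c) - mass * exp (- t * \<Psi> d)" if "0 \<le> c" "c < 1" "1 < d" for c d
  proof -
    have "A d \<subseteq> A c"
    proof
      fix w assume w: "w \<in> A d"
      then have "c * L t w \<le> d * L t w" using that L_nonneg[of w t] t by (intro mult_right_mono) (auto simp: A_def)
      then show "w \<in> A c" using w by (auto simp: A_def)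
    qed
    then have "measure M (A c - A d) = mass * exp (- t * \<Psi> c) - mass * exp (- t * \<Psi> d)"
      using that by (subst finite_measure_Diff[OF A A]) (auto simp: mA)
    moreover have "B \<subseteq> A c - A d" using that by (auto simp: A_def B_def)
    then have "measure M B \<le> measure M (A c - A d)" using A by (intro finite_measure_mono) auto
    ultimately show ?thesis by simp
  qed
  have "continuous_on {0..} (\<lambda>c. mass * exp (- t * \<Psi> c))"
    by (intro continuous_intros \<Psi>_continuous)
  with B bound have "AE w in M. w \<notin> B" by (rule AE_not_in_of_squeeze)
  then show ?thesis using AE_X0_pos AE_space by eventually_elim (use i in \<open>auto simp: B_def\<close>)
qed

end

lemma sort_nth_less_iff:
  fixes xs :: "'b::linorder list"
  assumes m: "1 \<le> m" "m \<le> length xs"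
  shows "sort xs ! (m - 1) < y \<longleftrightarrow> m \<le> length (filter (\<lambda>x. x < y) xs)"
proof -
  let ?ys = "sort xs"
  let ?S = "{i. i < length ?ys \<and> ?ys ! i < y}"
  have "length (filter (\<lambda>x. x < y) xs) = length (filter (\<lambda>x. x < y) ?ys)"
    by (metis mset_filter mset_sort size_mset)
  also have "\<dots> = card ?S" by (rule length_filter_conv_card)
  finally have len: "length (filter (\<lambda>x. x < y) xs) = card ?S" .
  have mono: "?ys ! i \<le> ?ys ! j" if "i \<le> j" "j < length ?ys" for i j
    using that by (intro sorted_nth_mono) auto
  show ?thesis
    unfolding len
  proof
    assume less: "?ys ! (m - 1) < y"
    have "{..<m} \<subseteq> ?S"
    proof
      fix i assume "i \<in> {..<m}"
      then have "i \<le> m - 1" "m - 1 < length ?ys" using m by auto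
      then show "i \<in> ?S" using mono[of i "m - 1"] less by auto
    qed
    then have "card {..<m} \<le> card ?S" by (intro card_mono) auto
    then show "m \<le> card ?S" by simp
  next
    assume le: "m \<le> card ?S"
    show "?ys ! (m - 1) < y"
    proof (rule ccontr)
      assume n: "\<not> ?ys ! (m - 1) < y"
      have "?S \<subseteq> {..<m - 1}"
      proof
        fix i assume i: "i \<in> ?S"
        show "i \<in> {..<m - 1}"
        proof (rule ccontr)
          assume "i \<notin> {..<m - 1}"
          then have "?ys ! (m - 1) \<le> ?ys ! i" using i by (intro mono) auto
          then show False using i n by auto
        qed
      qed
      then have "card ?S \<le> card {..<m - 1}" by (intro card_mono) auto
      then show False using le m by simp
    qed
  qed
qed

lemma order_stat_less_iff:
  assumes m: "1 \<le> m" "m \<le> n"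
  shows "lfmo_order_stat L eps n m w < y \<longleftrightarrow> m \<le> card {i \<in> {1..n}. lfmo_lifetime L eps i w < y}"
proof -
  let ?f = "\<lambda>i. lfmo_lifetime L eps i w"
  have "lfmo_order_stat L eps n m w < y \<longleftrightarrow> m \<le> length (filter (\<lambda>x. x < y) (map ?f [1..<Suc n]))"
    unfolding lfmo_order_stat_def using m by (intro sort_nth_less_iff) auto
  also have "length (filter (\<lambda>x. x < y) (map ?f [1..<Suc n])) = length (filter (\<lambda>i. ?f i < y) [1..<Suc n])"
    by (simp add: filter_map o_def)
  also have "\<dots> = card (set (filter (\<lambda>i. ?f i < y) [1..<Suc n]))"
    by (rule distinct_card[symmetric]) simp
  also have "set (filter (\<lambda>i. ?f i < y) [1..<Suc n]) = {i \<in> {1..n}. ?f i < y}" by auto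
  finally show ?thesis .
qed

context subordinator
begin

text \<open>\<open>f\<close> renames indices: \<open>fst\<close> for the thresholds
  \<open>eps\<close>, which have no reserve, and the identity for the whole family of repair
  thresholds.\<close>

lemma frailty_system_of_iid:
  assumes iid: "iid_std_exp_indep_of M L I X" and f: "inj_on f I'" "f ` I' \<subseteq> I"
    and I': "{1..n} \<times> {0} \<subseteq> I'" and q: "1 \<le> q" "q \<le> n"
  shows "frailty_system M L (\<lambda>x. X (f x)) I' n q \<Psi>"
proof (intro frailty_system.intro frailty_system_axioms.intro)
  show "finite_measure M" by unfold_locales
  show "0 < \<Psi> x" if "0 < x" for x by (rule \<Psi>_pos[OF that])
  show "X (f x) \<in> borel_measurable M" if "x \<in> I'" for x
  proof -
    have "distributed M lborel (X (f x)) (exponential_density 1)"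
      using iid f that by (auto simp: iid_std_exp_indep_of_def)
    then show ?thesis using distributed_measurable by fastforce
  qed
  fix J u p and b :: "nat \<times> nat \<Rightarrow> nat \<Rightarrow> real"
  assume J: "finite J" "J \<subseteq> I'" and u: "time_grid u p" and b: "\<And>x j. 0 \<le> b x j"
  have inj: "inj_on f J" using f J inj_on_subset by blast
  let ?g = "inv_into J f"
  have "measure M {w \<in> space M. \<forall>y\<in>f ` J. path_comb L u p (b (?g y)) w < X y w} =
      exp (- psi_comb \<Psi> u p (\<lambda>j. \<Sum>y\<in>f ` J. b (?g y) j))"
    using J f b by (intro survival_probability[OF iid _ _ u]) auto
  moreover have "{w \<in> space M. \<forall>y\<in>f ` J. path_comb L u p (b (?g y)) w < X y w} =
      {w \<in> space M. \<forall>x\<in>J. path_comb L u p (b x) w < X (f x) w}"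
    using inj by auto
  moreover have "(\<Sum>y\<in>f ` J. b (?g y) j) = (\<Sum>x\<in>J. b x j)" for j
    by (subst sum.reindex[OF inj]) (use inj in auto)
  ultimately show "measure M {w \<in> space M. \<forall>x\<in>J. path_comb L u p (b x) w < X (f x) w} =
      measure M (space M) * exp (- psi_comb \<Psi> u p (\<lambda>j. \<Sum>x\<in>J. b x j))"
    by (simp add: prob_space)
qed (use q I' L_measurable L_zero L_mono L_right_continuous \<Psi>_zero \<Psi>_continuous in auto)

text \<open>Almost surely the order statistic equals the first passage of the dead count; this is
  shown by comparing the values \<open>y\<close> above each of them.\<close>

theorem mean_order_stat_eq:
  assumes iid: "iid_std_exp_indep_of M L {1..n} eps" and m: "1 \<le> m" "m \<le> n"
  shows "mean_order_stat M L eps n m = ennreal (order_mean \<Psi> n m)"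
proof -
  interpret F: frailty_system M L "\<lambda>x. eps (fst x)" "{1..n} \<times> {0}" n m \<Psi>
    by (rule frailty_system_of_iid[OF iid]) (use m in \<open>auto simp: inj_on_def\<close>)
  \<comment> \<open>Countably many times suffice, since passages below \<open>y\<close> are
    witnessed at rational times.\<close>
  have "AE w in M. \<forall>r::rat. 0 \<le> r \<longrightarrow> (\<forall>i\<in>{1..n}. eps i w \<noteq> L (of_rat r) w)"
    unfolding AE_all_countable
  proof
    fix r :: rat
    show "AE w in M. 0 \<le> r \<longrightarrow> (\<forall>i\<in>{1..n}. eps i w \<noteq> L (of_rat r) w)"
    proof (cases "0 \<le> r")
      case True
      then have "AE w in M. \<forall>i\<in>{1..n}. eps i w \<noteq> L (of_rat r) w"
        using F.AE_no_tie_fixed_time[of _ "of_rat r"] by (intro AE_finite_allI) auto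
      then show ?thesis by eventually_elim simp
    qed simp
  qed
  then have "AE w in M. lfmo_order_stat L eps n m w = F.fp w"
    using AE_space
  proof eventually_elim
    case (elim w)
    then have w: "w \<in> space M" by simp
    have "lfmo_order_stat L eps n m w < y \<longleftrightarrow> F.fp w < y" for y
    proof
      assume "F.fp w < y"
      then obtain r :: rat where r: "0 < r" "ennreal (of_rat r) < y" "m \<le> card (F.D (of_rat r) w)"
        unfolding F.passage_less_iff_rat[OF w] by blast
      have "F.D (of_rat r) w \<subseteq> {i \<in> {1..n}. lfmo_lifetime L eps i w < y}"
      proof
        fix i assume "i \<in> F.D (of_rat r) w"
        then have i: "i \<in> {1..n}" "eps i w \<le> L (of_rat r) w" by (auto simp: dead_def)
        then have "eps i w < L (of_rat r) w" using elim r by (auto simp: less_le)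
        then have "lfmo_lifetime L eps i w \<le> ennreal (of_rat r)"
          unfolding lfmo_lifetime_def using r by (intro Inf_lower) auto
        then show "i \<in> {i \<in> {1..n}. lfmo_lifetime L eps i w < y}" using i r by simp
      qed
      then have "card (F.D (of_rat r) w) \<le> card {i \<in> {1..n}. lfmo_lifetime L eps i w < y}"
        by (intro card_mono) auto
      then show "lfmo_order_stat L eps n m w < y" using r(3) unfolding order_stat_less_iff[OF m] by linarith
    next
      let ?I = "{i \<in> {1..n}. lfmo_lifetime L eps i w < y}"
      assume "lfmo_order_stat L eps n m w < y"
      then have card: "m \<le> card ?I" unfolding order_stat_less_iff[OF m] .
      have "\<forall>i\<in>?I. \<exists>t. 0 \<le> t \<and> L t w > eps i w \<and> ennreal t < y"
        by (auto simp: lfmo_lifetime_def Inf_less_iff)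
      then obtain t where t: "\<And>i. i \<in> ?I \<Longrightarrow> 0 \<le> t i \<and> L (t i) w > eps i w \<and> ennreal (t i) < y"
        by metis
      have "?I \<noteq> {}"
      proof
        assume e: "?I = {}"
        show False using card m unfolding e by simp
      qed
      then have "Max (t ` ?I) \<in> t ` ?I" by (intro Max_in) auto
      then obtain i0 where i0: "i0 \<in> ?I" "Max (t ` ?I) = t i0" by auto
      have max: "t i \<le> t i0" if "i \<in> ?I" for i using that by (subst i0(2)[symmetric]) (intro Max_ge, auto)
      have "eps i w \<le> L (t i0 + s) w" if "i \<in> ?I" "0 \<le> s" for i s
        using t[OF that(1)] max[OF that(1)] L_mono[OF w, of "t i" "t i0 + s"] that by simp
      then have sub: "?I \<subseteq> F.D (t i0 + s) w" if "0 \<le> s" for s using that by (auto simp: dead_def)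
      \<comment> \<open>The witness of a passage has to be positive, while \<open>t i0\<close> may
        be 0; there is room below \<open>y\<close> for a small delay.\<close>
      obtain s where s: "0 < s" "ennreal (t i0 + s) < y"
      proof -
        have "\<exists>z. t i0 < z \<and> ennreal z < y"
        proof (cases y)
          case (real v)
          have "0 \<le> t i0" "ennreal (t i0) < y" using t[OF i0(1)] by blast+
          then have "t i0 < v" using real by (simp add: ennreal_less_iff)
          then obtain z where z: "t i0 < z" "z < v" using dense by blast
          have "ennreal z < ennreal v" using z t[OF i0(1)] by (intro ennreal_lessI) auto
          then show ?thesis using z real by auto
        next
          case top
          then show ?thesis by (intro exI[of _ "t i0 + 1"]) simp
        qed
        then obtain z where "t i0 < z" "ennreal z < y" by blast
        then show ?thesis using that[of "z - t i0"] by simp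
      qed
      have "F.fp w \<le> ennreal (t i0 + s)"
        unfolding passage_def
      proof (intro Inf_lower CollectI exI conjI)
        show "0 < t i0 + s" using t[OF i0(1)] s by simp
        have "card ?I \<le> card (F.D (t i0 + s) w)" using s by (intro card_mono sub) auto
        then show "m \<le> card (F.D (t i0 + s) w)" using card by simp
      qed simp
      then show "F.fp w < y" using s by simp
    qed
    from this[of "F.fp w"] this[of "lfmo_order_stat L eps n m w"] show ?case
      by (intro antisym) (auto simp: not_less[symmetric])
  qed
  then have "mean_order_stat M L eps n m = (\<integral>\<^sup>+ w. F.fp w \<partial>M)"
    unfolding mean_order_stat_def by (rule nn_integral_cong_AE)
  then show ?thesis using F.nn_integral_passage by (simp add: prob_space)
qed

end

section \<open>The paths of the repair process\<close>

locale repair_paths = repair_process M L "\<lambda>(i, m). E i m" n "min k r" \<Psi>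
  for M :: "'a measure" and L E n k r \<Psi>
begin

abbreviation "q \<equiv> min k r"
abbreviation "RT m w \<equiv> repair_time L E n k r m w"
abbreviation "thr m i w \<equiv> threshold L E n k r m i w"
abbreviation "CP m \<equiv> cycle_path L (\<lambda>(i, m). E i m) n q m"
abbreviation "CX m \<equiv> cycle_threshold L (\<lambda>(i, m). E i m) n q m"

definition S where "S w m = (\<Sum>l<m. CT l w)"

text \<open>Collects all null sets: on these outcomes every cycle has a finite positive length and
  ends with at least \<open>q\<close> failures, and the recursion for repair times can be compared
  with the restarts path by path.\<close>

definition regular :: "'a \<Rightarrow> bool" where
  "regular w \<longleftrightarrow> w \<in> space M \<and> (\<forall>m. passage (CP m) (CX m) n q w = ennreal (CT m w) \<and> 0 < CT m w \<and>
     q \<le> CN m w)"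

lemma AE_regular: "AE w in M. regular w"
proof -
  have "AE w in M. \<forall>m. passage (CP m) (CX m) n q w = ennreal (CT m w) \<and> 0 < CT m w \<and> q \<le> CN m w"
    unfolding AE_all_countable
  proof
    fix m
    interpret R: repair_system M "CP m" "CX m" n q \<Psi> by (rule cycle_repair_system)
    show "AE w in M. passage (CP m) (CX m) n q w = ennreal (CT m w) \<and> 0 < CT m w \<and> q \<le> CN m w"
      using R.AE_good R.AE_passage_count by eventually_elim (simp add: cycle_length_def cycle_count_def)
  qed
  then show ?thesis using AE_space by eventually_elim (simp add: regular_def)
qed

lemma S_simps: "S w 0 = 0" "S w (Suc m) = S w m + CT m w"
  by (simp_all add: S_def)

lemma S_mono: "regular w \<Longrightarrow> mono (S w)"
  by (intro mono_iff_le_Suc[THEN iffD2]) (auto simp: S_simps regular_def less_imp_le)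

lemma S_nonneg: "regular w \<Longrightarrow> 0 \<le> S w m"
  using monoD[OF S_mono, of w 0 m] by (simp add: S_simps)

lemma num_failed_eq:
  assumes "\<And>t. CP m t w = L (S w m + t) w - L (S w m) w"
    and "\<And>i. i \<in> {1..n} \<Longrightarrow> CX m (i, 0) w = thr m i w - L (S w m) w"
  shows "{i \<in> {1..n}. L (S w m + t) w \<ge> thr m i w} = dead (CP m) (CX m) n t w"
  unfolding dead_def using assms by auto

text \<open>The invariant that links the two recursions: cycle \<open>m\<close> sees the original
  path and thresholds from time \<open>S w m\<close> and level \<open>L (S w m) w\<close>, and its
  reserve entry \<open>Suc j\<close> is the one that repair \<open>m + Suc j\<close> draws.\<close>

lemma cycle_facts:
  assumes reg: "regular w"
  shows "(\<forall>t. CP m t w = L (S w m + t) w - L (S w m) w) \<and> RT m w = ennreal (S w m) \<and>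
    (\<forall>i\<in>{1..n}. CX m (i, 0) w = thr m i w - L (S w m) w) \<and> (\<forall>i j. CX m (i, Suc j) w = E i (m + Suc j) w)"
proof (induction m)
  case 0
  have "w \<in> space M" using reg by (simp add: regular_def)
  then show ?case by (simp add: S_simps L_zero)
next
  case (Suc m)
  then have P: "\<And>t. CP m t w = L (S w m + t) w - L (S w m) w" and R: "RT m w = ennreal (S w m)"
    and X0: "\<And>i. i \<in> {1..n} \<Longrightarrow> CX m (i, 0) w = thr m i w - L (S w m) w" and X1: "\<And>i j. CX m (i, Suc j) w = E i (m + Suc j) w"
    by blast+
  have c: "passage (CP m) (CX m) n q w = ennreal (CT m w)" "0 < CT m w" "q \<le> CN m w"
    using reg by (auto simp: regular_def)
  have T: "passage_time (CP m) (CX m) n q w = CT m w" by (simp add: cycle_length_def)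
  have nf: "{i \<in> {1..n}. L (S w m + t) w \<ge> thr m i w} = dead (CP m) (CX m) n t w" for t
    by (rule num_failed_eq[OF P X0])
  have P': "CP (Suc m) t w = L (S w (Suc m) + t) w - L (S w (Suc m)) w" for t
    by (simp add: cycle_Suc restart_path_def shifted_path_def T P S_simps add.assoc)
  \<comment> \<open>A count reaches \<open>min k r\<close> exactly when one of the two repair
    conditions holds. Witnesses are translated between absolute time and time since
    \<open>S w m\<close>.\<close>
  have R': "RT (Suc m) w = ennreal (S w (Suc m))"
  proof (rule antisym)
    have "q \<le> card {i \<in> {1..n}. L (S w m + CT m w) w \<ge> thr m i w}"
      unfolding nf using c(3) unfolding cycle_count_def passage_count_def T .
    then have "r \<le> num_failed L n (\<lambda>i. thr m i w) (S w (Suc m)) w \<or> k \<le> num_failed L n (\<lambda>i. thr m i w) (S w (Suc m)) w"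
      by (auto simp: num_failed_def S_simps min_le_iff_disj)
    moreover have "ennreal (S w m) < ennreal (S w (Suc m))"
      using c(2) S_nonneg[OF reg, of m] by (intro ennreal_lessI) (auto simp: S_simps)
    ultimately show "RT (Suc m) w \<le> ennreal (S w (Suc m))"
      unfolding repair_time.simps R using S_nonneg[OF reg, of "Suc m"] by (intro Inf_lower) auto
    show "ennreal (S w (Suc m)) \<le> RT (Suc m) w"
      unfolding repair_time.simps R
    proof (rule Inf_greatest, clarify)
      fix t assume t: "0 \<le> t" "ennreal (S w m) < ennreal t"
        "r \<le> num_failed L n (\<lambda>i. thr m i w) t w \<or> k \<le> num_failed L n (\<lambda>i. thr m i w) t w"
      have less: "S w m < t" using t(2) S_nonneg[OF reg, of m] by (simp add: ennreal_less_iff)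
      have "q \<le> card {i \<in> {1..n}. L (S w m + (t - S w m)) w \<ge> thr m i w}"
        using t(3) by (auto simp: num_failed_def min_le_iff_disj)
      then have "passage (CP m) (CX m) n q w \<le> ennreal (t - S w m)"
        unfolding nf passage_def using less by (intro Inf_lower) auto
      then have "CT m w \<le> t - S w m" using c less by simp
      then show "ennreal (S w (Suc m)) \<le> ennreal t" by (intro ennreal_leI) (simp add: S_simps)
    qed
  qed
  have l: "L (enn2real (RT (Suc m) w)) w = L (S w (Suc m)) w"
    using R' S_nonneg[OF reg, of "Suc m"] by simp
  have d: "i \<in> dead (CP m) (CX m) n (CT m w) w \<longleftrightarrow> i \<in> {1..n} \<and> thr m i w \<le> L (S w (Suc m)) w" for i
    using nf[of "CT m w"] by (auto simp: S_simps)
  have "CX (Suc m) (i, 0) w = thr (Suc m) i w - L (S w (Suc m)) w" if i: "i \<in> {1..n}" for i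
  proof (cases "thr m i w \<le> L (S w (Suc m)) w")
    case True
    then have "i \<in> dead (CP m) (CX m) n (CT m w) w" using i d by blast
    then have "CX (Suc m) (i, 0) w = E i (Suc m) w"
      by (simp add: cycle_Suc restart_threshold_def residual_def renew_index_def T X1)
    moreover have "thr (Suc m) i w = L (S w (Suc m)) w + E i (Suc m) w"
      using True by (simp only: threshold.simps Let_def l if_True)
    ultimately show ?thesis by simp
  next
    case False
    then have "i \<notin> dead (CP m) (CX m) n (CT m w) w" using d by blast
    then have "CX (Suc m) (i, 0) w = CX m (i, 0) w - CP m (CT m w) w"
      by (simp add: cycle_Suc restart_threshold_def residual_def renew_index_def T)
    moreover have "thr (Suc m) i w = thr m i w"
      using False by (simp only: threshold.simps Let_def l if_False)
    ultimately show ?thesis using X0[OF i] by (simp add: P S_simps)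
  qed
  moreover have "CX (Suc m) (i, Suc j) w = E i (Suc m + Suc j) w" for i j
    by (simp add: cycle_Suc restart_threshold_def residual_def renew_index_def X1)
  ultimately show ?case using P' R' by blast
qed

end

context repair_paths
begin

lemma repair_time_eq: "regular w \<Longrightarrow> RT m w = ennreal (S w m)"
  using cycle_facts by blast

text \<open>Cycles are numbered from 0 and repairs from 1, so repair \<open>Suc m\<close> ends cycle
  \<open>m\<close>.\<close>

lemma num_repaired_Suc:
  assumes reg: "regular w"
  shows "num_repaired L E n k r (Suc m) w = CN m w"
proof -
  have "{i \<in> {1..n}. L (S w m + CT m w) w \<ge> thr m i w} = dead (CP m) (CX m) n (CT m w) w"
    using cycle_facts[OF reg, of m] by (intro num_failed_eq) blast+
  moreover have "enn2real (RT (Suc m) w) = S w m + CT m w"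
    using repair_time_eq[OF reg, of "Suc m"] S_nonneg[OF reg, of "Suc m"] by (simp add: S_simps)
  ultimately show ?thesis
    unfolding num_repaired_def num_failed_def cycle_count_def passage_count_def cycle_length_def by simp
qed

lemma due_Suc_iff:
  assumes reg: "regular w"
  shows "due_to_system_failure L E n k r (Suc m) w \<longleftrightarrow> k \<le> CN m w"
  using repair_time_eq[OF reg, of "Suc m"] num_repaired_Suc[OF reg, of m]
  by (simp add: due_to_system_failure_def del: repair_time.simps)

lemma repairs_until_eq:
  assumes reg: "regular w" and t: "0 \<le> t"
  shows "repairs_until L E n k r t w = {m. 1 \<le> m \<and> S w m \<le> t}"
  using repair_time_eq[OF reg] t by (simp add: repairs_until_def)

lemma AE_S_tendsto: "AE w in M. regular w \<and> (\<lambda>m. S w m / real m) \<longlonglongrightarrow> order_mean \<Psi> n q"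
  using AE_regular AE_mean_cycle_length
  by eventually_elim (simp add: S_def expectation_passage_time)

lemma AE_repair_rate:
  "AE w in M. ((\<lambda>t. real (card (repairs_until L E n k r t w)) / t) \<longlongrightarrow> 1 / order_mean \<Psi> n q) at_top"
  using AE_S_tendsto
proof eventually_elim
  case (elim w)
  then have reg: "regular w" and lim: "(\<lambda>m. S w m / real m) \<longlonglongrightarrow> order_mean \<Psi> n q" by auto
  have "((\<lambda>t. real (card {m. 1 \<le> m \<and> S w m \<le> t}) / t) \<longlongrightarrow> 1 / order_mean \<Psi> n q) at_top"
    by (rule renewal_rate(3)[OF S_simps(1) S_mono[OF reg] expectation_passage_time(2) lim])
  moreover have "eventually (\<lambda>t. real (card {m. 1 \<le> m \<and> S w m \<le> t}) / t = real (card (repairs_until L E n k r t w)) / t) at_top"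
    using eventually_ge_at_top[of 0] by eventually_elim (simp add: repairs_until_eq[OF reg])
  ultimately show ?case by (rule Lim_transform_eventually)
qed

lemma sum_repairs_until:
  assumes reg: "regular w" and lim: "(\<lambda>m. S w m / real m) \<longlonglongrightarrow> order_mean \<Psi> n q" and t: "0 \<le> t"
  shows "(\<Sum>m\<in>repairs_until L E n k r t w. f m) = (\<Sum>l<card {m. 1 \<le> m \<and> S w m \<le> t}. f (Suc l))"
  unfolding repairs_until_eq[OF reg t]
  by (subst renewal_rate(1)[OF S_simps(1) S_mono[OF reg] expectation_passage_time(2) lim t])
    (simp add: sum.atLeast1_atMost_eq)

lemma AE_reward_rate:
  fixes g :: "nat \<Rightarrow> real"
  shows "AE w in M. ((\<lambda>t. (\<Sum>l<card {m. 1 \<le> m \<and> S w m \<le> t}. g (CN l w)) / t) \<longlongrightarrow>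
    (\<Sum>j\<in>{q..n}. F_prob \<Psi> n (q - 1) j * g j) / order_mean \<Psi> n q) at_top"
  using AE_S_tendsto AE_mean_cycle_count[of g]
proof eventually_elim
  case (elim w)
  then show ?case
    by (intro renewal_reward_rate[OF S_simps(1) S_mono _ _ elim(2)] expectation_passage_time) auto
qed

lemma AE_repair_reward_rate:
  fixes g :: "nat \<Rightarrow> real"
  assumes f: "\<And>w l. regular w \<Longrightarrow> f w (Suc l) = g (CN l w)"
  shows "AE w in M. ((\<lambda>t. (\<Sum>m\<in>repairs_until L E n k r t w. f w m) / t) \<longlongrightarrow>
    (\<Sum>j\<in>{q..n}. F_prob \<Psi> n (q - 1) j * g j) / order_mean \<Psi> n q) at_top"
  using AE_S_tendsto AE_reward_rate[of g]
proof eventually_elim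
  case (elim w)
  then have reg: "regular w" and lim: "(\<lambda>m. S w m / real m) \<longlonglongrightarrow> order_mean \<Psi> n q" by auto
  have "eventually (\<lambda>t. (\<Sum>l<card {m. 1 \<le> m \<and> S w m \<le> t}. g (CN l w)) / t = (\<Sum>m\<in>repairs_until L E n k r t w. f w m) / t) at_top"
    using eventually_ge_at_top[of 0]
    by eventually_elim (simp only: sum_repairs_until[OF reg lim] f[OF reg])
  with elim(2) show ?case by (rule Lim_transform_eventually)
qed

section \<open>Failures of components\<close>

text \<open>If the failure time does not exceed the repair time, the threshold is reached before
  every later time, and right-continuity of \<open>L\<close> carries this back to the repair time
  itself.\<close>

lemma component_failure_le_iff:
  assumes reg: "regular w" and i: "i \<in> {1..n}"
  shows "component_failure_time L E n k r m i w \<le> RT (Suc m) w \<longleftrightarrow> i \<in> dead (CP m) (CX m) n (CT m w) w"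
proof -
  have w: "w \<in> space M" and c: "0 < CT m w" using reg by (auto simp: regular_def)
  note R = repair_time_eq[OF reg]
  have "{i \<in> {1..n}. L (S w m + CT m w) w \<ge> thr m i w} = dead (CP m) (CX m) n (CT m w) w"
    using cycle_facts[OF reg, of m] by (intro num_failed_eq) blast+
  then have d: "i \<in> dead (CP m) (CX m) n (CT m w) w \<longleftrightarrow> thr m i w \<le> L (S w (Suc m)) w"
    using i by (auto simp: S_simps)
  show ?thesis
    unfolding d
  proof
    assume "thr m i w \<le> L (S w (Suc m)) w"
    moreover have "ennreal (S w m) < ennreal (S w (Suc m))"
      using c S_nonneg[OF reg, of m] by (intro ennreal_lessI) (auto simp: S_simps)
    ultimately show "component_failure_time L E n k r m i w \<le> RT (Suc m) w"
      unfolding component_failure_time_def R using S_nonneg[OF reg, of "Suc m"] by (intro Inf_lower) auto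
  next
    assume le: "component_failure_time L E n k r m i w \<le> RT (Suc m) w"
    show "thr m i w \<le> L (S w (Suc m)) w"
    proof (rule LIMSEQ_le_const)
      have "(\<lambda>j. S w (Suc m) + 1 / real (Suc j)) \<longlonglongrightarrow> S w (Suc m) + 0"
        by (intro tendsto_add tendsto_const LIMSEQ_inverse_real_of_nat[unfolded inverse_eq_divide])
      then show "(\<lambda>j. L (S w (Suc m) + 1 / real (Suc j)) w) \<longlonglongrightarrow> L (S w (Suc m)) w"
        using S_nonneg[OF reg, of "Suc m"] by (intro L_seq_tendsto[OF w]) auto
      have "thr m i w \<le> L (S w (Suc m) + 1 / real (Suc j)) w" for j
      proof -
        have "ennreal (S w (Suc m)) < ennreal (S w (Suc m) + 1 / real (Suc j))"
          using S_nonneg[OF reg, of "Suc m"] by (intro ennreal_lessI add_nonneg_pos) auto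
        then have "component_failure_time L E n k r m i w < ennreal (S w (Suc m) + 1 / real (Suc j))"
          using le unfolding R by (rule order.strict_trans1[rotated])
        then obtain t where t: "0 \<le> t" "thr m i w \<le> L t w" "ennreal t < ennreal (S w (Suc m) + 1 / real (Suc j))"
          unfolding component_failure_time_def Inf_less_iff by auto
        then have "t \<le> S w (Suc m) + 1 / real (Suc j)" by (simp add: ennreal_less_iff)
        then have "L t w \<le> L (S w (Suc m) + 1 / real (Suc j)) w" using t by (intro L_mono[OF w])
        then show ?thesis using t by simp
      qed
      then show "\<exists>N. \<forall>j\<ge>N. thr m i w \<le> L (S w (Suc m) + 1 / real (Suc j)) w" by blast
    qed
  qed
qed

text \<open>The \<open>K\<close> completed cycles contribute their counts, and the cycle running at
  \<open>t\<close> adds between 0 and \<open>n\<close> failures. This bounded error disappears after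
  division by \<open>t\<close>.\<close>

lemma card_component_failures_until:
  assumes reg: "regular w" and lim: "(\<lambda>m. S w m / real m) \<longlonglongrightarrow> order_mean \<Psi> n q" and t: "0 \<le> t"
  defines "K \<equiv> card {m. 1 \<le> m \<and> S w m \<le> t}"
  shows "(\<Sum>l<K. CN l w) \<le> card (component_failures_until L E n k r t w)"
    and "card (component_failures_until L E n k r t w) \<le> (\<Sum>l<K. CN l w) + n"
proof -
  let ?A = "component_failures_until L E n k r t w"
  let ?F = "\<lambda>m. dead (CP m) (CX m) n (CT m w) w"
  let ?cf = "\<lambda>m i. component_failure_time L E n k r m i w"
  define B where "B = (\<lambda>(m, i). (i, m)) ` (SIGMA m:{..<K}. ?F m)"
  have K: "{m. 1 \<le> m \<and> S w m \<le> t} = {1..K}"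
    unfolding K_def by (rule renewal_rate(1)[OF S_simps(1) S_mono[OF reg] expectation_passage_time(2) lim t])
  note R = repair_time_eq[OF reg]
  have SK: "S w m \<le> t \<longleftrightarrow> m \<le> K" for m
  proof (cases m)
    case (Suc l)
    then have "S w m \<le> t \<longleftrightarrow> m \<in> {m. 1 \<le> m \<and> S w m \<le> t}" by simp
    then show ?thesis unfolding K using Suc by simp
  qed (use t in \<open>simp add: S_simps\<close>)
  have cB: "card B = (\<Sum>l<K. CN l w)"
  proof -
    have "card B = card (SIGMA m:{..<K}. ?F m)"
      unfolding B_def by (rule card_image) (auto simp: inj_on_def)
    also have "\<dots> = (\<Sum>m<K. card (?F m))" by (rule card_SigmaI) auto
    finally show ?thesis by (simp add: cycle_count_def passage_count_def cycle_length_def)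
  qed
  have fB: "finite B" unfolding B_def by (intro finite_imageI finite_SigmaI) auto
  have BA: "B \<subseteq> ?A"
  proof
    fix x assume "x \<in> B"
    then obtain i m where x: "x = (i, m)" "m < K" "i \<in> ?F m" by (auto simp: B_def)
    have i: "i \<in> {1..n}" using x(3) dead_subset[of "CP m" "CX m" n "CT m w" w] by blast
    have 1: "?cf m i \<le> RT (Suc m) w" using component_failure_le_iff[OF reg i] x by blast
    have "S w (Suc m) \<le> t" using SK[of "Suc m"] x by simp
    then have "RT (Suc m) w \<le> ennreal t" unfolding R by (rule ennreal_leI)
    then have "?cf m i \<le> ennreal t" using 1 by (rule order_trans[rotated])
    then show "x \<in> ?A" using x 1 i by (simp add: component_failures_until_def del: repair_time.simps)
  qed
  have AB: "?A \<subseteq> B \<union> {1..n} \<times> {K}"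
  proof
    fix x assume "x \<in> ?A"
    then obtain i m where x: "x = (i, m)" "i \<in> {1..n}" "?cf m i \<le> RT (Suc m) w" "?cf m i \<le> ennreal t"
      by (auto simp: component_failures_until_def simp del: repair_time.simps)
    have "ennreal (S w m) \<le> ?cf m i"
      unfolding component_failure_time_def R by (intro Inf_greatest) (clarify, erule less_imp_le)
    then have "ennreal (S w m) \<le> ennreal t" using x(4) by (rule order_trans)
    then have "S w m \<le> t" using t by simp
    then have mK: "m \<le> K" using SK by simp
    have "i \<in> ?F m" using component_failure_le_iff[OF reg x(2)] x(3) by blast
    then show "x \<in> B \<union> {1..n} \<times> {K}"
      using mK x by (cases "m = K") (auto simp: B_def image_iff)
  qed
  have fA: "finite ?A" by (rule finite_subset[OF AB]) (use fB in auto)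
  show "(\<Sum>l<K. CN l w) \<le> card ?A" unfolding cB[symmetric] by (rule card_mono[OF fA BA])
  have "card ?A \<le> card (B \<union> {1..n} \<times> {K})" by (rule card_mono[OF _ AB]) (use fB in auto)
  also have "\<dots> \<le> card B + card ({1..n} \<times> {K})" by (rule card_Un_le)
  finally show "card ?A \<le> (\<Sum>l<K. CN l w) + n" by (simp add: cB card_cartesian_product)
qed

lemma AE_component_failure_rate:
  "AE w in M. ((\<lambda>t. real (card (component_failures_until L E n k r t w)) / t) \<longlongrightarrow>
    (\<Sum>j\<in>{q..n}. F_prob \<Psi> n (q - 1) j * real j) / order_mean \<Psi> n q) at_top"
  using AE_S_tendsto AE_reward_rate[of real]
proof eventually_elim
  case (elim w)
  then have reg: "regular w" and lim: "(\<lambda>m. S w m / real m) \<longlonglongrightarrow> order_mean \<Psi> n q" by auto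
  let ?K = "\<lambda>t. card {m. 1 \<le> m \<and> S w m \<le> t}"
  let ?c = "\<lambda>t. real (card (component_failures_until L E n k r t w))"
  have "((\<lambda>t. real n / t) \<longlongrightarrow> 0) at_top"
    by (intro tendsto_divide_0[OF tendsto_const] filterlim_at_top_imp_at_infinity filterlim_ident)
  with elim(2) have up: "((\<lambda>t. (\<Sum>l<?K t. real (CN l w)) / t + real n / t) \<longlongrightarrow>
      (\<Sum>j\<in>{q..n}. F_prob \<Psi> n (q - 1) j * real j) / order_mean \<Psi> n q + 0) at_top"
    by (rule tendsto_add)
  show ?case
  proof (rule tendsto_sandwich[OF _ _ elim(2)])
    show "eventually (\<lambda>t. (\<Sum>l<?K t. real (CN l w)) / t \<le> ?c t / t) at_top"
      using eventually_gt_at_top[of 0]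
    proof eventually_elim
      case (elim t)
      have "real (\<Sum>l<?K t. CN l w) \<le> ?c t"
        using card_component_failures_until(1)[OF reg lim, of t] elim by (intro of_nat_mono) simp
      then show ?case using elim by (intro divide_right_mono) simp_all
    qed
    show "eventually (\<lambda>t. ?c t / t \<le> (\<Sum>l<?K t. real (CN l w)) / t + real n / t) at_top"
      using eventually_gt_at_top[of 0]
    proof eventually_elim
      case (elim t)
      have "?c t \<le> real ((\<Sum>l<?K t. CN l w) + n)"
        using card_component_failures_until(2)[OF reg lim, of t] elim by (intro of_nat_mono) simp
      then show ?case using elim unfolding add_divide_distrib[symmetric] by (intro divide_right_mono) simp_all
    qed
    show "((\<lambda>t. (\<Sum>l<?K t. real (CN l w)) / t + real n / t) \<longlongrightarrow>
      (\<Sum>j\<in>{q..n}. F_prob \<Psi> n (q - 1) j * real j) / order_mean \<Psi> n q) at_top"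
      using up by simp
  qed
qed

section \<open>System failures\<close>

abbreviation "p \<equiv> prob_first_repair_system_failure M L E n k r"

lemma repair_time_1: "RT 1 w = fp w"
proof -
  have "{ennreal t | t. 0 \<le> t \<and> ennreal t > repair_time L E n k r 0 w \<and>
       (r \<le> num_failed L n (\<lambda>i. threshold L E n k r 0 i w) t w \<or>
        k \<le> num_failed L n (\<lambda>i. threshold L E n k r 0 i w) t w)} =
      {ennreal t | t. 0 < t \<and> q \<le> card (D t w)}"
    by (rule Collect_cong) (auto simp: num_failed_def dead_def min_le_iff_disj)
  then show ?thesis unfolding passage_def One_nat_def repair_time.simps(2) by (rule arg_cong)
qed

lemma due_1_iff: "due_to_system_failure L E n k r 1 w \<longleftrightarrow> fp w < \<infinity> \<and> k \<le> N w"
proof -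
  have "num_repaired L E n k r 1 w = N w"
    unfolding num_repaired_def repair_time_1 passage_count_def passage_time_def num_failed_def dead_def by simp
  then show ?thesis unfolding due_to_system_failure_def repair_time_1 by simp
qed

lemma p_eq_measure: "p = measure M {w \<in> space M. k \<le> N w}"
  unfolding prob_first_repair_system_failure_def due_1_iff
proof (rule measure_eq_AE)
  show "AE w in M. (w \<in> {w \<in> space M. fp w < \<infinity> \<and> k \<le> N w}) = (w \<in> {w \<in> space M. k \<le> N w})"
    using AE_passage_finite by eventually_elim auto
qed measurable

lemma p_eq_sum: "p = (\<Sum>j\<in>{q..n}. F_prob \<Psi> n (q - 1) j * (if k \<le> j then 1 else 0))"
proof -
  have "p = expectation (\<lambda>w. indicator {w \<in> space M. k \<le> N w} w)"
    unfolding p_eq_measure by (simp add: Int_absorb2)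
  also have "\<dots> = expectation (\<lambda>w. if k \<le> N w then 1 else 0)"
    by (intro Bochner_Integration.integral_cong) (auto simp: indicator_def)
  finally show ?thesis using expectation_passage_count[of "\<lambda>j. if k \<le> j then 1 else 0"] by simp
qed

lemma p_bounds: "0 \<le> p" "p \<le> 1"
  by (simp_all add: p_eq_measure)

lemma p_cases: "if r < k then p = F_prob_range \<Psi> n (r - 1) k n else p = 1"
proof (cases "r < k")
  case True
  then have "p = (\<Sum>j\<in>{r..n}. F_prob \<Psi> n (r - 1) j * (if k \<le> j then 1 else 0))"
    using p_eq_sum by simp
  also have "\<dots> = (\<Sum>j\<in>{k..n}. F_prob \<Psi> n (r - 1) j)"
    using True by (intro sum.mono_neutral_cong_right) auto
  finally show ?thesis using True by (simp add: F_prob_range_def)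
next
  case False
  have "p = measure M (space M)"
    unfolding p_eq_measure
  proof (rule measure_eq_AE)
    show "AE w in M. (w \<in> {w \<in> space M. k \<le> N w}) = (w \<in> space M)"
      using AE_passage_count by eventually_elim (use False in auto)
  qed measurable
  then show ?thesis using False by (simp add: mass_1)
qed

text \<open>Both kinds of cost form one reward depending on the repair size, because
  \<open>c_sys\<close> is due exactly when at least \<open>k\<close> components are
  repaired.\<close>

lemma AE_cost_rate:
  "AE w in M. ((\<lambda>t. cumulative_cost c_cmp c_sys L E n k r t w / t) \<longlongrightarrow>
    (p * c_sys + (\<Sum>j = q..n. F_prob \<Psi> n (q - 1) j * c_cmp j)) / order_mean \<Psi> n q) at_top"
proof -
  let ?g = "\<lambda>j. c_cmp j + (if k \<le> j then c_sys else 0)"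
  have "p * c_sys + (\<Sum>j = q..n. F_prob \<Psi> n (q - 1) j * c_cmp j) = (\<Sum>j = q..n. F_prob \<Psi> n (q - 1) j * ?g j)"
    unfolding p_eq_sum sum_distrib_right sum.distrib[symmetric] by (intro sum.cong) (auto simp: algebra_simps)
  moreover have "AE w in M. ((\<lambda>t. (\<Sum>m\<in>repairs_until L E n k r t w. c_cmp (num_repaired L E n k r m w) +
        (if due_to_system_failure L E n k r m w then c_sys else 0)) / t) \<longlongrightarrow>
    (\<Sum>j = q..n. F_prob \<Psi> n (q - 1) j * ?g j) / order_mean \<Psi> n q) at_top"
    by (rule AE_repair_reward_rate) (simp add: num_repaired_Suc due_Suc_iff)
  ultimately show ?thesis by (simp add: cumulative_cost_def)
qed

lemma AE_system_failure_rate: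
  "AE w in M. ((\<lambda>t. real (card (system_failures_until L E n k r t w)) / t) \<longlongrightarrow> p / order_mean \<Psi> n q) at_top"
proof -
  have "AE w in M. ((\<lambda>t. (\<Sum>m\<in>repairs_until L E n k r t w. if due_to_system_failure L E n k r m w then 1 else 0) / t) \<longlongrightarrow>
    (\<Sum>j\<in>{q..n}. F_prob \<Psi> n (q - 1) j * (if k \<le> j then 1 else 0)) / order_mean \<Psi> n q) at_top"
    by (rule AE_repair_reward_rate) (simp add: due_Suc_iff)
  then show ?thesis
    using AE_S_tendsto
  proof eventually_elim
    case (elim w)
    then have reg: "regular w" and lim: "(\<lambda>m. S w m / real m) \<longlonglongrightarrow> order_mean \<Psi> n q" by auto
    have "eventually (\<lambda>t. (\<Sum>m\<in>repairs_until L E n k r t w. if due_to_system_failure L E n k r m w then 1 else 0) / t =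
        real (card (system_failures_until L E n k r t w)) / t) at_top"
      using eventually_ge_at_top[of 0]
    proof eventually_elim
      case (elim t)
      have "finite (repairs_until L E n k r t w)"
        unfolding repairs_until_eq[OF reg elim]
        by (subst renewal_rate(1)[OF S_simps(1) S_mono[OF reg] expectation_passage_time(2) lim elim]) simp
      then show ?case by (simp add: system_failures_until_def sum.inter_filter[symmetric])
    qed
    with elim(1) show ?case unfolding p_eq_sum by (rule Lim_transform_eventually)
  qed
qed

lemma nn_integral_no_failure:
  "(\<integral>\<^sup>+ w. (\<Prod>l<m. ennreal (if CN l w < k then 1 else 0)) \<partial>M) = ennreal (1 - p) ^ m"
proof -
  let ?\<psi> = "\<lambda>j. if j < k then 1 else 0 :: real"
  have "0 < \<Psi> 1" using \<Psi>_pos[of 1] by simp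
  have "(\<integral>\<^sup>+ w. (\<Prod>l<m. ennreal (exp (0 * CT l w) * ?\<psi> (CN l w))) \<partial>M) =
      (\<integral>\<^sup>+ w. ennreal (?\<psi> (N w)) \<partial>M) ^ m * emeasure M (space M)"
  proof (rule nn_integral_cycle_prod[OF \<open>0 < \<Psi> 1\<close>])
    fix M' :: "'a measure" and L' X' assume R: "repair_system M' L' X' n q \<Psi>"
    interpret R: repair_system M' L' X' n q \<Psi> by (rule R)
    show "(\<integral>\<^sup>+ w. ennreal (exp (0 * passage_time L' X' n q w) * ?\<psi> (passage_count L' X' n q w)) \<partial>M') =
      (\<integral>\<^sup>+ w. ennreal (?\<psi> (N w)) \<partial>M) * emeasure M' (space M')"
      using R.nn_integral_passage_count[of ?\<psi>] nn_integral_passage_count[of ?\<psi>]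
      by (simp add: mass_1 R.emeasure_eq_measure mult.commute)
  qed simp
  moreover have "(\<integral>\<^sup>+ w. ennreal (?\<psi> (N w)) \<partial>M) = ennreal (1 - p)"
  proof -
    have "(\<integral>\<^sup>+ w. ennreal (?\<psi> (N w)) \<partial>M) = (\<integral>\<^sup>+ w. indicator {w \<in> space M. \<not> k \<le> N w} w \<partial>M)"
      by (intro nn_integral_cong) (auto simp: indicator_def)
    also have "\<dots> = emeasure M {w \<in> space M. \<not> k \<le> N w}" by (intro nn_integral_indicator) measurable
    also have "\<dots> = ennreal (measure M {w \<in> space M. \<not> k \<le> N w})" by (simp add: emeasure_eq_measure)
    also have "measure M {w \<in> space M. \<not> k \<le> N w} = 1 - p"
      unfolding p_eq_measure by (rule prob_neg) measurable
    finally show ?thesis .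
  qed
  ultimately show ?thesis by (simp add: emeasure_space_1)
qed

text \<open>Cycle \<open>m\<close> counts towards the first system failure iff no earlier cycle
  ended in one. Its expected length on this event is \<open>(1 - p) ^ m\<close> times the mean
  length, so the total is a geometric series.\<close>

theorem nn_integral_first_system_failure:
  "(\<integral>\<^sup>+ w. first_system_failure_time L E n k r w \<partial>M) =
    (if p = 0 then \<infinity> else ennreal (order_mean \<Psi> n q) / ennreal p)"
proof -
  let ?G = "\<lambda>w m. \<Prod>l<m. ennreal (if CN l w < k then 1 else 0)"
  have G: "?G w m = (if \<forall>l<m. CN l w < k then 1 else 0)" for w m
    by (induction m) (auto simp: less_Suc_eq)
  have first: "first_system_failure_time L E n k r w = Inf {ennreal (S w (Suc l)) | l. k \<le> CN l w}" if reg: "regular w" for w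
  proof -
    have "{repair_time L E n k r m w | m. 1 \<le> m \<and> due_to_system_failure L E n k r m w} =
        {ennreal (S w (Suc l)) | l. k \<le> CN l w}"
    proof (intro set_eqI iffI)
      fix y assume "y \<in> {repair_time L E n k r m w | m. 1 \<le> m \<and> due_to_system_failure L E n k r m w}"
      then obtain m where m: "y = repair_time L E n k r m w" "1 \<le> m" "due_to_system_failure L E n k r m w" by blast
      then obtain l where "m = Suc l" by (cases m) auto
      then show "y \<in> {ennreal (S w (Suc l)) | l. k \<le> CN l w}"
        using m due_Suc_iff[OF reg, of l] repair_time_eq[OF reg, of "Suc l"]
        by (auto simp del: repair_time.simps)
    next
      fix y assume "y \<in> {ennreal (S w (Suc l)) | l. k \<le> CN l w}"
      then obtain l where l: "y = ennreal (S w (Suc l))" "k \<le> CN l w" by blast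
      then have "y = repair_time L E n k r (Suc l) w" "due_to_system_failure L E n k r (Suc l) w"
        using due_Suc_iff[OF reg] repair_time_eq[OF reg] by (simp_all del: repair_time.simps)
      moreover have "1 \<le> Suc l" by simp
      ultimately show "y \<in> {repair_time L E n k r m w | m. 1 \<le> m \<and> due_to_system_failure L E n k r m w}" by blast
    qed
    then show ?thesis unfolding first_system_failure_time_def by (rule arg_cong)
  qed
  show ?thesis
  proof (cases "p = 0")
    case True
    \<comment> \<open>Almost surely no cycle ends in a system failure, and the infimum of the empty
      set is infinite.\<close>
    have never: "AE w in M. \<forall>m. CN m w < k"
      unfolding AE_all_countable
    proof
      fix m
      let ?B = "{w \<in> space M. \<forall>l<Suc m. CN l w < k}"
      have "(\<integral>\<^sup>+ w. ?G w (Suc m) \<partial>M) = (\<integral>\<^sup>+ w. indicator ?B w \<partial>M)"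
        unfolding G by (intro nn_integral_cong) (auto simp: indicator_def)
      also have "\<dots> = emeasure M ?B" by (intro nn_integral_indicator) measurable
      finally have "emeasure M ?B = 1" using nn_integral_no_failure[of "Suc m"] True by simp
      then have "measure M ?B = 1" by (simp add: emeasure_eq_measure)
      then have "AE w in M. w \<in> ?B" by (rule AE_prob_1)
      then show "AE w in M. CN m w < k" by eventually_elim auto
    qed
    have "(\<integral>\<^sup>+ w. first_system_failure_time L E n k r w \<partial>M) = (\<integral>\<^sup>+ w. \<infinity> \<partial>M)"
    proof (rule nn_integral_cong_AE)
      show "AE w in M. first_system_failure_time L E n k r w = \<infinity>"
        using never AE_regular
      proof eventually_elim
        case (elim w)
        then have "{ennreal (S w (Suc l)) | l. k \<le> CN l w} = {}" by (auto simp: not_le)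
        then show ?case unfolding first[OF elim(2)] by (simp only: Inf_empty infinity_ennreal_def)
      qed
    qed
    then show ?thesis using True by (simp add: emeasure_space_1)
  next
    case False
    then have p: "0 < p" using p_bounds by simp
    \<comment> \<open>The long-run proportion of cycles ending in a system failure is
      \<open>p > 0\<close>, so there is at least one.\<close>
    have ex: "AE w in M. \<exists>l. k \<le> CN l w"
      using AE_mean_cycle_count[of "\<lambda>j. if k \<le> j then 1 else 0"]
    proof eventually_elim
      case (elim w)
      show ?case
      proof (rule ccontr)
        assume "\<not> (\<exists>l. k \<le> CN l w)"
        then have "(\<lambda>m. (\<Sum>l<m. if k \<le> CN l w then 1 else 0 :: real) / real m) = (\<lambda>m. 0)" by simp
        with elim have "(\<lambda>m. 0 :: real) \<longlonglongrightarrow> p" unfolding p_eq_sum by simp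
        then show False using p by (simp add: LIMSEQ_const_iff)
      qed
    qed
    have "(\<integral>\<^sup>+ w. first_system_failure_time L E n k r w \<partial>M) =
        (\<integral>\<^sup>+ w. (\<Sum>m. ?G w m * passage (CP m) (CX m) n q w) \<partial>M)"
    proof (rule nn_integral_cong_AE)
      show "AE w in M. first_system_failure_time L E n k r w = (\<Sum>m. ?G w m * passage (CP m) (CX m) n q w)"
        using ex AE_regular
      proof eventually_elim
        case (elim w)
        then have reg: "regular w" by simp
        define l where "l = (LEAST l. k \<le> CN l w)"
        have l: "k \<le> CN l w" "\<And>j. j < l \<Longrightarrow> CN j w < k"
          unfolding l_def using elim(1) by (auto intro: LeastI dest: not_less_Least simp: not_le)
        \<comment> \<open>Cycle \<open>l\<close> itself still counts, since the failure occurs at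
          its end.\<close>
        have G': "?G w m = (if m < Suc l then 1 else 0)" for m
        proof (cases "m \<le> l")
          case True
          then have "\<forall>j<m. CN j w < k" using l(2) by auto
          then show ?thesis unfolding G using True by simp
        next
          case False
          then have "\<not> (\<forall>j<m. CN j w < k)" using l(1) by (auto intro!: exI[of _ l])
          then show ?thesis unfolding G using False by simp
        qed
        have "first_system_failure_time L E n k r w = ennreal (S w (Suc l))"
          unfolding first[OF reg]
        proof (rule antisym)
          show "Inf {ennreal (S w (Suc l)) | l. k \<le> CN l w} \<le> ennreal (S w (Suc l))"
            using l by (intro Inf_lower) auto
          show "ennreal (S w (Suc l)) \<le> Inf {ennreal (S w (Suc l)) | l. k \<le> CN l w}"
          proof (rule Inf_greatest, clarify)
            fix j assume "k \<le> CN j w"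
            then have "l \<le> j" using l(2)[of j] by linarith
            then show "ennreal (S w (Suc l)) \<le> ennreal (S w (Suc j))"
              by (intro ennreal_leI monoD[OF S_mono[OF reg]]) simp
          qed
        qed
        also have "\<dots> = (\<Sum>m<Suc l. ennreal (CT m w))"
          unfolding S_def using reg by (intro sum_ennreal[symmetric]) (auto simp: regular_def less_imp_le)
        also have "\<dots> = (\<Sum>m<Suc l. ?G w m * passage (CP m) (CX m) n q w)"
          unfolding G' using reg by (intro sum.cong) (auto simp: regular_def)
        also have "\<dots> = (\<Sum>m. ?G w m * passage (CP m) (CX m) n q w)"
          unfolding G' by (rule suminf_finite[symmetric]) auto
        finally show ?case .
      qed
    qed
    also have "\<dots> = (\<Sum>m. \<integral>\<^sup>+ w. ?G w m * passage (CP m) (CX m) n q w \<partial>M)"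
    proof (rule nn_integral_suminf)
      fix m
      interpret R: repair_system M "CP m" "CX m" n q \<Psi> by (rule cycle_repair_system)
      note [measurable] = R.passage_measurable
      show "(\<lambda>w. ?G w m * passage (CP m) (CX m) n q w) \<in> borel_measurable M" by measurable
    qed
    also have "\<dots> = (\<Sum>m. ennreal ((1 - p) ^ m * order_mean \<Psi> n q))"
    proof (intro arg_cong[where f = suminf] ext)
      fix m
      have "(\<integral>\<^sup>+ w. ?G w m * passage (CP m) (CX m) n q w \<partial>M) = ennreal (1 - p) ^ m * ennreal (order_mean \<Psi> n q)"
        using nn_integral_weighted_passage[where m = m and \<psi> = "\<lambda>j. if j < k then 1 else 0"]
        by (simp add: nn_integral_no_failure)
      then show "(\<integral>\<^sup>+ w. ?G w m * passage (CP m) (CX m) n q w \<partial>M) = ennreal ((1 - p) ^ m * order_mean \<Psi> n q)"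
        using p_bounds expectation_passage_time(2) by (simp add: ennreal_power ennreal_mult)
    qed
    also have "\<dots> = ennreal (order_mean \<Psi> n q / p)"
    proof (rule suminf_ennreal_eq)
      show "0 \<le> (1 - p) ^ m * order_mean \<Psi> n q" for m
        using p_bounds expectation_passage_time(2) by simp
      have "(\<lambda>m. (1 - p) ^ m) sums (1 / (1 - (1 - p)))"
        using p p_bounds by (intro geometric_sums) simp
      then show "(\<lambda>m. (1 - p) ^ m * order_mean \<Psi> n q) sums (order_mean \<Psi> n q / p)"
        using sums_mult2[of "\<lambda>m. (1 - p) ^ m" "1 / p" "order_mean \<Psi> n q"] by simp
    qed
    also have "\<dots> = ennreal (order_mean \<Psi> n q) / ennreal p"
      using p expectation_passage_time(2) by (simp add: divide_ennreal)
    finally show ?thesis using False by simp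
  qed
qed

end

theorem proposition2p1:
  fixes M :: "'a measure"
    and L :: "real \<Rightarrow> 'a \<Rightarrow> real"
    and eps :: "nat \<Rightarrow> 'a \<Rightarrow> real"
    and E :: "nat \<Rightarrow> nat \<Rightarrow> 'a \<Rightarrow> real"
    and n k r :: nat
    and c_cmp :: "nat \<Rightarrow> real"
    and c_sys :: real
  assumes "levy_subordinator M L"
    and "iid_std_exp_indep_of M L {1..n} eps"
    and "iid_std_exp_indep_of M L ({1..n} \<times> UNIV) (\<lambda>(i, m). E i m)"
    and "n > 1" and "1 \<le> k" and "k \<le> n" and "1 \<le> r" and "r \<le> n"
  shows "let \<Psi> = laplace_exponent M L;
             p = prob_first_repair_system_failure M L E n k r;
             q = min k r;
             ET = mean_order_stat M L eps n
    in
      (if k > r then p = F_prob_range \<Psi> n (r - 1) k n else p = 1)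
      \<and>
      (AE \<omega> in M. ((\<lambda>t. cumulative_cost c_cmp c_sys L E n k r t \<omega> / t) \<longlongrightarrow>
          (p * c_sys + (\<Sum>j = q..n. F_prob \<Psi> n (q - 1) j * c_cmp j)) / enn2real (ET q)) at_top)
      \<and>
      (\<forall>m\<in>{1..n}. ET m = ennreal (\<Sum>i = n - m + 1..n.
          real (n choose i) * real (i - 1 choose (n - m)) * (- 1) ^ (i + m - n - 1) / \<Psi> (real i)))
      \<and>
      (\<integral>\<^sup>+ \<omega>. repair_time L E n k r 1 \<omega> \<partial>M) = ET q
      \<and>
      (\<integral>\<^sup>+ \<omega>. first_system_failure_time L E n k r \<omega> \<partial>M) =
        (if p = 0 then \<infinity> else ET q / ennreal p)
      \<and>
      (AE \<omega> in M. ((\<lambda>t. real (card (repairs_until L E n k r t \<omega>)) / t) \<longlongrightarrow>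
          1 / enn2real (ET q)) at_top)
      \<and>
      (AE \<omega> in M. ((\<lambda>t. real (card (system_failures_until L E n k r t \<omega>)) / t) \<longlongrightarrow>
          p / enn2real (ET q)) at_top)
      \<and>
      (AE \<omega> in M. ((\<lambda>t. real (card (component_failures_until L E n k r t \<omega>)) / t) \<longlongrightarrow>
          (\<Sum>j = 1..n. F_prob \<Psi> n (q - 1) j * real j) / enn2real (ET q)) at_top)"
proof -
  interpret subordinator M L by unfold_locales (rule assms(1))
  let ?q = "min k r"
  have q: "1 \<le> ?q" "?q \<le> n" using assms by auto
  have fs: "frailty_system M L (\<lambda>x. (\<lambda>(i, m). E i m) (id x)) ({1..n} \<times> UNIV) n ?q \<Psi>"
    by (rule frailty_system_of_iid[OF assms(3)]) (use q in auto)
  interpret R: repair_paths M L E n k r \<Psi>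
    using fs by (intro repair_paths.intro repair_process.intro repair_system.intro repair_process_axioms.intro)
      (simp_all add: prob_space)
  have ET: "mean_order_stat M L eps n m = ennreal (order_mean \<Psi> n m)" if "m \<in> {1..n}" for m
    using that by (intro mean_order_stat_eq[OF assms(2)]) auto
  have ETq: "mean_order_stat M L eps n ?q = ennreal (order_mean \<Psi> n ?q)" using q by (intro ET) simp
  have pos: "0 < order_mean \<Psi> n ?q" by (rule R.expectation_passage_time(2))
  then have real: "enn2real (mean_order_stat M L eps n ?q) = order_mean \<Psi> n ?q" by (simp add: ETq)
  \<comment> \<open>Below \<open>?q\<close> the entries of \<open>F_prob\<close> are zero, so it
    does not matter whether the sum starts at 1 or at \<open>?q\<close>.\<close>
  have comp: "(\<Sum>j = 1..n. F_prob \<Psi> n (?q - 1) j * real j) = (\<Sum>j = ?q..n. F_prob \<Psi> n (?q - 1) j * real j)"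
    using q by (intro sum.mono_neutral_right) (auto simp: F_prob_eq_sum)
  have first: "(\<integral>\<^sup>+ w. repair_time L E n k r 1 w \<partial>M) = mean_order_stat M L eps n ?q"
    unfolding R.repair_time_1 ETq using R.nn_integral_passage by (simp add: prob_space)
  show ?thesis
    unfolding Let_def real comp
    by (intro conjI ballI R.p_cases R.AE_cost_rate ET[unfolded order_mean_def] first
        R.nn_integral_first_system_failure[folded ETq] R.AE_repair_rate R.AE_system_failure_rate
        R.AE_component_failure_rate)
qed

end
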